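(* Let $\mathcal{F}$ be a singular holomorphic foliation on $\overline{\mathbb{C}} \times \overline{\mathbb{C}}^n$ given by a polynomial vector field $X$ in affine coordinates $(x,y) \in \mathbb{C} \times \mathbb{C}^n$, $y=(y_1,\dots,y_n)$. Suppose $\mathcal{F}$ is transverse to almost every fiber of the bundle $\eta$ with projection $\pi: \overline{\mathbb{C}} \times \overline{\mathbb{C}}^n \to \overline{\mathbb{C}}$, $\pi(z_1,z_2)= z_1$. Then $\mathcal{F}$ is a Riccati foliation and $$X(x,y)=p(x)\frac{\partial}{\partial x}+\bigl(q_{1,2}(x) y_1^2 + q_{1,1}(x) y_1 + q_{1,0}(x)\bigr)\frac{\partial}{\partial y_1}+\cdots+\bigl(q_{n,2}(x)y_n^2 + q_{n,1}(x) y_n + q_{n,0}(x)\bigr)\frac{\partial}{\partial y_n},$$ where $p$ and the $q_{i,j}$ ($1\le i\le n$, $0\le j\le 2$) are polynomials in $\mathbb{C}[x]$.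
   Context: $\overline{\mathbb{C}}=\mathbb{C}\cup\{\infty\}$ is the Riemann sphere and $\overline{\mathbb{C}}^n$ is the product of $n$ copies of it; $\mathbb{C}\times\mathbb{C}^n\hookrightarrow\overline{\mathbb{C}}\times\overline{\mathbb{C}}^n$ is the standard affine chart. All foliations are holomorphic, possibly singular, and one-dimensional; a foliation given by a polynomial vector field $X$ in an affine chart is the one on the compact manifold whose leaves in that chart are tangent to $X$. Let $\eta=(E,\pi,B,F)$ be a holomorphic fibre bundle with total space $E$, projection $\pi:E\to B$ and fiber $F$. A (nonsingular) holomorphic foliation $\mathcal{F}$ on $E$ is transverse to $\eta$ if: (1) for each $p\in E$ the leaf $L_p$ of $\mathcal{F}$ through $p$ is transverse to the fiber $\pi^{-1}(\pi(p))$; (2) $\dim \mathcal{F}+\dim F=\dim E$; (3) for each leaf $L$ of $\mathcal{F}$, the restriction $\pi|_L:L\to B$ is a covering map (if $F$ is compact, (3) follows from (1) and (2)). A singular holomorphic foliation $\mathcal{F}$ on $E$ is transverse to almost every fiber of $\eta$ if there is a proper analytic subset $\Lambda(\mathcal{F})\subset E$, a union of fibers of $\eta$, such that the restriction $\mathcal{F}_0$ of $\mathcal{F}$ to $E_0=E\smallsetminus\Lambda(\mathcal{F})$ is (nonsingular and) transverse to the subbundle $\eta_0$ of $\eta$ with total space $E_0$. If $\Lambda(\mathcal{F})$ is minimal with this property it is called the exceptional set of $\mathcal{F}$. A Riccati foliation is a foliation transverse to almost every fiber of $\eta$ whose exceptional set $\Lambda(\mathcal{F})$ is $\mathcal{F}$-invariant.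 Here $E=\overline{\mathbb{C}}\times\overline{\mathbb{C}}^n$, $B=\overline{\mathbb{C}}$, $F=\overline{\mathbb{C}}^n$. *)

theory Defs
  imports "HOL-Analysis.Analysis" "HOL-Computational_Algebra.Polynomial"
begin

section \<open>The Riemann sphere and the product of the base with the fibre\<close>

text \<open>The Riemann sphere is \<open>complex option\<close>, with \<open>None\<close> as the point at infinity.\<close>

definition sphere_topology :: "complex option topology" where
  "sphere_topology = Alexandroff_compactification euclidean"

type_synonym 'n affine = "complex \<times> (complex ^ 'n)"
type_synonym 'n total = "complex option \<times> ((complex option) ^ 'n)"

text \<open>
  The two standard charts of the sphere, as parametrizations by the complex plane: \<open>t\<close> is sent to
  the point \<open>t\<close> (chart \<open>False\<close>) or to the point \<open>1 / t\<close>, with \<open>0\<close> sent to infinity (chart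
  \<open>True\<close>). Products of these give the standard holomorphic atlas of the total space, which has one
  chart for each choice of a sphere chart in every coordinate. A subset of the total space is open
  iff its preimages under all these parametrizations are open.
\<close>

definition sphere_chart :: "bool \<Rightarrow> complex \<Rightarrow> complex option" where
  "sphere_chart b t = (if b then (if t = 0 then None else Some (1 / t)) else Some t)"

type_synonym 'n chart_id = "bool \<times> ('n \<Rightarrow> bool)"

definition chart :: "'n::finite chart_id \<Rightarrow> 'n affine \<Rightarrow> 'n total" where
  "chart c z = (sphere_chart (fst c) (fst z), \<chi> i. sphere_chart (snd c i) (snd z $ i))"

definition affine_chart :: "'n::finite chart_id" where
  "affine_chart = (False, \<lambda>_. False)"

text \<open>Only meaningful at the points \<open>z\<close> with \<open>chart c z\<close> in the range of \<open>chart c'\<close>.\<close>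

definition transition ::
    "'n::finite chart_id \<Rightarrow> 'n chart_id \<Rightarrow> 'n affine \<Rightarrow> 'n affine" where
  "transition c c' z = inv (chart c') (chart c z)"

section \<open>Holomorphic functions and analytic sets\<close>

definition cscale :: "complex \<Rightarrow> 'n::finite affine \<Rightarrow> 'n affine" where
  "cscale a v = (a * fst v, a *s snd v)"

definition holomorphic_fun :: "('n::finite affine \<Rightarrow> complex) \<Rightarrow> 'n affine set \<Rightarrow> bool" where
  "holomorphic_fun f U \<longleftrightarrow> open U \<and>
     (\<forall>z\<in>U. \<exists>D. (f has_derivative D) (at z) \<and> (\<forall>a v. D (cscale a v) = a * D v))"

definition holomorphic_field :: "('n::finite affine \<Rightarrow> 'n affine) \<Rightarrow> 'n affine set \<Rightarrow> bool" where
  "holomorphic_field Z U \<longleftrightarrow>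
     holomorphic_fun (\<lambda>z. fst (Z z)) U \<and> (\<forall>i. holomorphic_fun (\<lambda>z. snd (Z z) $ i) U)"

definition analytic_subset :: "'n::finite total set \<Rightarrow> bool" where
  "analytic_subset A \<longleftrightarrow>
     (\<forall>c z. \<exists>U \<Phi>. open U \<and> z \<in> U \<and> finite \<Phi> \<and> (\<forall>f\<in>\<Phi>. holomorphic_fun f U) \<and>
        {w \<in> U. chart c w \<in> A} = {w \<in> U. \<forall>f\<in>\<Phi>. f w = 0})"

section \<open>Singular one-dimensional foliations\<close>

text \<open>
  A foliation is given by local generators: a triple \<open>(c, U, Z)\<close> is a holomorphic vector field
  \<open>Z\<close> on an open set \<open>U\<close> of the coordinate space of the chart \<open>c\<close>. Two generators are compatible
  if, on the overlap of their domains, they differ by a holomorphic factor without zeros.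
  The singular points are the zeros of the generators. Generators must not vanish identically on a
  nonempty open set; their zero sets may or may not have codimension at least two, so that
  the foliations usually called saturated are included as a special case.
\<close>

type_synonym 'n local_field = "'n chart_id \<times> 'n affine set \<times> ('n affine \<Rightarrow> 'n affine)"

fun compatible :: "'n::finite local_field \<Rightarrow> 'n local_field \<Rightarrow> bool" where
  "compatible (c, U, Z) (c', U', Z') \<longleftrightarrow>
     (let W = {z \<in> U. chart c z \<in> chart c' ` U'} in
      \<exists>g. holomorphic_fun g W \<and>
        (\<forall>z\<in>W. g z \<noteq> 0 \<and>
           Z' (transition c c' z) =
             cscale (g z) (frechet_derivative (transition c c') (at z) (Z z))))"

definition singular_foliation :: "'n::finite local_field set \<Rightarrow> bool" where
  "singular_foliation \<F> \<longleftrightarrow>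
     (\<forall>(c, U, Z)\<in>\<F>. open U \<and> holomorphic_field Z U \<and> interior {z \<in> U. Z z = 0} = {}) \<and>
     (\<Union>(c, U, Z)\<in>\<F>. chart c ` U) = UNIV \<and>
     (\<forall>A\<in>\<F>. \<forall>B\<in>\<F>. compatible A B)"

definition sing :: "'n::finite local_field set \<Rightarrow> 'n total set" where
  "sing \<F> = (\<Union>(c, U, Z)\<in>\<F>. chart c ` {z \<in> U. Z z = 0})"

text \<open>
  The leaf topology of the restriction of the foliation to an open set \<open>W\<close>: it is generated by the
  images of the nonconstant integral curves (with complex time) of the generators. The underlying
  set is the regular part of \<open>W\<close>; the leaves, with their intrinsic topology as
  immersed Riemann surfaces, are the connected components.
\<close>

definition leaf_topology :: "'n::finite local_field set \<Rightarrow> 'n total set \<Rightarrow> 'n total topology" where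
  "leaf_topology \<F> W = topology_generated_by
     {chart c ` \<gamma> ` D | c U Z \<gamma> D. (c, U, Z) \<in> \<F> \<and> open D \<and> \<gamma> ` D \<subseteq> U \<and> chart c ` \<gamma> ` D \<subseteq> W \<and>
        (\<forall>t\<in>D. Z (\<gamma> t) \<noteq> 0 \<and> (\<gamma> has_derivative (\<lambda>h. cscale h (Z (\<gamma> t)))) (at t))}"

definition leaves :: "'n::finite local_field set \<Rightarrow> 'n total set \<Rightarrow> 'n total set set" where
  "leaves \<F> W = connected_components_of (leaf_topology \<F> W)"

definition invariant_under :: "'n::finite local_field set \<Rightarrow> 'n total set \<Rightarrow> bool" where
  "invariant_under \<F> A \<longleftrightarrow> (\<forall>L\<in>leaves \<F> UNIV. L \<inter> A \<noteq> {} \<longrightarrow> L \<subseteq> A)"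

section \<open>Transversality to the fibres of the first projection\<close>

text \<open>The analogue of \<^const>\<open>covering_space\<close> for abstract topologies.\<close>

definition covering_map :: "'a topology \<Rightarrow> 'b topology \<Rightarrow> ('a \<Rightarrow> 'b) \<Rightarrow> bool" where
  "covering_map X Y p \<longleftrightarrow> continuous_map X Y p \<and> p ` topspace X = topspace Y \<and>
     (\<forall>y\<in>topspace Y. \<exists>T. y \<in> T \<and> openin Y T \<and>
        (\<exists>\<V>. \<Union>\<V> = {x \<in> topspace X. p x \<in> T} \<and> (\<forall>V\<in>\<V>. openin X V) \<and> pairwise disjnt \<V> \<and>
           (\<forall>V\<in>\<V>. homeomorphic_map (subtopology X V) (subtopology Y T) p)))"

text \<open>
  The second conjunct says that, at every point over which the generator \<open>Z\<close> is defined, the tangent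
  line of the leaf and the tangent space of the fibre (the vertical vectors, in any of the product
  charts) span the tangent space. The condition that the dimensions of the foliation
  and of the fibre add up to that of the total space holds by construction.
\<close>

definition transverse_on :: "'n::finite local_field set \<Rightarrow> 'n total set \<Rightarrow> bool" where
  "transverse_on \<F> E\<^sub>0 \<longleftrightarrow>
     E\<^sub>0 \<inter> sing \<F> = {} \<and>
     (\<forall>(c, U, Z)\<in>\<F>. \<forall>z\<in>U. chart c z \<in> E\<^sub>0 \<longrightarrow> {cscale a (Z z) + v | a v. fst v = 0} = UNIV) \<and>
     (\<forall>L\<in>leaves \<F> E\<^sub>0.
        covering_map (subtopology (leaf_topology \<F> E\<^sub>0) L) (subtopology sphere_topology (fst ` E\<^sub>0)) fst)"

definition transverse_off :: "'n::finite local_field set \<Rightarrow> 'n total set \<Rightarrow> bool" where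
  "transverse_off \<F> \<Lambda> \<longleftrightarrow>
     analytic_subset \<Lambda> \<and> \<Lambda> \<noteq> UNIV \<and> (\<exists>S. \<Lambda> = fst -` S) \<and> transverse_on \<F> (- \<Lambda>)"

definition transverse_to_almost_every_fiber :: "'n::finite local_field set \<Rightarrow> bool" where
  "transverse_to_almost_every_fiber \<F> \<longleftrightarrow> (\<exists>\<Lambda>. transverse_off \<F> \<Lambda>)"

definition exceptional_set :: "'n::finite local_field set \<Rightarrow> 'n total set \<Rightarrow> bool" where
  "exceptional_set \<F> \<Lambda> \<longleftrightarrow> transverse_off \<F> \<Lambda> \<and> (\<forall>\<Lambda>'. transverse_off \<F> \<Lambda>' \<longrightarrow> \<not> \<Lambda>' \<subset> \<Lambda>)"

definition riccati_foliation :: "'n::finite local_field set \<Rightarrow> bool" where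
  "riccati_foliation \<F> \<longleftrightarrow>
     singular_foliation \<F> \<and> transverse_to_almost_every_fiber \<F> \<and>
     (\<exists>\<Lambda>. exceptional_set \<F> \<Lambda>) \<and> (\<forall>\<Lambda>. exceptional_set \<F> \<Lambda> \<longrightarrow> invariant_under \<F> \<Lambda>)"

section \<open>Polynomial vector fields in the affine chart\<close>

text \<open>A pair \<open>(k, m)\<close> stands for the monomial with exponent \<open>k\<close> in \<open>x\<close> and \<open>m i\<close> in the \<open>i\<close>-th
  coordinate of \<open>y\<close>.\<close>

definition polynomial_fun :: "('n::finite affine \<Rightarrow> complex) \<Rightarrow> bool" where
  "polynomial_fun f \<longleftrightarrow> (\<exists>(M :: (nat \<times> ('n \<Rightarrow> nat)) set) a. finite M \<and>
     (\<forall>x y. f (x, y) = (\<Sum>(k, m)\<in>M. a (k, m) * x ^ k * (\<Prod>i\<in>UNIV. (y $ i) ^ m i))))"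

definition polynomial_field :: "('n::finite affine \<Rightarrow> 'n affine) \<Rightarrow> bool" where
  "polynomial_field X \<longleftrightarrow>
     polynomial_fun (\<lambda>z. fst (X z)) \<and> (\<forall>i. polynomial_fun (\<lambda>z. snd (X z) $ i))"

text \<open>
  \<open>X\<close> generates the foliation on the affine chart. Mere tangency of \<open>X\<close> to the leaves would be too
  weak: multiplying \<open>X\<close> by a function of \<open>y\<close> preserves it.
\<close>

definition given_by :: "'n::finite local_field set \<Rightarrow> ('n affine \<Rightarrow> 'n affine) \<Rightarrow> bool" where
  "given_by \<F> X \<longleftrightarrow> (\<forall>A\<in>\<F>. compatible (affine_chart, UNIV, X) A)"

end

theory Submission
  imports Defs "HOL-Complex_Analysis.Complex_Analysis"
    "HOL-Computational_Algebra.Fundamental_Theorem_Algebra"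
begin

text \<open>
  Call a base point vertical if some generator over it has vanishing \<open>x\<close>-component. Transversality
  off \<open>\<Lambda> = fst -` S\<close> forces the vertical points into \<open>S\<close>, and \<open>S\<close> is finite because a proper
  analytic subset of the sphere is.

  Over a nonvertical \<open>x\<close> the \<open>x\<close>-component of \<open>X\<close> is a polynomial in \<open>y\<close> without zeros, hence
  constant in \<open>y\<close>; comparing \<open>X\<close> with a generator near a point whose \<open>j\<close>-th fibre coordinate is
  infinite bounds the growth of the \<open>i\<close>-th component in \<open>y\<^sub>j\<close> by \<open>|y\<^sub>j|\<^sup>2\<close> if \<open>i = j\<close> and by a constant
  otherwise. This is the Riccati form, which extends to all \<open>x\<close> because it holds off a finite set.

  A zero of a holomorphic function of two variables is not isolated, so if one point of a fibre is
  vertical, so is every point of it, and the fibre is invariant. Near a nonvertical base point the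
  leaves are graphs of solutions of Riccati equations, which linearize and thus extend over a
  whole disc as a family of Moebius maps; these graphs trivialize the foliation, so the leaves cover
  the set of nonvertical base points. Therefore the vertical fibres form the least set off which
  the foliation is transverse, that is, the exceptional set.
\<close>

text \<open>Three obstacles shape the proof. Generators agree only up to a factor without zeros, so
  whatever is read off from them must survive such a factor: the vanishing of the base component
  does, and so does the quotient of a fibre component by the base speed, which carries the Riccati
  equation. Next, \<open>X\<close> can be compared with generators at finite points only, while
  leaves pass through points with infinite coordinates and the base point itself may be infinity;
  there the equation holds by continuity. Finally, \<open>leaf_topology\<close> is generated by
  integral curves with their own complex time, whereas solutions of the Riccati equation are graphs
  over the base coordinate, so one has to reparametrize in both directions. Homogeneous coordinates
  make a solution that blows up in the affine coordinate an ordinary one, which gives a single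
  radius for all initial points of the fibre. Solutions are needed only locally: the global part of
  the covering property is the connectedness of the sphere without a finite set.\<close>

no_notation fps_nth (infixl "$" 75)

section \<open>Holomorphic functions and linear differential equations\<close>

text \<open>A Gronwall argument on a disc with \<open>r * K' \<le> 1/2\<close>: by the mean value
  bound from \<open>t0\<close>, the maximum of \<open>norm (f t)\<close> is at most half of itself.
  It serves both for the uniqueness of Riccati solutions and for showing that integral curves do not
  leave a vertical fibre.\<close>

lemma vanishes_near_if_deriv_le:
  fixes f f' :: "complex \<Rightarrow> complex"
  assumes "open D" "t0 \<in> D" "f t0 = 0"
    and der: "\<And>t. t \<in> D \<Longrightarrow> (f has_field_derivative f' t) (at t)"
    and le: "\<And>t. t \<in> D \<Longrightarrow> norm (f' t) \<le> K * norm (f t)"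
  obtains r where "r > 0" "ball t0 r \<subseteq> D" "\<forall>t\<in>ball t0 r. f t = 0"
proof -
  obtain e where e: "e > 0" "cball t0 e \<subseteq> D"
    using assms open_contains_cball by meson
  define K' where "K' = max K 0 + 1"
  define r where "r = min e (1 / (2 * K'))"
  have K': "K' > 0" "K \<le> K'" by (auto simp: K'_def)
  have r: "r > 0" "r * K' \<le> 1/2"
    using e K' by (auto simp: r_def min_def field_simps)
  have "cball t0 r \<subseteq> cball t0 e" by (intro subset_cball) (simp add: r_def)
  with e have r: "r > 0" "r * K' \<le> 1/2" "cball t0 r \<subseteq> D" using r by auto
  have cont: "continuous_on (cball t0 r) (\<lambda>t. norm (f t))"
    by (intro continuous_intros continuous_at_imp_continuous_on)
      (use der r(3) in \<open>auto intro: DERIV_isCont\<close>)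
  obtain s where s: "s \<in> cball t0 r" "\<And>t. t \<in> cball t0 r \<Longrightarrow> norm (f t) \<le> norm (f s)"
    using continuous_attains_sup[OF compact_cball _ cont] r(1) by fastforce
  have "norm (f s - f t0) \<le> (K' * norm (f s)) * norm (s - t0)"
  proof (rule field_differentiable_bound)
    show "convex (cball t0 r)" by simp
    show "(f has_field_derivative f' z) (at z within cball t0 r)" if "z \<in> cball t0 r" for z
      using der r(3) that by (meson has_field_derivative_at_within subsetD)
    show "norm (f' z) \<le> K' * norm (f s)" if "z \<in> cball t0 r" for z
    proof -
      have "norm (f' z) \<le> K * norm (f z)" using le r(3) that by blast
      also have "\<dots> \<le> K' * norm (f z)" using K' by (intro mult_right_mono) auto
      also have "\<dots> \<le> K' * norm (f s)" using K' s(2)[OF that] by (intro mult_left_mono) auto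
      finally show ?thesis .
    qed
  qed (use s r in auto)
  also have "\<dots> \<le> K' * norm (f s) * r"
    using s(1) K' by (intro mult_left_mono) (auto simp: dist_norm norm_minus_commute)
  also have "\<dots> = (r * K') * norm (f s)" by simp
  also have "\<dots> \<le> 1/2 * norm (f s)" using r by (intro mult_right_mono) auto
  finally have "norm (f s) = 0" using assms(3) by simp
  then have "f t = 0" if "t \<in> ball t0 r" for t
    using s(2)[of t] that by auto
  with r that show ?thesis by (meson ball_subset_cball order_trans)
qed

section \<open>Local solution of linear systems of two equations by power series\<close>

fun linear_ode_coeff :: "(nat \<Rightarrow> complex) \<Rightarrow> (nat \<Rightarrow> complex) \<Rightarrow> (nat \<Rightarrow> complex) \<Rightarrow> (nat \<Rightarrow> complex) \<Rightarrow>
    complex \<times> complex \<Rightarrow> nat \<Rightarrow> complex \<times> complex" where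
  "linear_ode_coeff a b c d w 0 = w"
| "linear_ode_coeff a b c d w (Suc n) =
    ((\<Sum>k\<le>n. a k * fst (linear_ode_coeff a b c d w (n - k)) + b k * snd (linear_ode_coeff a b c d w (n - k))) / of_nat (Suc n),
     (\<Sum>k\<le>n. c k * fst (linear_ode_coeff a b c d w (n - k)) + d k * snd (linear_ode_coeff a b c d w (n - k))) / of_nat (Suc n))"

lemma fps_nth_geometric_bound:
  fixes F :: "complex fps"
  assumes "fps_conv_radius F > 0"
  obtains K R where "K > 0" "R > 0" "\<And>k. norm (fps_nth F k) \<le> K * R ^ k"
proof -
  obtain z :: real where z: "z > 0" "ereal z < fps_conv_radius F"
    using assms by (metis ereal_dense2 ereal_less(2))
  have "summable (\<lambda>n. norm (fps_nth F n * of_real z ^ n))"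
    using z by (intro norm_summable_fps) auto
  then have "Bseq (\<lambda>n. norm (fps_nth F n * of_real z ^ n))"
    using summable_LIMSEQ_zero convergent_imp_Bseq convergentI by blast
  then obtain K where K: "K > 0" "\<And>n. norm (norm (fps_nth F n * of_real z ^ n)) \<le> K"
    by (rule BseqE) blast
  have "norm (fps_nth F k) \<le> K * (1 / z) ^ k" for k
    using K(2)[of k] z by (simp add: norm_mult norm_power field_simps)
  with K z that[of K "1/z"] show thesis by simp
qed

text \<open>The induction step of the majorant method. Since \<open>R \<ge> 2 * R0\<close>, each of
  the two products in the \<open>k\<close>-th summand is at most
  \<open>K * M * R ^ n * (1/2) ^ k\<close>; the geometric series contributes a factor 2, and
  \<open>R \<ge> 4 * K\<close> absorbs the resulting \<open>4 * K\<close> into one more power of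
  \<open>R\<close>.\<close>

lemma linear_ode_step_bound:
  fixes a b u v :: "nat \<Rightarrow> complex"
  assumes pos: "K > 0" "R0 > 0" "R \<ge> 2 * R0" "R \<ge> 4 * K" "M \<ge> 0"
    and ab: "\<And>k. norm (a k) \<le> K * R0 ^ k" "\<And>k. norm (b k) \<le> K * R0 ^ k"
    and uv: "\<And>k. k \<le> n \<Longrightarrow> norm (u k) \<le> M * R ^ k" "\<And>k. k \<le> n \<Longrightarrow> norm (v k) \<le> M * R ^ k"
  shows "norm ((\<Sum>k\<le>n. a k * u (n - k) + b k * v (n - k)) / of_nat (Suc n)) \<le> M * R ^ Suc n"
proof -
  have R: "R > 0" using pos by linarith
  have "norm (a k * u (n - k) + b k * v (n - k)) \<le> 2 * K * M * R ^ n * (1/2) ^ k" if "k \<le> n" for k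
  proof -
    have "norm (a k * u (n - k)) \<le> (K * R0 ^ k) * (M * R ^ (n - k))"
      unfolding norm_mult by (intro mult_mono ab uv) (use pos R in auto)
    moreover have "norm (b k * v (n - k)) \<le> (K * R0 ^ k) * (M * R ^ (n - k))"
      unfolding norm_mult by (intro mult_mono ab uv) (use pos R in auto)
    ultimately have "norm (a k * u (n - k) + b k * v (n - k)) \<le> 2 * ((K * R0 ^ k) * (M * R ^ (n - k)))"
      using norm_triangle_ineq[of "a k * u (n - k)" "b k * v (n - k)"] by linarith
    also have "\<dots> \<le> 2 * ((K * (R/2) ^ k) * (M * R ^ (n - k)))"
      using pos R by (intro mult_left_mono mult_right_mono power_mono) auto
    also have "\<dots> = 2 * K * M * (R ^ k * R ^ (n - k)) * (1/2) ^ k"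
      by (simp add: power_divide)
    also have "R ^ k * R ^ (n - k) = R ^ n" using that by (simp flip: power_add)
    finally show ?thesis .
  qed
  then have "norm (\<Sum>k\<le>n. a k * u (n - k) + b k * v (n - k)) \<le> (\<Sum>k\<le>n. 2 * K * M * R ^ n * (1/2) ^ k)"
    by (intro sum_norm_le) auto
  also have "\<dots> = 2 * K * M * R ^ n * (\<Sum>k\<le>n. (1/2) ^ k)" by (simp add: sum_distrib_left)
  also have "\<dots> \<le> 2 * K * M * R ^ n * 2"
  proof (intro mult_left_mono)
    have "(\<Sum>k\<le>n. (1/2::real) ^ k) = 2 - (1/2)^n"
      by (induction n) auto
    then show "(\<Sum>k\<le>n. (1/2::real) ^ k) \<le> 2" by simp
  qed (use pos R in auto)
  also have "\<dots> = (4 * K) * (M * R ^ n)" by simp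
  also have "\<dots> \<le> R * (M * R ^ n)" using pos R by (intro mult_right_mono) auto
  finally have *: "norm (\<Sum>k\<le>n. a k * u (n - k) + b k * v (n - k)) \<le> M * R ^ Suc n"
    by (simp add: mult_ac)
  have "norm ((\<Sum>k\<le>n. a k * u (n - k) + b k * v (n - k)) / of_nat (Suc n))
      = norm (\<Sum>k\<le>n. a k * u (n - k) + b k * v (n - k)) / real (Suc n)"
    by (simp only: norm_divide norm_of_nat)
  also have "\<dots> \<le> norm (\<Sum>k\<le>n. a k * u (n - k) + b k * v (n - k)) / 1"
    by (intro divide_left_mono) auto
  finally show ?thesis using * by linarith
qed

lemma fps_conv_radius_pos_if_geometric:
  fixes F :: "complex fps"
  assumes "R > 0" "\<And>n. norm (fps_nth F n) \<le> M * R ^ n"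
  shows "fps_conv_radius F > 0"
proof -
  \<comment> \<open>At half of the radius suggested by the bound, the terms are dominated by
    \<open>M * (1/2) ^ n\<close>.\<close>
  have "summable (\<lambda>n. fps_nth F n * of_real (1 / (2 * R)) ^ n)"
  proof (rule summable_comparison_test')
    show "summable (\<lambda>n. M * (1/2::real) ^ n)" by (intro summable_mult summable_geometric) auto
    show "norm (fps_nth F n * of_real (1 / (2 * R)) ^ n) \<le> M * (1/2) ^ n" if "n \<ge> 0" for n
    proof -
      have "norm (fps_nth F n * of_real (1 / (2 * R)) ^ n) = norm (fps_nth F n) * (1 / (2 * R)) ^ n"
        using assms(1) by (simp add: norm_mult norm_power norm_divide)
      also have "\<dots> \<le> M * R ^ n * (1 / (2 * R)) ^ n"
        using assms by (intro mult_right_mono) auto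
      also have "\<dots> = M * (1/2) ^ n"
        using assms(1) by (simp add: power_divide field_simps)
      finally show ?thesis .
    qed
  qed
  then have "fps_conv_radius F \<ge> norm (complex_of_real (1 / (2 * R)))"
    unfolding fps_conv_radius_def by (rule conv_radius_geI)
  then have "ereal (1 / (2 * R)) \<le> fps_conv_radius F"
    using assms(1) by (simp add: norm_divide)
  moreover have "ereal (1 / (2 * R)) > 0" using assms(1) by simp
  ultimately show ?thesis by (meson less_le_trans)
qed

text \<open>Comparing coefficients in the system determines each coefficient from the earlier ones,
  after division by the factor that \<open>fps_deriv\<close> introduces; this is the recursion
  \<open>linear_ode_coeff\<close>. Its solution is bounded geometrically and hence
  converges.\<close>

lemma linear_ode_fps:
  fixes a b c d :: "complex fps"
  assumes "fps_conv_radius a > 0" "fps_conv_radius b > 0" "fps_conv_radius c > 0" "fps_conv_radius d > 0"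
  obtains u v where "fps_conv_radius u > 0" "fps_conv_radius v > 0"
    "fps_deriv u = a * u + b * v" "fps_deriv v = c * u + d * v"
    "fps_nth u 0 = u0" "fps_nth v 0 = v0"
proof -
  obtain Ka Ra where a: "Ka > 0" "Ra > 0" "\<And>k. norm (fps_nth a k) \<le> Ka * Ra ^ k"
    using fps_nth_geometric_bound[OF assms(1)] by metis
  obtain Kb Rb where b: "Kb > 0" "Rb > 0" "\<And>k. norm (fps_nth b k) \<le> Kb * Rb ^ k"
    using fps_nth_geometric_bound[OF assms(2)] by metis
  obtain Kc Rc where c: "Kc > 0" "Rc > 0" "\<And>k. norm (fps_nth c k) \<le> Kc * Rc ^ k"
    using fps_nth_geometric_bound[OF assms(3)] by metis
  obtain Kd Rd where d: "Kd > 0" "Rd > 0" "\<And>k. norm (fps_nth d k) \<le> Kd * Rd ^ k"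
    using fps_nth_geometric_bound[OF assms(4)] by metis
  \<comment> \<open>One pair \<open>K\<close>, \<open>R0\<close> majorizes all four coefficient
    series. \<open>R\<close> is as large as \<open>linear_ode_step_bound\<close> demands, and
    \<open>M\<close> bounds the initial values, with which the induction starts.\<close>
  define K where "K = Ka + Kb + Kc + Kd"
  define R0 where "R0 = Ra + Rb + Rc + Rd"
  define R where "R = 2 * R0 + 4 * K"
  define M where "M = norm u0 + norm v0"
  have pos: "K > 0" "R0 > 0" "R \<ge> 2 * R0" "R \<ge> 4 * K" "M \<ge> 0" "R > 0"
    using a b c d by (auto simp: K_def R0_def R_def M_def)
  have weaken: "x \<le> K * R0 ^ k" if "x \<le> L * S ^ k" "L > 0" "S > 0" "L \<le> K" "S \<le> R0" for x L S k
  proof -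
    have "L * S ^ k \<le> K * R0 ^ k"
      using that pos by (intro mult_mono power_mono) auto
    then show ?thesis using that by linarith
  qed
  have bnd: "norm (fps_nth a k) \<le> K * R0 ^ k" "norm (fps_nth b k) \<le> K * R0 ^ k"
    "norm (fps_nth c k) \<le> K * R0 ^ k" "norm (fps_nth d k) \<le> K * R0 ^ k" for k
    by (rule weaken[OF a(3)] weaken[OF b(3)] weaken[OF c(3)] weaken[OF d(3)];
        use a(1,2) b(1,2) c(1,2) d(1,2) in \<open>simp add: K_def R0_def\<close>)+
  define s where "s = linear_ode_coeff (fps_nth a) (fps_nth b) (fps_nth c) (fps_nth d) (u0, v0)"
  have sb: "norm (fst (s n)) \<le> M * R ^ n \<and> norm (snd (s n)) \<le> M * R ^ n" for n
  proof (induction n rule: less_induct)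
    case (less n)
    show ?case
    proof (cases n)
      case 0
      then show ?thesis by (simp add: s_def M_def)
    next
      case (Suc m)
      have IH: "norm (fst (s k)) \<le> M * R ^ k" "norm (snd (s k)) \<le> M * R ^ k" if "k \<le> m" for k
        using less Suc that by auto
      have "norm ((\<Sum>k\<le>m. fps_nth a k * fst (s (m - k)) + fps_nth b k * snd (s (m - k))) / of_nat (Suc m)) \<le> M * R ^ Suc m"
        by (rule linear_ode_step_bound[OF pos(1-5)]) (use bnd IH in auto)
      moreover have "norm ((\<Sum>k\<le>m. fps_nth c k * fst (s (m - k)) + fps_nth d k * snd (s (m - k))) / of_nat (Suc m)) \<le> M * R ^ Suc m"
        by (rule linear_ode_step_bound[OF pos(1-5)]) (use bnd IH in auto)
      ultimately show ?thesis
        by (simp only: Suc s_def linear_ode_coeff.simps fst_conv snd_conv)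
    qed
  qed
  define u where "u = Abs_fps (\<lambda>n. fst (s n))"
  define v where "v = Abs_fps (\<lambda>n. snd (s n))"
  have "fps_conv_radius u > 0" "fps_conv_radius v > 0"
    by (rule fps_conv_radius_pos_if_geometric[OF pos(6), of _ M]; use sb in \<open>simp add: u_def v_def\<close>)+
  moreover have "fps_deriv u = a * u + b * v"
  proof (rule fps_ext)
    fix n
    have "fps_nth (fps_deriv u) n = of_nat (Suc n) * fst (s (Suc n))"
      by (simp add: u_def)
    also have "\<dots> = (\<Sum>k\<le>n. fps_nth a k * fst (s (n - k)) + fps_nth b k * snd (s (n - k)))"
      unfolding s_def linear_ode_coeff.simps fst_conv times_divide_eq_right
      by (rule nonzero_mult_div_cancel_left) (simp del: of_nat_Suc)
    finally show "fps_nth (fps_deriv u) n = fps_nth (a * u + b * v) n"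
      by (simp add: fps_mult_nth u_def v_def sum.distrib atLeast0AtMost)
  qed
  moreover have "fps_deriv v = c * u + d * v"
  proof (rule fps_ext)
    fix n
    have "fps_nth (fps_deriv v) n = of_nat (Suc n) * snd (s (Suc n))"
      by (simp add: v_def)
    also have "\<dots> = (\<Sum>k\<le>n. fps_nth c k * fst (s (n - k)) + fps_nth d k * snd (s (n - k)))"
      unfolding s_def linear_ode_coeff.simps snd_conv times_divide_eq_right
      by (rule nonzero_mult_div_cancel_left) (simp del: of_nat_Suc)
    finally show "fps_nth (fps_deriv v) n = fps_nth (c * u + d * v) n"
      by (simp add: fps_mult_nth u_def v_def sum.distrib atLeast0AtMost)
  qed
  moreover have "fps_nth u 0 = u0" "fps_nth v 0 = v0" by (auto simp: u_def v_def s_def)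
  ultimately show ?thesis using that by blast
qed


lemma eventually_in_fps_conv_radius:
  fixes F :: "complex fps"
  assumes "fps_conv_radius F > 0"
  shows "eventually (\<lambda>z::complex. norm z < fps_conv_radius F) (nhds 0)"
proof -
  have "eventually (\<lambda>z. z \<in> eball (0::complex) (fps_conv_radius F)) (nhds 0)"
    by (rule eventually_nhds_in_open) (use assms in \<open>auto simp: zero_ereal_def\<close>)
  then show ?thesis by (simp add: in_eball_iff)
qed

lemma eval_fps_linear_combination:
  fixes a b u v :: "complex fps"
  assumes "norm z < fps_conv_radius a" "norm z < fps_conv_radius b"
    "norm z < fps_conv_radius u" "norm z < fps_conv_radius v"
  shows "eval_fps (a * u + b * v) z = eval_fps a z * eval_fps u z + eval_fps b z * eval_fps v z"
proof -
  have "norm z < fps_conv_radius (a * u)" "norm z < fps_conv_radius (b * v)"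
    using fps_conv_radius_mult[of a u] fps_conv_radius_mult[of b v] assms
    by (meson less_le_trans min_less_iff_conj)+
  then show ?thesis using assms by (simp add: eval_fps_add eval_fps_mult)
qed

text \<open>The formal solution becomes an actual one where all six series converge and the four
  coefficient functions equal their expansions. The radius may shrink in the process, which is
  harmless because covering maps are tested locally.\<close>

lemma linear_ode_2:
  fixes a b c d :: "complex \<Rightarrow> complex"
  assumes "r > 0" and hol: "a holomorphic_on ball t0 r" "b holomorphic_on ball t0 r"
    "c holomorphic_on ball t0 r" "d holomorphic_on ball t0 r"
  obtains \<rho> u v where "0 < \<rho>" "\<rho> \<le> r" "u t0 = u0" "v t0 = v0"
    "\<And>t. t \<in> ball t0 \<rho> \<Longrightarrow> (u has_field_derivative a t * u t + b t * v t) (at t)"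
    "\<And>t. t \<in> ball t0 \<rho> \<Longrightarrow> (v has_field_derivative c t * u t + d t * v t) (at t)"
proof -
  have ex: "(\<lambda>x. f (t0 + x)) has_fps_expansion fps_expansion f t0" if "f holomorphic_on ball t0 r" for f
    by (rule analytic_at_imp_has_fps_expansion)
      (use that assms(1) in \<open>auto simp: analytic_at intro!: exI[of _ "ball t0 r"]\<close>)
  define A where "A = fps_expansion a t0"
  define B where "B = fps_expansion b t0"
  define C where "C = fps_expansion c t0"
  define D where "D = fps_expansion d t0"
  have pos: "fps_conv_radius A > 0" "fps_conv_radius B > 0" "fps_conv_radius C > 0" "fps_conv_radius D > 0"
    and ev: "eventually (\<lambda>z. eval_fps A z = a (t0 + z)) (nhds 0)"
     "eventually (\<lambda>z. eval_fps B z = b (t0 + z)) (nhds 0)"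
     "eventually (\<lambda>z. eval_fps C z = c (t0 + z)) (nhds 0)"
     "eventually (\<lambda>z. eval_fps D z = d (t0 + z)) (nhds 0)"
    using ex[OF hol(1)] ex[OF hol(2)] ex[OF hol(3)] ex[OF hol(4)]
    by (auto simp: has_fps_expansion_def A_def B_def C_def D_def)
  obtain U V where UV: "fps_conv_radius U > 0" "fps_conv_radius V > 0"
    "fps_deriv U = A * U + B * V" "fps_deriv V = C * U + D * V"
    "fps_nth U 0 = u0" "fps_nth V 0 = v0"
    using linear_ode_fps[OF pos] by metis
  let ?P = "\<lambda>z. eval_fps A z = a (t0 + z) \<and> eval_fps B z = b (t0 + z) \<and>
     eval_fps C z = c (t0 + z) \<and> eval_fps D z = d (t0 + z) \<and>
     norm z < fps_conv_radius A \<and> norm z < fps_conv_radius B \<and> norm z < fps_conv_radius C \<and>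
     norm z < fps_conv_radius D \<and> norm z < fps_conv_radius U \<and> norm z < fps_conv_radius V"
  have "eventually ?P (nhds 0)"
    using ev eventually_in_fps_conv_radius[OF pos(1)] eventually_in_fps_conv_radius[OF pos(2)]
      eventually_in_fps_conv_radius[OF pos(3)] eventually_in_fps_conv_radius[OF pos(4)]
      eventually_in_fps_conv_radius[OF UV(1)] eventually_in_fps_conv_radius[OF UV(2)]
    by eventually_elim blast
  then obtain \<delta> where \<delta>: "\<delta> > 0" "\<And>z. norm z < \<delta> \<Longrightarrow> ?P z"
    unfolding eventually_nhds_metric dist_norm by auto
  define \<rho> where "\<rho> = min \<delta> r"
  define u where "u = (\<lambda>t. eval_fps U (t - t0))"
  define v where "v = (\<lambda>t. eval_fps V (t - t0))"
  have P: "?P (t - t0)" if "t \<in> ball t0 \<rho>" for t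
    using that by (intro \<delta>(2)) (auto simp: \<rho>_def dist_norm norm_minus_commute)
  have der: "((\<lambda>t. eval_fps F (t - t0)) has_field_derivative eval_fps (fps_deriv F) (t - t0)) (at t)"
    if "norm (t - t0) < fps_conv_radius F" for F :: "complex fps" and t
    by (rule DERIV_chain2[where Db=1, simplified])
      (use that in \<open>auto intro!: has_field_derivative_eval_fps derivative_eq_intros\<close>)
  have "(u has_field_derivative a t * u t + b t * v t) (at t)" if "t \<in> ball t0 \<rho>" for t
    using der[of t U] P[OF that] by (simp add: u_def v_def UV(3) eval_fps_linear_combination)
  moreover have "(v has_field_derivative c t * u t + d t * v t) (at t)" if "t \<in> ball t0 \<rho>" for t
    using der[of t V] P[OF that] by (simp add: u_def v_def UV(4) eval_fps_linear_combination)
  moreover have "u t0 = u0" "v t0 = v0" using UV by (auto simp: u_def v_def eval_fps_at_0)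
  moreover have "0 < \<rho>" "\<rho> \<le> r" using \<delta>(1) assms(1) by (auto simp: \<rho>_def)
  ultimately show ?thesis using that by blast
qed

text \<open>If the zero of \<open>f t0\<close> at 0 were isolated, \<open>f t0\<close> would be
  bounded away from 0 on a small circle, and by uniform continuity so would \<open>f t\<close> for
  \<open>t\<close> near \<open>t0\<close>. For \<open>t \<noteq> t0\<close> the inverse of
  \<open>f t\<close> is holomorphic inside, so the maximum principle carries the lower bound
  \<open>m / 2\<close> to the centre, contradicting continuity of \<open>f t 0\<close> at
  \<open>t0\<close>.\<close>

lemma no_isolated_zero_slice:
  fixes f :: "complex \<Rightarrow> complex \<Rightarrow> complex"
  assumes "r > 0" "R > 0"
    and cont: "continuous_on (ball t0 r \<times> ball 0 R) (\<lambda>(t, s). f t s)"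
    and hol: "\<And>t. t \<in> ball t0 r \<Longrightarrow> f t holomorphic_on ball 0 R"
    and nz: "\<And>t s. t \<in> ball t0 r \<Longrightarrow> t \<noteq> t0 \<Longrightarrow> s \<in> ball 0 R \<Longrightarrow> f t s \<noteq> 0"
    and z: "f t0 0 = 0" and s: "s \<in> ball 0 R"
  shows "f t0 s = 0"
proof (rule ccontr)
  assume "f t0 s \<noteq> 0"
  have "t0 \<in> ball t0 r" "(0::complex) \<in> ball 0 R" using assms by simp_all
  obtain e where e: "0 < e" "ball (0::complex) e \<subseteq> ball 0 R" "\<And>z. z \<in> ball 0 e - {0} \<Longrightarrow> f t0 z \<noteq> 0"
    by (rule isolated_zeros[OF hol[OF \<open>t0 \<in> ball t0 r\<close>] open_ball connected_ball
          \<open>0 \<in> ball 0 R\<close> z s \<open>f t0 s \<noteq> 0\<close>])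
      (rule that)
  define \<rho> where "\<rho> = e / 2"
  have \<rho>: "\<rho> > 0" "cball (0::complex) \<rho> \<subseteq> ball 0 R" using e by (auto simp: \<rho>_def)
  have nz0: "f t0 z \<noteq> 0" if "norm z = \<rho>" for z
    using e(3)[of z] that e(1) by (auto simp: \<rho>_def)
  have c1: "continuous_on (sphere 0 \<rho>) (\<lambda>s. norm (f t0 s))"
    by (intro continuous_intros holomorphic_on_imp_continuous_on holomorphic_on_subset[OF hol[of t0]])
      (use \<rho> assms(1) in auto)
  have "complex_of_real \<rho> \<in> sphere 0 \<rho>" using \<rho>(1) by simp
  then have ne: "sphere (0::complex) \<rho> \<noteq> {}" by blast
  obtain z0 where z0: "norm z0 = \<rho>" "\<And>z. norm z = \<rho> \<Longrightarrow> norm (f t0 z0) \<le> norm (f t0 z)"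
    using continuous_attains_inf[OF compact_sphere ne c1] by (auto simp: sphere_def)
  define m where "m = norm (f t0 z0)"
  have m: "m > 0" using nz0 z0 by (simp add: m_def)
  have K: "compact (cball t0 (r/2) \<times> sphere (0::complex) \<rho>)"
    by (intro compact_Times) auto
  have "continuous_on (cball t0 (r/2) \<times> sphere (0::complex) \<rho>) (\<lambda>(t, s). f t s)"
    by (rule continuous_on_subset[OF cont]) (use \<rho> assms(1) in auto)
  then have "uniformly_continuous_on (cball t0 (r/2) \<times> sphere (0::complex) \<rho>) (\<lambda>(t, s). f t s)"
    using K by (rule compact_uniformly_continuous)
  then obtain d where d: "d > 0" "\<And>p q. p \<in> cball t0 (r/2) \<times> sphere (0::complex) \<rho> \<Longrightarrow>
     q \<in> cball t0 (r/2) \<times> sphere (0::complex) \<rho> \<Longrightarrow> dist q p < d \<Longrightarrow>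
     dist (case q of (t, s) \<Rightarrow> f t s) (case p of (t, s) \<Rightarrow> f t s) < m / 2"
    unfolding uniformly_continuous_on_def using m by (metis half_gt_zero)
  have lower: "norm (f t 0) \<ge> m / 2" if t: "t \<in> ball t0 (min d (r/2))" "t \<noteq> t0" for t
  proof -
    have tb: "t \<in> ball t0 r" using t assms(1) by auto
    have edge: "norm (f t z) \<ge> m / 2" if "norm z = \<rho>" for z
    proof -
      have "dist (f t z) (f t0 z) < m / 2"
        using d(2)[of "(t0, z)" "(t, z)"] that t assms(1)
        by (auto simp: dist_Pair_Pair dist_commute)
      then have "norm (f t0 z) - norm (f t z) < m / 2"
        by (smt (verit) dist_norm norm_minus_commute norm_triangle_ineq2)
      then show ?thesis using z0(2)[OF that] by (simp add: m_def)
    qed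
    have "norm (inverse (f t 0)) \<le> 2 / m"
    proof (rule maximum_modulus_frontier[where S="cball 0 \<rho>" and f="\<lambda>s. inverse (f t s)"])
      have h: "(\<lambda>s. inverse (f t s)) holomorphic_on ball 0 R"
        using hol[OF tb] nz[OF tb t(2)] by (intro holomorphic_intros) auto
      show "(\<lambda>s. inverse (f t s)) holomorphic_on interior (cball 0 \<rho>)"
        using h by (rule holomorphic_on_subset) (use \<rho> in auto)
      show "continuous_on (closure (cball 0 \<rho>)) (\<lambda>s. inverse (f t s))"
        using holomorphic_on_imp_continuous_on[OF h] by (rule continuous_on_subset) (use \<rho> in auto)
      fix z :: complex assume "z \<in> frontier (cball 0 \<rho>)"
      then have "norm z = \<rho>" by (simp add: frontier_cball)
      from edge[OF this] have "m / 2 \<le> norm (f t z)" .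
      with m have "inverse (norm (f t z)) \<le> inverse (m / 2)" by (intro le_imp_inverse_le) auto
      then show "norm (inverse (f t z)) \<le> 2 / m" by (simp add: norm_inverse)
    qed (use \<rho> in auto)
    moreover have "f t 0 \<noteq> 0" using nz[OF tb t(2)] assms(2) by simp
    then have "norm (f t 0) > 0" by simp
    ultimately show ?thesis using m unfolding norm_inverse by (simp add: field_simps)
  qed
  have "continuous_on (ball t0 r) (\<lambda>t. (\<lambda>(t, s). f t s) (t, 0))"
    by (rule continuous_on_compose2[OF cont]) (use assms(2) in \<open>auto intro!: continuous_intros\<close>)
  then have "isCont (\<lambda>t. f t 0) t0"
    using assms(1) by (simp add: continuous_on_eq_continuous_at)
  then have "((\<lambda>t. norm (f t 0)) \<longlongrightarrow> norm (f t0 0)) (at t0)"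
    by (intro tendsto_norm) (simp add: isCont_def)
  moreover have "eventually (\<lambda>t. norm (f t 0) \<ge> m / 2) (at t0)"
    unfolding eventually_at using lower d(1) assms(1)
    by (intro exI[of _ "min d (r/2)"]) (auto simp: dist_commute)
  ultimately have "norm (f t0 0) \<ge> m / 2"
    by (intro tendsto_lowerbound) auto
  then show False using z m by simp
qed

section \<open>Charts of the total space\<close>

lemma has_derivative_vec_componentwise:
  fixes f :: "'a::real_normed_vector \<Rightarrow> complex ^ 'n::finite"
  assumes "\<And>i. ((\<lambda>x. f x $ i) has_derivative (\<lambda>h. f' h $ i)) (at x)"
  shows "(f has_derivative f') (at x)"
proof -
  have "((\<lambda>x. f x \<bullet> b) has_derivative (\<lambda>h. f' h \<bullet> b)) (at x)" if "b \<in> Basis" for b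
  proof -
    from that obtain i u where b: "b = axis i u" by (auto simp: Basis_vec_def)
    have "((\<lambda>x. f x $ i \<bullet> u) has_derivative (\<lambda>h. f' h $ i \<bullet> u)) (at x)"
      by (intro has_derivative_inner_left assms)
    then show ?thesis by (simp add: b inner_axis)
  qed
  then show ?thesis using has_derivative_componentwise_within[of f f' x UNIV] by simp
qed

text \<open>Splits the integral curve condition of \<open>leaf_topology\<close> into scalar complex
  differential equations, the form in which the Riccati equations appear.\<close>

lemma has_derivative_affine_iff:
  fixes \<gamma> :: "complex \<Rightarrow> 'n::finite affine"
  shows "(\<gamma> has_derivative (\<lambda>h. cscale h v)) (at t) \<longleftrightarrow>
    ((\<lambda>t. fst (\<gamma> t)) has_field_derivative fst v) (at t) \<and>
    (\<forall>i. ((\<lambda>t. snd (\<gamma> t) $ i) has_field_derivative snd v $ i) (at t))"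
proof safe
  assume *: "(\<gamma> has_derivative (\<lambda>h. cscale h v)) (at t)"
  show "((\<lambda>t. fst (\<gamma> t)) has_field_derivative fst v) (at t)"
    using has_derivative_fst[OF *] by (simp add: has_field_derivative_def cscale_def mult_commute_abs)
  fix i
  have "((\<lambda>t. snd (\<gamma> t) $ i) has_derivative (\<lambda>h. snd (cscale h v) $ i)) (at t)"
    by (rule bounded_linear.has_derivative[OF bounded_linear_vec_nth has_derivative_snd[OF *]])
  then show "((\<lambda>t. snd (\<gamma> t) $ i) has_field_derivative snd v $ i) (at t)"
    by (simp add: has_field_derivative_def cscale_def mult_commute_abs)
next
  assume a: "((\<lambda>t. fst (\<gamma> t)) has_field_derivative fst v) (at t)"
    and b: "\<forall>i. ((\<lambda>t. snd (\<gamma> t) $ i) has_field_derivative snd v $ i) (at t)"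
  have 1: "((\<lambda>t. fst (\<gamma> t)) has_derivative (\<lambda>h. h * fst v)) (at t)"
    using a by (simp add: has_field_derivative_def mult_commute_abs)
  have 2: "((\<lambda>t. snd (\<gamma> t)) has_derivative (\<lambda>h. h *s snd v)) (at t)"
    using b by (intro has_derivative_vec_componentwise)
      (simp add: has_field_derivative_def mult_commute_abs)
  show "(\<gamma> has_derivative (\<lambda>h. cscale h v)) (at t)"
    using has_derivative_Pair[OF 1 2] by (simp add: cscale_def)
qed

lemma holomorphic_fun_open: "holomorphic_fun f U \<Longrightarrow> open U"
  by (simp add: holomorphic_fun_def)

lemma holomorphic_fun_continuous_on: "holomorphic_fun f U \<Longrightarrow> continuous_on U f"
  unfolding holomorphic_fun_def
  by (meson continuous_at_imp_continuous_on has_derivative_continuous)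

lemma holomorphic_fun_along_curve:
  assumes "holomorphic_fun f U" "(\<gamma> has_derivative (\<lambda>h. cscale h v)) (at t)" "\<gamma> t \<in> U"
  shows "(\<lambda>t. f (\<gamma> t)) field_differentiable (at t)"
proof -
  from assms(1,3) obtain D where D: "(f has_derivative D) (at (\<gamma> t))" "\<And>a v. D (cscale a v) = a * D v"
    unfolding holomorphic_fun_def by blast
  have "((\<lambda>t. f (\<gamma> t)) has_derivative (\<lambda>h. D (cscale h v))) (at t)"
    using has_derivative_compose[OF assms(2) D(1)] .
  then have "((\<lambda>t. f (\<gamma> t)) has_field_derivative D v) (at t)"
    by (simp add: has_field_derivative_def D(2) mult_commute_abs)
  then show ?thesis by (auto simp: field_differentiable_def)
qed

lemma holomorphic_on_along_curve:
  assumes "holomorphic_fun f U" "open D" "\<gamma> ` D \<subseteq> U"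
    and "\<And>t. t \<in> D \<Longrightarrow> (\<gamma> has_derivative (\<lambda>h. cscale h (v t))) (at t)"
  shows "(\<lambda>t. f (\<gamma> t)) holomorphic_on D"
  unfolding holomorphic_on_open[OF assms(2)]
  using holomorphic_fun_along_curve[OF assms(1) assms(4)] assms(3)
  by (auto simp: field_differentiable_def)

lemma has_derivative_line:
  "((\<lambda>s. p + cscale s v) has_derivative (\<lambda>h. cscale h v)) (at t)"
  unfolding has_derivative_affine_iff
  by (auto simp: cscale_def intro!: derivative_eq_intros)

lemma has_derivative_horizontal:
  "((\<lambda>t. (t, y)) has_derivative (\<lambda>h. cscale h (1, 0))) (at t)"
  unfolding has_derivative_affine_iff by (auto simp: cscale_def intro!: derivative_eq_intros)

lemma holomorphic_fun_base:
  assumes "h holomorphic_on UNIV"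
  shows "holomorphic_fun (\<lambda>z :: 'n::finite affine. h (fst z)) UNIV"
  unfolding holomorphic_fun_def
proof (intro conjI ballI)
  fix z :: "'n affine"
  have "(h has_field_derivative deriv h (fst z)) (at (fst z))"
    using assms by (intro holomorphic_derivI) auto
  then have "(h has_derivative (\<lambda>x. deriv h (fst z) * x)) (at (fst z))"
    by (simp add: has_field_derivative_def)
  then have "((\<lambda>z. h (fst z)) has_derivative (\<lambda>w. deriv h (fst z) * fst w)) (at z)"
    by (rule has_derivative_compose[OF has_derivative_fst[OF has_derivative_ident]])
  then show "\<exists>D. ((\<lambda>z. h (fst z)) has_derivative D) (at z) \<and> (\<forall>a v. D (cscale a v) = a * D v)"
    by (intro exI[of _ "\<lambda>w. deriv h (fst z) * fst w"]) (auto simp: cscale_def)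
qed auto

definition coord_change :: "bool \<Rightarrow> bool \<Rightarrow> complex \<Rightarrow> complex" where
  "coord_change b b' t = (if b = b' then t else 1 / t)"

definition coord_change_deriv :: "bool \<Rightarrow> bool \<Rightarrow> complex \<Rightarrow> complex" where
  "coord_change_deriv b b' t = (if b = b' then 1 else - (1 / t\<^sup>2))"

lemma has_field_derivative_coord_change:
  "b = b' \<or> t \<noteq> 0 \<Longrightarrow> (coord_change b b' has_field_derivative coord_change_deriv b b' t) (at t)"
  unfolding coord_change_def[abs_def] coord_change_deriv_def
  by (auto intro!: derivative_eq_intros simp: power2_eq_square)

lemma coord_change_deriv_nonzero: "b = b' \<or> t \<noteq> 0 \<Longrightarrow> coord_change_deriv b b' t \<noteq> 0"
  by (auto simp: coord_change_deriv_def)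

lemma sphere_chart_eq_iff:
  "sphere_chart b t = sphere_chart b' s \<longleftrightarrow> (b = b' \<or> t \<noteq> 0) \<and> s = coord_change b b' t"
  by (auto simp: sphere_chart_def coord_change_def)

lemma sphere_chart_inj: "sphere_chart b t = sphere_chart b s \<longleftrightarrow> t = s"
  by (auto simp: sphere_chart_def)

lemma sphere_chart_coord_change:
  "b = b' \<or> t \<noteq> 0 \<Longrightarrow> sphere_chart b' (coord_change b b' t) = sphere_chart b t"
  by (auto simp: sphere_chart_def coord_change_def)

lemma sphere_chart_surj: obtains b t where "x = sphere_chart b t"
  by (cases x) (auto simp: sphere_chart_def split: if_splits intro: that[of True 0] that[of False])

lemma chart_eq_iff:
  "chart c z = chart c' z' \<longleftrightarrow> sphere_chart (fst c) (fst z) = sphere_chart (fst c') (fst z') \<and>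
     (\<forall>i. sphere_chart (snd c i) (snd z $ i) = sphere_chart (snd c' i) (snd z' $ i))"
  by (auto simp: chart_def vec_eq_iff)

lemma inj_chart: "inj (chart c)"
  by (rule injI, unfold chart_eq_iff) (auto simp: sphere_chart_inj prod_eq_iff vec_eq_iff)

lemma fst_chart: "fst (chart c z) = sphere_chart (fst c) (fst z)"
  by (simp add: chart_def)

lemma snd_chart: "snd (chart c z) $ i = sphere_chart (snd c i) (snd z $ i)"
  by (simp add: chart_def)

lemma fst_affine_chart [simp]: "fst affine_chart = False"
  and snd_affine_chart [simp]: "snd affine_chart i = False"
  by (auto simp: affine_chart_def)

text \<open>The part of the coordinate space of \<open>c\<close> on which
  \<open>transition c c'\<close> is meaningful: in a coordinate where the charts differ, 0 is the
  one parameter whose point the other chart misses.\<close>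

definition chart_overlap :: "'n::finite chart_id \<Rightarrow> 'n chart_id \<Rightarrow> 'n affine set" where
  "chart_overlap c c' = {z. (fst c = fst c' \<or> fst z \<noteq> 0) \<and> (\<forall>i. snd c i = snd c' i \<or> snd z $ i \<noteq> 0)}"

definition chart_change :: "'n::finite chart_id \<Rightarrow> 'n chart_id \<Rightarrow> 'n affine \<Rightarrow> 'n affine" where
  "chart_change c c' z = (coord_change (fst c) (fst c') (fst z),
     \<chi> i. coord_change (snd c i) (snd c' i) (snd z $ i))"

lemma chart_eq_iff_chart_change:
  "chart c z = chart c' z' \<longleftrightarrow> z \<in> chart_overlap c c' \<and> z' = chart_change c c' z"
  unfolding chart_eq_iff sphere_chart_eq_iff chart_overlap_def
  by (auto simp: chart_change_def prod_eq_iff vec_eq_iff)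

lemma open_chart_overlap: "open (chart_overlap c c')"
proof -
  have "chart_overlap c c' = {z. fst c = fst c' \<or> fst z \<noteq> 0} \<inter> (\<Inter>i. {z. snd c i = snd c' i \<or> snd z $ i \<noteq> 0})"
    by (auto simp: chart_overlap_def)
  moreover have "open {z :: 'a affine. fst c = fst c' \<or> fst z \<noteq> 0}"
    by (cases "fst c = fst c'") (auto intro!: open_Collect_neq continuous_intros)
  moreover have "open {z :: 'a affine. snd c i = snd c' i \<or> snd z $ i \<noteq> 0}" for i
    by (cases "snd c i = snd c' i") (auto intro!: open_Collect_neq continuous_intros)
  ultimately show ?thesis by (auto intro!: open_Int)
qed

lemma transition_eq:
  assumes "z \<in> chart_overlap c c'"
  shows "transition c c' z = chart_change c c' z"
proof -
  have "chart c z = chart c' (chart_change c c' z)"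
    using assms by (simp add: chart_eq_iff_chart_change)
  then show ?thesis by (simp add: transition_def inv_f_f[OF inj_chart])
qed

lemma frechet_derivative_transition:
  assumes "z \<in> chart_overlap c c'"
  shows "frechet_derivative (transition c c') (at z) v =
    (coord_change_deriv (fst c) (fst c') (fst z) * fst v,
     \<chi> i. coord_change_deriv (snd c i) (snd c' i) (snd z $ i) * snd v $ i)"
proof -
  let ?D = "\<lambda>v. (coord_change_deriv (fst c) (fst c') (fst z) * fst v,
     \<chi> i. coord_change_deriv (snd c i) (snd c' i) (snd z $ i) * snd v $ i)"
  have "(coord_change (fst c) (fst c') has_derivative
     (\<lambda>v. coord_change_deriv (fst c) (fst c') (fst z) * v)) (at (fst z))"
    using has_field_derivative_coord_change[of "fst c" "fst c'" "fst z"] assms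
    by (simp add: has_field_derivative_def chart_overlap_def)
  from has_derivative_compose[OF has_derivative_fst[OF has_derivative_ident] this]
  have 1: "((\<lambda>z. coord_change (fst c) (fst c') (fst z)) has_derivative
     (\<lambda>v. coord_change_deriv (fst c) (fst c') (fst z) * fst v)) (at z)" .
  have 2: "((\<lambda>z. coord_change (snd c i) (snd c' i) (snd z $ i)) has_derivative
     (\<lambda>v. coord_change_deriv (snd c i) (snd c' i) (snd z $ i) * snd v $ i)) (at z)" for i
  proof -
    have "(coord_change (snd c i) (snd c' i) has_derivative
     (\<lambda>v. coord_change_deriv (snd c i) (snd c' i) (snd z $ i) * v)) (at (snd z $ i))"
      using has_field_derivative_coord_change[of "snd c i" "snd c' i" "snd z $ i"] assms
      by (simp add: has_field_derivative_def chart_overlap_def)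
    from has_derivative_compose[OF bounded_linear.has_derivative[OF bounded_linear_vec_nth
          has_derivative_snd[OF has_derivative_ident]] this] show ?thesis .
  qed
  have "(chart_change c c' has_derivative ?D) (at z)"
    unfolding chart_change_def[abs_def]
    by (intro has_derivative_Pair 1 has_derivative_vec_componentwise) (simp add: 2)
  then have "(transition c c' has_derivative ?D) (at z)"
    using open_chart_overlap assms
    by (rule has_derivative_transform_within_open) (simp add: transition_eq)
  then have "frechet_derivative (transition c c') (at z) = ?D"
    by (rule frechet_derivative_at[symmetric])
  then show ?thesis by simp
qed

text \<open>The derivative of a change of product charts is diagonal, so components are only
  rescaled and never mixed. In particular, the vanishing of the base component does not depend on
  the generator.\<close>

lemma compatibleD:
  assumes "compatible (c, U, Z) (c', U', Z')" "z \<in> U" "z' \<in> U'" "chart c z = chart c' z'"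
  obtains g where "g \<noteq> 0"
    "fst (Z' z') = g * (coord_change_deriv (fst c) (fst c') (fst z) * fst (Z z))"
    "\<And>i. snd (Z' z') $ i = g * (coord_change_deriv (snd c i) (snd c' i) (snd z $ i) * snd (Z z) $ i)"
proof -
  have z: "z \<in> chart_overlap c c'" "z' = chart_change c c' z"
    using assms(4) chart_eq_iff_chart_change by blast+
  from assms(1) obtain g where "\<forall>z\<in>{z \<in> U. chart c z \<in> chart c' ` U'}. g z \<noteq> 0 \<and>
       Z' (transition c c' z) = cscale (g z) (frechet_derivative (transition c c') (at z) (Z z))"
    by (auto simp: Let_def)
  then have "g z \<noteq> 0" "Z' (transition c c' z) = cscale (g z) (frechet_derivative (transition c c') (at z) (Z z))"
    using assms by blast+
  then show ?thesis
    using that[of "g z"] z(1) by (simp add: transition_eq frechet_derivative_transition cscale_def flip: z(2))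
qed

section \<open>Topology of the sphere in its two charts\<close>

lemma open_inverse_vimage:
  assumes "open (D :: complex set)"
  shows "open {t. t \<noteq> 0 \<and> 1 / t \<in> D}"
proof -
  have "open ((- {0}) \<inter> (\<lambda>t::complex. 1 / t) -` D)"
    by (intro continuous_open_preimage) (use assms in \<open>auto intro!: continuous_intros\<close>)
  then show ?thesis by (simp add: Int_def vimage_def Compl_eq)
qed

text \<open>A compact set of norm at most \<open>M\<close> misses, in the chart at infinity, the
  disc of radius \<open>1 / M\<close>. Conversely, a disc of radius \<open>e\<close> there bounds
  the complement of \<open>V\<close> by \<open>1 / e\<close>. So neighbourhoods of infinity in the
  compactification are those of the chart.\<close>

lemma openin_sphere_iff: "openin sphere_topology V \<longleftrightarrow> (\<forall>b. open (sphere_chart b -` V))"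
proof
  assume "openin sphere_topology V"
  then consider U where "open U" "V = Some ` U"
    | C where "compact C" "V = insert None (Some ` (- C))"
    unfolding sphere_topology_def openin_Alexandroff_compactification
    by (auto simp: Compl_eq_Diff_UNIV)
  then show "\<forall>b. open (sphere_chart b -` V)"
  proof cases
    case 1
    have "sphere_chart b -` V = (if b then {t. t \<noteq> 0 \<and> 1 / t \<in> U} else U)" for b
      using 1 by (auto simp: sphere_chart_def split: if_splits)
    then show ?thesis using 1 open_inverse_vimage by auto
  next
    case 2
    obtain M where M: "M > 0" "\<And>x. x \<in> C \<Longrightarrow> norm x \<le> M"
      using compact_imp_bounded[OF 2(1)] by (auto simp: bounded_pos)
    have "open (- C)" using 2(1) by (simp add: compact_imp_closed open_Compl)
    moreover have "sphere_chart False -` V = - C"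
      using 2 by (auto simp: sphere_chart_def)
    moreover have "sphere_chart True -` V = {t. t \<noteq> 0 \<and> 1 / t \<in> - C} \<union> ball 0 (1 / M)"
    proof -
      have "1 / t \<notin> C" if "norm t < 1 / M" "t \<noteq> 0" for t
      proof
        assume "1 / t \<in> C"
        then have "norm (1 / t) \<le> M" using M by blast
        then show False using that M(1) by (simp add: norm_divide field_simps)
      qed
      then show ?thesis using 2 M(1) by (auto simp: sphere_chart_def split: if_splits)
    qed
    ultimately show ?thesis using open_inverse_vimage[of "- C"] by (metis (full_types) open_Un open_ball)
  qed
next
  assume op: "\<forall>b. open (sphere_chart b -` V)"
  let ?U = "sphere_chart False -` V"
  have U: "open ?U" using op by blast
  show "openin sphere_topology V"
  proof (cases "None \<in> V")
    case False
    have "x \<in> V \<longleftrightarrow> x \<in> Some ` ?U" for x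
      using False by (cases x) (auto simp: sphere_chart_def)
    then have "V = Some ` ?U" by blast
    then show ?thesis unfolding sphere_topology_def openin_Alexandroff_compactification
      using U by auto
  next
    case True
    have "x \<in> V \<longleftrightarrow> x \<in> insert None (Some ` (UNIV - (- ?U)))" for x
      using True by (cases x) (auto simp: sphere_chart_def)
    then have V: "V = insert None (Some ` (UNIV - (- ?U)))" by blast
    have "0 \<in> sphere_chart True -` V" using True by (simp add: sphere_chart_def)
    with op obtain e where e: "e > 0" "ball 0 e \<subseteq> sphere_chart True -` V"
      by (meson open_contains_ball)
    have "norm x \<le> 1 / e" if "x \<notin> ?U" for x
    proof (rule ccontr)
      assume *: "\<not> norm x \<le> 1 / e"
      then have x: "x \<noteq> 0" using e(1) by auto
      have "1 / x \<in> ball 0 e" using * e(1) x by (simp add: norm_divide field_simps)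
      then have "sphere_chart True (1 / x) \<in> V" using e(2) by blast
      then show False using that x by (simp add: sphere_chart_def)
    qed
    then have "bounded (- ?U)" by (auto simp: bounded_iff)
    then have "compact (- ?U)" using U by (simp add: compact_eq_bounded_closed closed_Compl)
    then show ?thesis unfolding sphere_topology_def openin_Alexandroff_compactification
      using V compact_imp_closed by (intro disjI2 exI[of _ "- ?U"]) auto
  qed
qed

lemma topspace_sphere [simp]: "topspace sphere_topology = UNIV"
  using openin_sphere_iff[of UNIV] openin_subset by fastforce

lemma openin_sphere_chart_image:
  assumes "open D"
  shows "openin sphere_topology (sphere_chart b ` D)"
  unfolding openin_sphere_iff
proof
  fix b'
  have "sphere_chart b' -` sphere_chart b ` D = (if b = b' then D else {t. t \<noteq> 0 \<and> 1 / t \<in> D})"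
    by (auto simp: image_iff sphere_chart_eq_iff coord_change_def split: if_splits)
  then show "open (sphere_chart b' -` sphere_chart b ` D)"
    using assms open_inverse_vimage by auto
qed

lemma finite_sphere_chart_vimage: "finite S \<Longrightarrow> finite (sphere_chart b -` S)"
  by (rule finite_vimageI) (auto simp: inj_def sphere_chart_inj)

section \<open>The exceptional base points and the shape of the vector field\<close>

definition vertical_base :: "'n::finite local_field set \<Rightarrow> complex option set" where
  "vertical_base \<F> = {fst (chart c z) | c U Z z. (c, U, Z) \<in> \<F> \<and> z \<in> U \<and> fst (Z z) = 0}"

lemma generator_through:
  assumes "singular_foliation \<F>"
  obtains c U Z z where "(c, U, Z) \<in> \<F>" "z \<in> U" "chart c z = q"
proof -
  have "q \<in> (\<Union>(c, U, Z)\<in>\<F>. chart c ` U)" using assms by (auto simp: singular_foliation_def)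
  then show ?thesis using that by blast
qed

lemma generator_holomorphic:
  assumes "singular_foliation \<F>" "(c, U, Z) \<in> \<F>"
  shows "open U" "holomorphic_fun (\<lambda>z. fst (Z z)) U" "holomorphic_fun (\<lambda>z. snd (Z z) $ i) U"
  using assms unfolding singular_foliation_def holomorphic_field_def by blast+

lemma generators_compatible:
  "singular_foliation \<F> \<Longrightarrow> A \<in> \<F> \<Longrightarrow> B \<in> \<F> \<Longrightarrow> compatible A B"
  by (auto simp: singular_foliation_def)

lemma vertical_baseI:
  "(c, U, Z) \<in> \<F> \<Longrightarrow> z \<in> U \<Longrightarrow> fst (Z z) = 0 \<Longrightarrow> fst (chart c z) \<in> vertical_base \<F>"
  unfolding vertical_base_def by blast

text \<open>Vertical vectors form a complex hyperplane, and a line complements a hyperplane exactly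
  when it is not contained in it.\<close>

lemma spans_with_vertical_iff:
  fixes w :: "'n::finite affine"
  shows "{cscale a w + v | a v. fst v = 0} = UNIV \<longleftrightarrow> fst w \<noteq> 0"
proof
  assume "{cscale a w + v | a v. fst v = 0} = UNIV"
  then have "(1, 0) \<in> {cscale a w + v | a v. fst v = 0}" by blast
  then obtain a v where "(1, 0) = cscale a w + v" "fst v = 0" by blast
  then have "1 = a * fst w" by (auto simp: cscale_def prod_eq_iff)
  then show "fst w \<noteq> 0" by auto
next
  assume w: "fst w \<noteq> 0"
  have "p \<in> {cscale a w + v | a v. fst v = 0}" for p
    by (rule CollectI, rule exI[of _ "fst p / fst w"], rule exI[of _ "p - cscale (fst p / fst w) w"])
      (use w in \<open>auto simp: cscale_def\<close>)
  then show "{cscale a w + v | a v. fst v = 0} = UNIV" by blast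
qed

lemma vertical_base_subset_if_transverse:
  assumes "transverse_on \<F> (- (fst -` S))"
  shows "vertical_base \<F> \<subseteq> S"
proof
  fix x assume "x \<in> vertical_base \<F>"
  then obtain c U Z z where *: "(c, U, Z) \<in> \<F>" "z \<in> U" "fst (Z z) = 0" "x = fst (chart c z)"
    by (auto simp: vertical_base_def)
  from assms *(1,2) have "chart c z \<in> - (fst -` S) \<Longrightarrow> {cscale a (Z z) + v | a v. fst v = 0} = UNIV"
    unfolding transverse_on_def by blast
  then show "x \<in> S" using *(3,4) unfolding spans_with_vertical_iff by auto
qed

lemma base_slice_open:
  fixes U :: "'n::finite affine set"
  assumes "open U" "(t0, y) \<in> U"
  obtains e where "e > 0" "\<forall>t\<in>ball t0 e. (t, y) \<in> U"
proof -
  have "open ((\<lambda>t. (t, y)) -` U)"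
    using assms(1) by (intro open_vimage) (auto intro!: continuous_intros)
  moreover have "t0 \<in> (\<lambda>t. (t, y)) -` U" using assms(2) by simp
  ultimately obtain e where "e > 0" "ball t0 e \<subseteq> (\<lambda>t. (t, y)) -` U" by (rule openE)
  then show ?thesis using that by blast
qed

text \<open>As the set is a union of fibres, its equations may be restricted to the horizontal line
  with fibre coordinates 0. There either all of them vanish identically on a disc, or one of them
  has no further zeros near \<open>t0\<close>.\<close>

lemma analytic_slice_dichotomy:
  assumes "analytic_subset (fst -` S :: 'n::finite total set)"
  obtains e where "e > 0"
    "(\<forall>t\<in>ball t0 e. sphere_chart b t \<in> S) \<or> (\<forall>t\<in>ball t0 e - {t0}. sphere_chart b t \<notin> S)"
proof -
  define c :: "'n chart_id" where "c = (b, \<lambda>_. False)"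
  obtain U \<Phi> where U: "open U" "(t0, 0) \<in> U" "\<And>f. f \<in> \<Phi> \<Longrightarrow> holomorphic_fun f U"
    "{w \<in> U. chart c w \<in> fst -` S} = {w \<in> U. \<forall>f\<in>\<Phi>. f w = 0}"
    using assms[unfolded analytic_subset_def, THEN spec[of _ c], THEN spec[of _ "(t0, 0)"]] by auto
  obtain e where e: "e > 0" "\<forall>t\<in>ball t0 e. (t, 0) \<in> U"
    using base_slice_open[OF U(1,2)] .
  have iff: "sphere_chart b t \<in> S \<longleftrightarrow> (\<forall>f\<in>\<Phi>. f (t, 0) = 0)" if "t \<in> ball t0 e" for t
  proof -
    have "(t, 0) \<in> {w \<in> U. chart c w \<in> fst -` S} \<longleftrightarrow> (t, 0) \<in> {w \<in> U. \<forall>f\<in>\<Phi>. f w = 0}"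
      using U(4) by simp
    then show ?thesis using e(2) that by (simp add: fst_chart c_def)
  qed
  show ?thesis
  proof (cases "\<forall>f\<in>\<Phi>. \<forall>t\<in>ball t0 e. f (t, 0) = 0")
    case True
    then show ?thesis using that[OF e(1)] iff by blast
  next
    case False
    then obtain f t1 where f: "f \<in> \<Phi>" "t1 \<in> ball t0 e" "f (t1, 0) \<noteq> 0" by blast
    have "(\<lambda>t. f (t, 0)) holomorphic_on ball t0 e"
      by (rule holomorphic_on_along_curve[OF U(3)[OF f(1)] open_ball _ has_derivative_horizontal])
        (use e(2) in auto)
    then have "\<forall>\<^sub>F t in at t0. f (t, 0) \<noteq> 0 \<and> t \<in> ball t0 e"
      using e(1) f by (intro non_zero_neighbour_alt[of _ _ _ t1]) auto
    then obtain d where d: "d > 0" "\<And>t. t \<noteq> t0 \<Longrightarrow> dist t t0 < d \<Longrightarrow> f (t, 0) \<noteq> 0 \<and> t \<in> ball t0 e"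
      unfolding eventually_at by auto
    then have "\<forall>t\<in>ball t0 d - {t0}. sphere_chart b t \<notin> S"
      using iff f(1) by (force simp: dist_commute)
    then show ?thesis using that d(1) by blast
  qed
qed

text \<open>The dichotomy makes the interior of \<open>A b\<close> closed, hence empty or the whole
  plane. The whole plane would give interior points in the other chart through \<open>1 / t\<close>,
  so that chart would lie in \<open>S\<close> as well, against \<open>S \<noteq> UNIV\<close>.
  Without interior, the dichotomy excludes limit points, and the two closed unit discs, which are
  compact, cover the sphere.\<close>

lemma finite_base_of_analytic:
  assumes "analytic_subset (fst -` S :: 'n::finite total set)" "S \<noteq> UNIV"
  shows "finite S"
proof -
  define A where "A = (\<lambda>b. sphere_chart b -` S)"
  have clopen_int: "interior (A b) = {} \<or> interior (A b) = UNIV" for b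
  proof -
    have "open (- interior (A b))"
      unfolding open_contains_ball
    proof
      fix t0 assume t0: "t0 \<in> - interior (A b)"
      obtain e where e: "e > 0"
        "(\<forall>t\<in>ball t0 e. sphere_chart b t \<in> S) \<or> (\<forall>t\<in>ball t0 e - {t0}. sphere_chart b t \<notin> S)"
        using analytic_slice_dichotomy[OF assms(1)] .
      have "\<not> ball t0 e \<subseteq> A b" using t0 e(1) by (meson ComplD centre_in_ball interiorI open_ball)
      then have "\<forall>t\<in>ball t0 e - {t0}. sphere_chart b t \<notin> S" using e(2) by (auto simp: A_def)
      then have "ball t0 e \<subseteq> - interior (A b)"
        using t0 interior_subset[of "A b"] by (auto simp: A_def)
      then show "\<exists>e>0. ball t0 e \<subseteq> - interior (A b)" using e(1) by blast
    qed
    then show ?thesis using clopen[of "interior (A b)"] by (simp add: closed_open)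
  qed
  have "interior (A b) = {}" for b
  proof (rule ccontr)
    assume "interior (A b) \<noteq> {}"
    then have "A b = UNIV" using clopen_int[of b] interior_subset[of "A b"] by auto
    then have *: "sphere_chart b t \<in> S" for t by (auto simp: A_def)
    have "t \<in> A (\<not> b)" if "t \<noteq> 0" for t
      using *[of "coord_change (\<not> b) b t"] that sphere_chart_coord_change[of "\<not> b" b t] by (simp add: A_def)
    then have "1 \<in> interior (A (\<not> b))" by (intro interiorI[of "- {0}"]) auto
    then have "A (\<not> b) = UNIV" using clopen_int[of "\<not> b"] interior_subset[of "A (\<not> b)"] by auto
    then have **: "sphere_chart (\<not> b) t \<in> S" for t by (auto simp: A_def)
    have "x \<in> S" for x
    proof -
      obtain b' t where "x = sphere_chart b' t" by (rule sphere_chart_surj)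
      then show ?thesis using * ** by (cases "b' = b") auto
    qed
    then show False using assms(2) by blast
  qed
  then have "\<not> t0 islimpt A b" for t0 b
  proof -
    obtain e where e: "e > 0"
      "(\<forall>t\<in>ball t0 e. sphere_chart b t \<in> S) \<or> (\<forall>t\<in>ball t0 e - {t0}. sphere_chart b t \<notin> S)"
      using analytic_slice_dichotomy[OF assms(1)] .
    have "\<not> ball t0 e \<subseteq> A b"
      using e(1) \<open>\<And>b. interior (A b) = {}\<close>
      by (metis centre_in_ball empty_iff interiorI open_ball)
    then show ?thesis using e by (fastforce simp: A_def islimpt_approachable dist_commute)
  qed
  then have fin: "finite (cball 0 1 \<inter> A b)" for b
    by (intro finite_not_islimpt_in_compact) auto
  have "S \<subseteq> (\<Union>b. sphere_chart b ` (cball 0 1 \<inter> A b))"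
  proof
    fix x assume x: "x \<in> S"
    show "x \<in> (\<Union>b. sphere_chart b ` (cball 0 1 \<inter> A b))"
    proof (cases "\<exists>t. x = Some t \<and> norm t \<le> 1")
      case True
      then obtain t where "x = sphere_chart False t" "norm t \<le> 1" by (auto simp: sphere_chart_def)
      then show ?thesis using x by (intro UN_I[of False]) (auto simp: A_def)
    next
      case False
      define t where "t = (case x of None \<Rightarrow> 0 | Some s \<Rightarrow> 1 / s)"
      have "x = sphere_chart True t" "norm t \<le> 1"
        using False by (auto simp: t_def sphere_chart_def norm_divide divide_le_eq split: option.splits)
      then show ?thesis using x by (intro UN_I[of True]) (auto simp: A_def)
    qed
  qed
  then show ?thesis by (rule finite_subset) (simp add: fin)
qed

section \<open>Degrees of the polynomial field in the fibre coordinates\<close>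

definition vec_upd :: "complex ^ 'n \<Rightarrow> 'n \<Rightarrow> complex \<Rightarrow> complex ^ 'n::finite" where
  "vec_upd y i t = (\<chi> j. if j = i then t else y $ j)"

lemma vec_upd_nth: "vec_upd y i t $ j = (if j = i then t else y $ j)"
  by (simp add: vec_upd_def)

lemma vec_upd_same [simp]: "vec_upd y i (y $ i) = y"
  by (simp add: vec_eq_iff vec_upd_nth)

lemma polynomial_fun_base:
  assumes "polynomial_fun f"
  obtains P where "\<And>x. f (x, y) = poly P x"
proof -
  obtain M a where f: "\<And>x y. f (x, y) = (\<Sum>(k, m)\<in>M. a (k, m) * x ^ k * (\<Prod>i\<in>UNIV. (y $ i) ^ m i))"
    using assms by (auto simp: polynomial_fun_def)
  have "f (x, y) = poly (\<Sum>(k, m)\<in>M. monom (a (k, m) * (\<Prod>i\<in>UNIV. (y $ i) ^ m i)) k) x" for x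
    unfolding f poly_sum by (intro sum.cong refl) (auto simp: poly_monom mult_ac)
  then show ?thesis using that by blast
qed

lemma polynomial_fun_coordinate:
  assumes "polynomial_fun f"
  obtains P where "\<And>t. f (x, vec_upd y i t) = poly P t"
proof -
  obtain M a where f: "\<And>x y. f (x, y) = (\<Sum>(k, m)\<in>M. a (k, m) * x ^ k * (\<Prod>i\<in>UNIV. (y $ i) ^ m i))"
    using assms by (auto simp: polynomial_fun_def)
  have pr: "(\<Prod>j\<in>UNIV. (vec_upd y i t $ j) ^ m j) = t ^ m i * (\<Prod>j\<in>UNIV - {i}. (y $ j) ^ m j)" for t m
    by (subst prod.remove[of _ i]) (auto simp: vec_upd_nth intro!: arg_cong2[of _ _ _ _ "(*)"] prod.cong)
  have "f (x, vec_upd y i t) =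
     poly (\<Sum>(k, m)\<in>M. monom (a (k, m) * x ^ k * (\<Prod>j\<in>UNIV - {i}. (y $ j) ^ m j)) (m i)) t" for t
    unfolding f poly_sum pr by (intro sum.cong refl) (auto simp: poly_monom mult_ac)
  then show ?thesis using that by blast
qed

lemma poly_eq_if_cofinite:
  fixes P Q :: "complex poly"
  assumes "finite S" "\<And>x. Some x \<notin> S \<Longrightarrow> poly P x = poly Q x"
  shows "P = Q"
proof (rule ccontr)
  assume "P \<noteq> Q"
  then have "finite {x. poly (P - Q) x = 0}" by (intro poly_roots_finite) auto
  moreover have "finite (Some -` S)" using assms(1) by (intro finite_vimageI) auto
  ultimately have "finite ({x. poly (P - Q) x = 0} \<union> Some -` S)" by blast
  also have "{x. poly (P - Q) x = 0} \<union> Some -` S = UNIV" using assms(2) by auto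
  finally show False using infinite_UNIV_char_0[where 'a=complex] by contradiction
qed

lemma eq_if_constant_in_coordinates:
  fixes f :: "complex ^ 'n::finite \<Rightarrow> complex"
  assumes "finite J" "\<And>j y t. j \<in> J \<Longrightarrow> f (vec_upd y j t) = f y" "\<And>j. j \<notin> J \<Longrightarrow> y $ j = y' $ j"
  shows "f y = f y'"
  using assms
proof (induction J arbitrary: y rule: finite_induct)
  case empty
  then have "y = y'" by (simp add: vec_eq_iff)
  then show ?case by simp
next
  case (insert j J)
  have "f (vec_upd y j (y' $ j)) = f y'"
    by (rule insert.IH) (use insert.prems in \<open>auto simp: vec_upd_nth\<close>)
  then show ?case using insert.prems(1)[of j] by simp
qed

lemma generator_vs_affine_field:
  assumes "given_by \<F> X" "(c, U, Z) \<in> \<F>" "z \<in> U" "chart c z = chart affine_chart (x, y)"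
  obtains g where "g \<noteq> 0"
    "fst (Z z) = g * (coord_change_deriv False (fst c) x * fst (X (x, y)))"
    "\<And>i. snd (Z z) $ i = g * (coord_change_deriv False (snd c i) (y $ i) * snd (X (x, y)) $ i)"
proof -
  have "compatible (affine_chart, UNIV, X) (c, U, Z)" using assms by (auto simp: given_by_def)
  from compatibleD[OF this _ assms(3) assms(4)[symmetric]]
  show ?thesis using that by (auto simp del: compatible.simps)
qed

lemma affine_field_base_nonzero:
  assumes "singular_foliation \<F>" "given_by \<F> X" "Some x \<notin> vertical_base \<F>"
  shows "fst (X (x, y)) \<noteq> 0"
proof -
  obtain c U Z z where z: "(c, U, Z) \<in> \<F>" "z \<in> U" "chart c z = chart affine_chart (x, y)"
    using generator_through[OF assms(1)] .
  have "fst (Z z) \<noteq> 0"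
    using vertical_baseI[OF z(1,2)] z(3) assms(3) by (auto simp: fst_chart sphere_chart_def)
  then show ?thesis using generator_vs_affine_field[OF assms(2) z] by (metis mult_zero_right)
qed

lemma affine_field_base_constant:
  assumes "singular_foliation \<F>" "given_by \<F> X" "polynomial_field X" "Some x \<notin> vertical_base \<F>"
  shows "fst (X (x, y)) = fst (X (x, 0))"
proof (rule eq_if_constant_in_coordinates[where J=UNIV and f="\<lambda>y. fst (X (x, y))"])
  fix j t and y :: "complex ^ 'a"
  have "polynomial_fun (\<lambda>z. fst (X z))" using assms(3) by (simp add: polynomial_field_def)
  then obtain P where P: "\<And>t. fst (X (x, vec_upd y j t)) = poly P t"
    using polynomial_fun_coordinate[of "\<lambda>z. fst (X z)"] by metis
  have "poly P t \<noteq> 0" for t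
    using affine_field_base_nonzero[OF assms(1,2,4), of "vec_upd y j t"] by (simp add: P)
  then have "constant (poly P)" using Fundamental_Theorem_Algebra.fundamental_theorem_of_algebra[of P] by auto
  then have "poly P t = poly P (y $ j)" by (simp add: constant_def)
  then show "fst (X (x, vec_upd y j t)) = fst (X (x, y))" using P[of t] P[of "y $ j"] by simp
qed auto

lemma eventually_nhds_if_isCont:
  assumes "isCont f a" "open S" "f a \<in> S"
  shows "eventually (\<lambda>x. f x \<in> S) (nhds a)"
  using topological_tendstoD[of f "f a" "nhds a" S] assms
  by (simp add: isCont_def tendsto_at_iff_tendsto_nhds)

lemma continuous_on_vec_upd: "continuous_on A (\<lambda>t. vec_upd y j t)"
  unfolding vec_upd_def
proof (rule continuous_on_vec_lambda)
  show "continuous_on A (\<lambda>t. if i = j then t else y $ i)" for i by (cases "i = j") auto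
qed

text \<open>The quotient \<open>s\<close> of a fibre component of a generator by its base component
  is free of the unknown factor \<open>g\<close>, and it is continuous at a point with infinite
  \<open>j\<close>-th coordinate, hence bounded nearby. Returning to \<open>X\<close> means dividing
  by the derivative of the coordinate change, which is what produces the exponent.\<close>

lemma affine_field_growth:
  assumes "singular_foliation \<F>" "given_by \<F> X" "polynomial_field X" "Some x \<notin> vertical_base \<F>"
  obtains K R where "\<And>t. norm t \<ge> R \<Longrightarrow>
    norm (snd (X (x, vec_upd y j t)) $ i) \<le> K * norm t ^ (if i = j then 2 else 0)"
proof -
  define q :: "'a total" where "q = (Some x, \<chi> i. if i = j then None else Some (y $ i))"
  obtain c U Z z where z: "(c, U, Z) \<in> \<F>" "z \<in> U" "chart c z = q"
    using generator_through[OF assms(1)] .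
  have zx: "sphere_chart (fst c) (fst z) = Some x"
    using arg_cong[OF z(3), of fst] by (simp add: fst_chart q_def)
  have zi: "sphere_chart (snd c k) (snd z $ k) = (if k = j then None else Some (y $ k))" for k
    using arg_cong[OF z(3), of "\<lambda>q. snd q $ k"] by (simp add: snd_chart q_def)
  have zj: "snd c j" "snd z $ j = 0" using zi[of j] by (auto simp: sphere_chart_def split: if_splits)
  \<comment> \<open>Only the \<open>j\<close>-th coordinate varies along this path; its parameter is
    \<open>u = 1 / t\<close>, so that large \<open>t\<close> corresponds to \<open>u\<close> near
    0.\<close>
  define w where "w = (\<lambda>u. (fst z, vec_upd (snd z) j u))"
  have w0: "w 0 = z" using zj by (simp add: w_def prod_eq_iff vec_eq_iff vec_upd_nth)
  have "continuous_on UNIV w" unfolding w_def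
    by (intro continuous_intros continuous_on_vec_upd)
  then have contw: "isCont w 0" by (simp add: continuous_on_eq_continuous_at)
  have U: "open U" using generator_holomorphic[OF assms(1) z(1)] by simp
  have nz: "fst (Z z) \<noteq> 0"
    using vertical_baseI[OF z(1,2)] zx assms(4) by (auto simp: fst_chart)
  have cZ: "isCont (\<lambda>z. fst (Z z)) z" "isCont (\<lambda>z. snd (Z z) $ i) z"
    using generator_holomorphic[OF assms(1) z(1)] z(2) U
    by (meson continuous_on_eq_continuous_at holomorphic_fun_continuous_on)+
  define s where "s = (\<lambda>u. snd (Z (w u)) $ i / fst (Z (w u)))"
  have c1: "isCont (\<lambda>u. fst (Z (w u))) 0" "isCont (\<lambda>u. snd (Z (w u)) $ i) 0"
    using isCont_o2[OF contw, of "\<lambda>z. fst (Z z)"] isCont_o2[OF contw, of "\<lambda>z. snd (Z z) $ i"] cZ w0 by auto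
  then have c2: "isCont s 0" unfolding s_def using nz w0 by (intro isCont_divide) auto
  have "eventually (\<lambda>u. w u \<in> U \<and> fst (Z (w u)) \<noteq> 0 \<and> norm (s u) < norm (s 0) + 1) (nhds 0)"
  proof (intro eventually_conj)
    show "eventually (\<lambda>u. w u \<in> U) (nhds 0)"
      using eventually_nhds_if_isCont[OF contw U] z(2) w0 by simp
    show "eventually (\<lambda>u. fst (Z (w u)) \<noteq> 0) (nhds 0)"
      using eventually_nhds_if_isCont[OF c1(1), of "- {0}"] nz w0 by (simp add: open_Compl)
    show "eventually (\<lambda>u. norm (s u) < norm (s 0) + 1) (nhds 0)"
      using eventually_nhds_if_isCont[OF continuous_norm[OF c2], of "{..<norm (s 0) + 1}"] by simp
  qed
  then obtain d where d: "d > 0" "\<And>u. norm u < d \<Longrightarrow> w u \<in> U \<and> fst (Z (w u)) \<noteq> 0 \<and> norm (s u) < norm (s 0) + 1"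
    unfolding eventually_nhds_metric by auto
  define d0 where "d0 = coord_change_deriv False (fst c) x"
  define di where "di = coord_change_deriv False (snd c i) (y $ i)"
  \<comment> \<open>The first factor bounds \<open>s\<close> near infinity, and the next two restore
    the base speed, which is constant along the fibre. For \<open>i \<noteq> j\<close> the
    \<open>i\<close>-th coordinate stays at \<open>y $ i\<close>, so its coordinate change
    contributes the constant \<open>di\<close>.\<close>
  define K where "K = (norm (s 0) + 1) * norm d0 * norm (fst (X (x, 0))) * (if i = j then 1 else inverse (norm di))"
  have "norm (snd (X (x, vec_upd y j t)) $ i) \<le> K * norm t ^ (if i = j then 2 else 0)"
    if t: "norm t \<ge> 2 / d" for t
  proof -
    let ?Y = "vec_upd y j t" and ?u = "1 / t"
    have "norm t > 0" using t d(1) by (meson divide_pos_pos less_le_trans zero_less_numeral)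
    then have t0: "t \<noteq> 0" by simp
    have "norm ?u < d" using t d(1) t0 by (simp add: norm_divide field_simps)
    from d(2)[OF this] have u: "w ?u \<in> U" "fst (Z (w ?u)) \<noteq> 0" "norm (s ?u) \<le> norm (s 0) + 1" by auto
    have "chart c (w ?u) = chart affine_chart (x, ?Y)"
      unfolding chart_eq_iff
    proof (intro conjI allI)
      show "sphere_chart (fst c) (fst (w ?u)) = sphere_chart (fst affine_chart) (fst (x, ?Y))"
        by (simp add: w_def zx sphere_chart_def[of False])
      show "sphere_chart (snd c k) (snd (w ?u) $ k) = sphere_chart (snd affine_chart k) (snd (x, ?Y) $ k)" for k
        using zi[of k] zj(1) t0
        by (cases "k = j") (simp_all add: w_def vec_upd_nth sphere_chart_def[of False] sphere_chart_def[of True])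
    qed
    from generator_vs_affine_field[OF assms(2) z(1) u(1) this] obtain g where g: "g \<noteq> 0"
      "fst (Z (w ?u)) = g * (d0 * fst (X (x, ?Y)))"
      "snd (Z (w ?u)) $ i = g * (coord_change_deriv False (snd c i) (?Y $ i) * snd (X (x, ?Y)) $ i)"
      unfolding d0_def by metis
    \<comment> \<open>For \<open>i = j\<close> this is the derivative of \<open>1 / t\<close>, of
      modulus \<open>1 / norm t ^ 2\<close>: here the quadratic growth arises.\<close>
    define D where "D = coord_change_deriv False (snd c i) (?Y $ i)"
    have D: "D \<noteq> 0" "inverse (norm D) = (if i = j then 1 else inverse (norm di)) * norm t ^ (if i = j then 2 else 0)"
    proof -
      have "snd c i \<Longrightarrow> i \<noteq> j \<Longrightarrow> y $ i \<noteq> 0" using zi[of i] by (auto simp: sphere_chart_def split: if_splits)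
      then show "D \<noteq> 0" using t0 unfolding D_def
        by (intro coord_change_deriv_nonzero) (auto simp: vec_upd_nth)
      show "inverse (norm D) = (if i = j then 1 else inverse (norm di)) * norm t ^ (if i = j then 2 else 0)"
        using zj(1) by (auto simp: D_def di_def vec_upd_nth coord_change_deriv_def norm_divide norm_power)
    qed
    have X0: "fst (X (x, ?Y)) = fst (X (x, 0))"
      by (rule affine_field_base_constant[OF assms])
    have "snd (X (x, ?Y)) $ i = s ?u * d0 * fst (X (x, 0)) * inverse D"
      using g D(1) u(2) unfolding s_def D_def[symmetric] X0[symmetric] by (simp add: field_simps)
    then have "norm (snd (X (x, ?Y)) $ i) = norm (s ?u) * (norm d0 * norm (fst (X (x, 0))) * inverse (norm D))"
      by (simp add: norm_mult norm_inverse)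
    also have "\<dots> \<le> (norm (s 0) + 1) * (norm d0 * norm (fst (X (x, 0))) * inverse (norm D))"
      using u(3) by (intro mult_right_mono) auto
    also have "\<dots> = K * norm t ^ (if i = j then 2 else 0)"
      unfolding D(2) K_def by (simp add: mult_ac)
    finally show ?thesis .
  qed
  then show ?thesis using that by blast
qed

text \<open>By Liouville's theorem a growth exponent bounds a degree: 2 in the \<open>i\<close>-th
  fibre coordinate and 0 in the others. The latter can therefore be set to 0, which leaves a
  quadratic in a single variable. How its coefficients depend on \<open>x\<close> is still open at
  this point.\<close>

lemma affine_field_fibre_form:
  assumes "singular_foliation \<F>" "given_by \<F> X" "polynomial_field X" "Some x \<notin> vertical_base \<F>"
  obtains a b c where "\<And>y. snd (X (x, y)) $ i = a * (y $ i)\<^sup>2 + b * y $ i + c"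
proof -
  have pf: "polynomial_fun (\<lambda>z. snd (X z) $ i)" using assms(3) by (simp add: polynomial_field_def)
  have degb: "\<exists>C. \<forall>t. snd (X (x, vec_upd y j t)) $ i = (\<Sum>k\<le>(if i = j then 2 else 0). C k * t ^ k)" for y j
  proof -
    obtain P where P: "\<And>t. snd (X (x, vec_upd y j t)) $ i = poly P t"
      using polynomial_fun_coordinate[OF pf] by metis
    obtain K R where K: "\<And>t. norm t \<ge> R \<Longrightarrow>
       norm (snd (X (x, vec_upd y j t)) $ i) \<le> K * norm t ^ (if i = j then 2 else 0)"
      using affine_field_growth[OF assms] by metis
    have "poly P t = (\<Sum>k\<le>(if i = j then 2 else 0). (deriv ^^ k) (poly P) 0 / fact k * t ^ k)" for t
      by (rule Liouville_polynomial[where A=R and B=K]) (use K in \<open>auto simp: P intro!: holomorphic_intros\<close>)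
    then show ?thesis using P by (intro exI[of _ "\<lambda>k. (deriv ^^ k) (poly P) 0 / fact k"]) simp
  qed
  have ind: "snd (X (x, y)) $ i = snd (X (x, vec_upd 0 i (y $ i))) $ i" for y
  proof (rule eq_if_constant_in_coordinates[where J="- {i}" and f="\<lambda>y. snd (X (x, y)) $ i"])
    fix j t and y :: "complex ^ 'a" assume "j \<in> - {i}"
    then obtain C where C: "\<And>t. snd (X (x, vec_upd y j t)) $ i = (\<Sum>k\<le>0. C k * t ^ k)"
      using degb[of y j] by auto
    show "snd (X (x, vec_upd y j t)) $ i = snd (X (x, y)) $ i"
      using C[of t] C[of "y $ j"] by simp
  qed (auto simp: vec_upd_nth)
  obtain C where C: "\<And>t. snd (X (x, vec_upd 0 i t)) $ i = (\<Sum>k\<le>2. C k * t ^ k)"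
    using degb[of 0 i] by auto
  have "snd (X (x, y)) $ i = C 2 * (y $ i)\<^sup>2 + C 1 * y $ i + C 0" for y
    unfolding ind[of y] C by (simp add: numeral_2_eq_2)
  then show ?thesis by (rule that)
qed

text \<open>The coefficients of a quadratic are linear combinations of its values at 0, 1 and -1. As
  these values are polynomials in \<open>x\<close>, so are the coefficients, and the resulting
  polynomial identity extends over the finitely many vertical base points.\<close>

lemma affine_field_riccati_form:
  fixes X :: "'n::finite affine \<Rightarrow> 'n affine"
  assumes "singular_foliation \<F>" "given_by \<F> X" "polynomial_field X" "finite (vertical_base \<F>)"
  obtains p and q :: "'n \<Rightarrow> nat \<Rightarrow> complex poly" where "\<And>x y. X (x, y) =
         (poly p x, \<chi> i. poly (q i 2) x * (y $ i)\<^sup>2 + poly (q i 1) x * y $ i + poly (q i 0) x)"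
proof -
  have pf: "polynomial_fun (\<lambda>z. fst (X z))" "polynomial_fun (\<lambda>z. snd (X z) $ i)" for i
    using assms(3) by (auto simp: polynomial_field_def)
  obtain p where p: "\<And>x. fst (X (x, 0)) = poly p x" using polynomial_fun_base[OF pf(1)] by metis
  have p': "fst (X (x, y)) = poly p x" for x y
  proof -
    obtain P where P: "\<And>x. fst (X (x, y)) = poly P x" using polynomial_fun_base[OF pf(1)] by metis
    have "P = p"
      by (rule poly_eq_if_cofinite[OF assms(4)]) (metis P p affine_field_base_constant[OF assms(1-3)])
    then show ?thesis using P by simp
  qed
  have "\<exists>q. \<forall>x y. snd (X (x, y)) $ i = poly (q 2) x * (y $ i)\<^sup>2 + poly (q 1) x * y $ i + poly (q (0::nat)) x" for i
  proof -
    obtain r0 where r0: "\<And>x. snd (X (x, vec_upd 0 i 0)) $ i = poly r0 x"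
      using polynomial_fun_base[OF pf(2)] by metis
    obtain r1 where r1: "\<And>x. snd (X (x, vec_upd 0 i 1)) $ i = poly r1 x"
      using polynomial_fun_base[OF pf(2)] by metis
    obtain r2 where r2: "\<And>x. snd (X (x, vec_upd 0 i (-1))) $ i = poly r2 x"
      using polynomial_fun_base[OF pf(2)] by metis
    define q where "q = (\<lambda>k::nat. if k = 2 then smult (1/2) (r1 + r2) - r0
       else if k = 1 then smult (1/2) (r1 - r2) else r0)"
    have "snd (X (x, y)) $ i = poly (q 2) x * (y $ i)\<^sup>2 + poly (q 1) x * y $ i + poly (q 0) x" for x y
    proof -
      obtain P where P: "\<And>x. snd (X (x, y)) $ i = poly P x" using polynomial_fun_base[OF pf(2)] by metis
      have "P = smult ((y $ i)\<^sup>2) (q 2) + smult (y $ i) (q 1) + q 0"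
      proof (rule poly_eq_if_cofinite[OF assms(4)])
        fix x assume "Some x \<notin> vertical_base \<F>"
        then obtain a b c where abc: "\<And>y. snd (X (x, y)) $ i = a * (y $ i)\<^sup>2 + b * y $ i + c"
          using affine_field_fibre_form[OF assms(1-3)] by metis
        have "poly r0 x = c" "poly r1 x = a + b + c" "poly r2 x = a - b + c"
          by (simp_all flip: r0 r1 r2 add: abc vec_upd_nth)
        then have "poly (q 2) x = a" "poly (q 1) x = b" "poly (q 0) x = c"
          by (simp_all add: q_def field_simps)
        then show "poly P x = poly (smult ((y $ i)\<^sup>2) (q 2) + smult (y $ i) (q 1) + q 0) x"
          by (simp flip: P add: abc)
      qed
      then show ?thesis by (simp add: P mult.commute)
    qed
    then show ?thesis by blast
  qed
  then obtain q where q: "\<And>i x y. snd (X (x, y)) $ i =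
     poly (q i 2) x * (y $ i)\<^sup>2 + poly (q i 1) x * y $ i + poly (q i (0::nat)) x" by metis
  have "X (x, y) = (poly p x, \<chi> i. poly (q i 2) x * (y $ i)\<^sup>2 + poly (q i 1) x * y $ i + poly (q i 0) x)" for x y
    by (simp add: prod_eq_iff vec_eq_iff p' q)
  then show ?thesis by (rule that)
qed

section \<open>Vertical fibres and their invariance\<close>

lemma open_iff_eventually_nhds: "open S \<longleftrightarrow> (\<forall>x\<in>S. eventually (\<lambda>y. y \<in> S) (nhds x))"
  unfolding eventually_nhds by (subst open_subopen) (simp only: subset_iff Ball_def)

lemma continuous_on_coord_change:
  "(\<And>x. x \<in> A \<Longrightarrow> b = b' \<or> f x \<noteq> 0) \<Longrightarrow> continuous_on A f \<Longrightarrow>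
    continuous_on A (\<lambda>x. coord_change b b' (f x))"
  unfolding coord_change_def by (cases "b = b'") (auto intro!: continuous_intros)

lemma continuous_on_chart_change: "continuous_on (chart_overlap c c') (chart_change c c')"
  unfolding chart_change_def
  by (intro continuous_on_Pair continuous_on_vec_lambda continuous_on_coord_change continuous_intros)
    (auto simp: chart_overlap_def)

lemma norm_vector_scalar_mult: "norm (a *s (v :: complex ^ 'n::finite)) = norm a * norm v"
  unfolding norm_vec_def by (simp add: norm_mult L2_set_right_distrib)

definition vertical_at :: "'n::finite local_field set \<Rightarrow> 'n total \<Rightarrow> bool" where
  "vertical_at \<F> q \<longleftrightarrow> (\<exists>c U Z z. (c, U, Z) \<in> \<F> \<and> z \<in> U \<and> chart c z = q \<and> fst (Z z) = 0)"

lemma vertical_base_iff: "x \<in> vertical_base \<F> \<longleftrightarrow> (\<exists>q. fst q = x \<and> vertical_at \<F> q)"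
  unfolding vertical_base_def vertical_at_def by blast

lemma vertical_at_iff:
  assumes "singular_foliation \<F>" "(c, U, Z) \<in> \<F>" "z \<in> U"
  shows "vertical_at \<F> (chart c z) \<longleftrightarrow> fst (Z z) = 0"
proof
  assume "vertical_at \<F> (chart c z)"
  then obtain c' U' Z' z' where *: "(c', U', Z') \<in> \<F>" "z' \<in> U'" "chart c' z' = chart c z" "fst (Z' z') = 0"
    unfolding vertical_at_def by blast
  obtain g where "fst (Z z) = g * (coord_change_deriv (fst c') (fst c) (fst z') * fst (Z' z'))"
    using compatibleD[OF generators_compatible[OF assms(1) *(1) assms(2)] *(2) assms(3) *(3)] by metis
  then show "fst (Z z) = 0" using * by simp
qed (use assms in \<open>unfold vertical_at_def, blast\<close>)

lemma fst_generator_nonzero: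
  "(c, U, Z) \<in> \<F> \<Longrightarrow> z \<in> U \<Longrightarrow> fst (chart c z) \<notin> vertical_base \<F> \<Longrightarrow> fst (Z z) \<noteq> 0"
  using vertical_baseI by blast

lemma product_ball_subset:
  fixes U :: "'n::finite affine set"
  assumes "open U" "(t0, y0) \<in> U"
  obtains r where "r > 0" "ball t0 r \<times> ball y0 r \<subseteq> U"
proof -
  obtain A B where "open A" "open B" "(t0, y0) \<in> A \<times> B" "A \<times> B \<subseteq> U"
    using assms(1)[unfolded open_prod_def, THEN bspec, OF assms(2)] by blast
  then have AB: "open A" "open B" "t0 \<in> A" "y0 \<in> B" "A \<times> B \<subseteq> U" by auto
  obtain r1 where r1: "r1 > 0" "ball t0 r1 \<subseteq> A" using AB(1,3) by (rule openE)
  obtain r2 where r2: "r2 > 0" "ball y0 r2 \<subseteq> B" using AB(2,4) by (rule openE)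
  have "ball t0 (min r1 r2) \<times> ball y0 (min r1 r2) \<subseteq> U"
    using r1 r2 AB(5) by fastforce
  then show ?thesis using r1(1) r2(1) that[of "min r1 r2"] by simp
qed

text \<open>Nonvanishing is an open condition. For the vanishing case, each nearby \<open>y\<close>
  is joined to \<open>y0\<close> by a complex line in the fibre, and
  \<open>no_isolated_zero_slice\<close> is applied to the base component along parallel copies of
  this line over neighbouring base points.\<close>

lemma vertical_locally_constant:
  fixes \<F> :: "'n::finite local_field set"
  assumes "singular_foliation \<F>" "finite (vertical_base \<F>)" "(c, U, Z) \<in> \<F>" "(t0, y0) \<in> U"
  shows "eventually (\<lambda>y. (t0, y) \<in> U \<and> (fst (Z (t0, y)) = 0 \<longleftrightarrow> fst (Z (t0, y0)) = 0)) (nhds y0)"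
proof -
  note hol = generator_holomorphic[OF assms(1,3)]
  obtain r1 where r1: "r1 > 0" "ball t0 r1 \<times> ball y0 r1 \<subseteq> U"
    using product_ball_subset[OF hol(1) assms(4)] .
  show ?thesis
  proof (cases "fst (Z (t0, y0)) = 0")
    case False
    have "isCont (\<lambda>z. fst (Z z)) (t0, y0)"
      using holomorphic_fun_continuous_on[OF hol(2)] hol(1) assms(4)
      by (simp add: continuous_on_eq_continuous_at)
    then have "isCont (\<lambda>y. fst (Z (t0, y))) y0"
      by (rule isCont_o2[rotated]) (intro continuous_intros)
    then have "eventually (\<lambda>y. fst (Z (t0, y)) \<in> - {0}) (nhds y0)"
      by (rule eventually_nhds_if_isCont) (use False in \<open>auto simp: open_Compl\<close>)
    moreover have "eventually (\<lambda>y. y \<in> ball y0 r1) (nhds y0)"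
      using r1(1) by (intro eventually_nhds_in_open) auto
    ultimately show ?thesis
      by eventually_elim (use False r1 in auto)
  next
    case True
    \<comment> \<open>The finitely many other vertical base points have to be avoided, so that over
      the disc the base component vanishes at most over \<open>t0\<close>.\<close>
    define K where "K = sphere_chart (fst c) -` vertical_base \<F> - {t0}"
    have "open (- K)" unfolding K_def
      by (intro open_Compl finite_imp_closed finite_Diff finite_sphere_chart_vimage assms)
    moreover have "t0 \<in> - K" by (simp add: K_def)
    ultimately obtain r2 where r2: "r2 > 0" "ball t0 r2 \<subseteq> - K" by (rule openE)
    define r where "r = min r1 r2"
    have r: "r > 0" "ball t0 r \<subseteq> - K" "ball t0 r \<times> ball y0 r \<subseteq> U"
    proof -
      show "r > 0" using r1 r2 by (simp add: r_def)
      show "ball t0 r \<subseteq> - K" using r2 subset_ball[of r r2 t0] by (auto simp: r_def)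
      have "ball t0 r \<times> ball y0 r \<subseteq> ball t0 r1 \<times> ball y0 r1" by (auto simp: r_def)
      then show "ball t0 r \<times> ball y0 r \<subseteq> U" using r1 by blast
    qed
    have van: "fst (Z (t0, y)) = 0" if y: "y \<in> ball y0 r" for y
    proof (cases "y = y0")
      case False
      \<comment> \<open>The largest disc of parameters \<open>s\<close> for which the line stays in
        the ball; it contains \<open>s = 1\<close>, the parameter of \<open>y\<close>, because
        \<open>R > 1\<close>.\<close>
      define R where "R = r / norm (y - y0)"
      have R: "R > 1" "norm (y - y0) > 0"
        using False y r(1) by (auto simp: R_def dist_norm norm_minus_commute field_simps)
      have inb: "y0 + s *s (y - y0) \<in> ball y0 r" if "s \<in> ball 0 R" for s
      proof -
        have "dist y0 (y0 + s *s (y - y0)) = norm s * norm (y - y0)"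
          using norm_vector_scalar_mult[of s "y - y0"] by (simp only: dist_norm norm_minus_commute[of y0] add_diff_cancel_left')
        also have "\<dots> < r" using that R(2) by (simp add: R_def field_simps)
        finally show ?thesis by simp
      qed
      define f where "f = (\<lambda>t s. fst (Z (t, y0 + s *s (y - y0))))"
      have "f t0 1 = 0"
      proof (rule no_isolated_zero_slice[of r R t0 f])
        have "continuous_on (ball t0 r \<times> ball 0 R) (\<lambda>p. (fst p, y0 + snd p *s (y - y0)))"
          unfolding vector_scalar_mult_def by (intro continuous_intros)
        then have "continuous_on (ball t0 r \<times> ball 0 R) (\<lambda>p. fst (Z (fst p, y0 + snd p *s (y - y0))))"
          by (rule continuous_on_compose2[OF holomorphic_fun_continuous_on[OF hol(2)]])
            (use inb r in auto)
        then show "continuous_on (ball t0 r \<times> ball 0 R) (\<lambda>(t, s). f t s)"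
          by (simp add: f_def case_prod_beta)
        show "f t holomorphic_on ball 0 R" if "t \<in> ball t0 r" for t
          unfolding f_def
        proof (rule holomorphic_on_along_curve[OF hol(2) open_ball])
          show "(\<lambda>s. (t, y0 + s *s (y - y0))) ` ball 0 R \<subseteq> U" using that inb r by auto
          show "((\<lambda>s. (t, y0 + s *s (y - y0))) has_derivative (\<lambda>h. cscale h (0, y - y0))) (at s)" for s
            using has_derivative_line[of "(t, y0)" "(0, y - y0)" s] by (simp add: cscale_def)
        qed
        show "f t s \<noteq> 0" if "t \<in> ball t0 r" "t \<noteq> t0" "s \<in> ball 0 R" for t s
          unfolding f_def
        proof (rule fst_generator_nonzero[OF assms(3)])
          show "(t, y0 + s *s (y - y0)) \<in> U" using that inb r by auto
          show "fst (chart c (t, y0 + s *s (y - y0))) \<notin> vertical_base \<F>"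
            using r(2) that(1,2) by (auto simp: fst_chart K_def)
        qed
        show "f t0 0 = 0" using True by (simp add: f_def)
      qed (use r R in auto)
      then show ?thesis by (simp add: f_def)
    qed (use True in simp)
    have "eventually (\<lambda>y. y \<in> ball y0 r) (nhds y0)"
      using r(1) by (intro eventually_nhds_in_open) auto
    then show ?thesis
      by eventually_elim (use van True r in auto)
  qed
qed

text \<open>In each product chart of the fibre verticality is an open and closed condition, hence
  holds everywhere or nowhere. All these charts contain the point with every coordinate 1, and it
  has the same parameters in each of them, so the answer is the same for all charts.\<close>

lemma vertical_fibre:
  fixes \<F> :: "'n::finite local_field set"
  assumes "singular_foliation \<F>" "finite (vertical_base \<F>)" "fst q \<in> vertical_base \<F>"
  shows "vertical_at \<F> q"
proof -
  obtain b t0 where x: "fst q = sphere_chart b t0" by (rule sphere_chart_surj)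
  define V where "V = (\<lambda>d. {y. vertical_at \<F> (chart (b, d) (t0, y))})"
  have ev: "eventually (\<lambda>y'. y' \<in> V d \<longleftrightarrow> y \<in> V d) (nhds y)" for d :: "'n \<Rightarrow> bool" and y
  proof -
    let ?e = "(b, d)"
    obtain c U Z z where z: "(c, U, Z) \<in> \<F>" "z \<in> U" "chart c z = chart ?e (t0, y)"
      using generator_through[OF assms(1)] .
    have z': "(t0, y) \<in> chart_overlap ?e c" "z = chart_change ?e c (t0, y)"
      using z(3) chart_eq_iff_chart_change by metis+
    have "isCont (chart_change ?e c) (t0, y)"
      using continuous_on_chart_change[of ?e c] z'(1) open_chart_overlap[of ?e c]
      by (simp add: continuous_on_eq_continuous_at)
    then have "isCont (\<lambda>y. chart_change ?e c (t0, y)) y"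
      by (rule isCont_o2[rotated]) (intro continuous_intros)
    then have "isCont (\<lambda>y. snd (chart_change ?e c (t0, y))) y" by (intro continuous_intros)
    note cont = this
    obtain S where S: "open S" "snd z \<in> S"
      "\<And>w. w \<in> S \<Longrightarrow> (fst z, w) \<in> U \<and> (fst (Z (fst z, w)) = 0 \<longleftrightarrow> fst (Z z) = 0)"
      using vertical_locally_constant[OF assms(1,2) z(1), of "fst z" "snd z"] z(2)
      unfolding eventually_nhds by auto
    have "eventually (\<lambda>y'. snd (chart_change ?e c (t0, y')) \<in> S) (nhds y)"
      by (rule eventually_nhds_if_isCont[OF cont S(1)]) (use S(2) z'(2) in simp)
    moreover have "eventually (\<lambda>y'. y' \<in> Pair t0 -` chart_overlap ?e c) (nhds y)"
      by (intro eventually_nhds_in_open open_vimage open_chart_overlap continuous_intros)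
        (use z'(1) in simp)
    ultimately show ?thesis
    proof eventually_elim
      case (elim y')
      note elim = elim(2) S(3)[OF elim(1)]
      have "fst z = fst (chart_change ?e c (t0, y'))" using z'(2) by (simp add: chart_change_def)
      then have "chart_change ?e c (t0, y') = (fst z, snd (chart_change ?e c (t0, y')))"
        by (metis prod.collapse)
      then have "chart ?e (t0, y') = chart c (fst z, snd (chart_change ?e c (t0, y')))"
        using elim by (simp add: chart_eq_iff_chart_change)
      then show ?case
        using elim z vertical_at_iff[OF assms(1) z(1)] by (simp add: V_def flip: z(3))
    qed
  qed
  have clopenV: "V d = {} \<or> V d = UNIV" for d
  proof -
    have "open (V d)" unfolding open_iff_eventually_nhds
    proof
      fix y assume "y \<in> V d"
      then show "eventually (\<lambda>y. y \<in> V d) (nhds y)" using ev[of d y] by (auto elim: eventually_mono)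
    qed
    moreover have "open (- V d)" unfolding open_iff_eventually_nhds
    proof
      fix y assume "y \<in> - V d"
      then show "eventually (\<lambda>y. y \<in> - V d) (nhds y)" using ev[of d y] by (auto elim: eventually_mono)
    qed
    ultimately show ?thesis using clopen[of "V d"] by (simp add: closed_open)
  qed
  have one: "(\<chi> i. 1) \<in> V d \<longleftrightarrow> (\<chi> i. 1) \<in> V d'" for d d'
  proof -
    have "chart (b, d) (t0, \<chi> i. 1) = chart (b, d') (t0, \<chi> i. 1)"
      unfolding chart_eq_iff by (simp add: sphere_chart_def)
    then show ?thesis by (simp add: V_def)
  qed
  have ex: "\<exists>d y. q' = chart (b, d) (t0, y)" if "fst q' = fst q" for q'
  proof -
    have "\<exists>d s. snd q' $ i = sphere_chart d s" for i using sphere_chart_surj by metis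
    then obtain d s where "\<And>i. snd q' $ i = sphere_chart (d i) (s i)" by metis
    then have "q' = chart (b, d) (t0, \<chi> i. s i)"
      using that x by (simp add: prod_eq_iff vec_eq_iff fst_chart snd_chart)
    then show ?thesis by blast
  qed
  obtain q' where q': "fst q' = fst q" "vertical_at \<F> q'"
    using assms(3) vertical_base_iff[of "fst q" \<F>] by blast
  obtain d' y' where "q' = chart (b, d') (t0, y')" using ex[OF q'(1)] by blast
  then have "y' \<in> V d'" using q'(2) by (simp add: V_def)
  then have V': "V d' = UNIV" using clopenV[of d'] by auto
  obtain d y where q: "q = chart (b, d) (t0, y)" using ex[of q] by blast
  have "(\<chi> i. 1) \<in> V d" using one[of d d'] V' by simp
  then have "V d = UNIV" using clopenV[of d] by auto
  then have "y \<in> V d" by simp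
  then show ?thesis by (simp add: V_def q)
qed

text \<open>By continuity \<open>norm (h z) < 1\<close> near the base point, where \<open>h\<close>
  vanishes. For fixed \<open>y\<close> the Schwarz lemma, rescaled to radius \<open>r\<close>, then
  gives the bound with \<open>K = 1 / r\<close>, uniformly in \<open>y\<close>.\<close>

lemma lipschitz_at_zero_fibre:
  fixes h :: "'n::finite affine \<Rightarrow> complex"
  assumes "holomorphic_fun h U" "(t0, y0) \<in> U" "\<And>y. (t0, y) \<in> U \<Longrightarrow> h (t0, y) = 0"
  obtains r K where "r > 0" "ball t0 r \<times> ball y0 r \<subseteq> U"
    "\<forall>t\<in>ball t0 r. \<forall>y\<in>ball y0 r. norm (h (t, y)) \<le> K * norm (t - t0)"
proof -
  note U = holomorphic_fun_open[OF assms(1)]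
  have "isCont h (t0, y0)"
    using holomorphic_fun_continuous_on[OF assms(1)] U assms(2)
    by (simp add: continuous_on_eq_continuous_at)
  moreover have "open (ball (0::complex) 1)" "h (t0, y0) \<in> ball 0 1" using assms(2,3) by auto
  ultimately have "eventually (\<lambda>z. h z \<in> ball 0 1) (nhds (t0, y0))"
    by (rule eventually_nhds_if_isCont)
  then obtain S where S: "open S" "(t0, y0) \<in> S" "\<And>z. z \<in> S \<Longrightarrow> h z \<in> ball 0 1"
    unfolding eventually_nhds by blast
  obtain r where r: "r > 0" "ball t0 r \<times> ball y0 r \<subseteq> U \<inter> S"
    using product_ball_subset[of "U \<inter> S" t0 y0] U S assms(2) by blast
  have "norm (h (t, y)) \<le> (1 / r) * norm (t - t0)" if t: "t \<in> ball t0 r" and y: "y \<in> ball y0 r" for t y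
  proof -
    define f where "f = (\<lambda>w. h (t0 + of_real r * w, y))"
    have inb: "t0 + of_real r * w \<in> ball t0 r" if "norm w < 1" for w :: complex
      using that r(1) by (simp add: dist_norm norm_mult)
    have "f holomorphic_on ball 0 1" unfolding f_def
    proof (rule holomorphic_on_along_curve[OF assms(1) open_ball])
      show "(\<lambda>w. (t0 + of_real r * w, y)) ` ball 0 1 \<subseteq> U" using inb y r(2) by auto
      show "((\<lambda>w. (t0 + of_real r * w, y)) has_derivative (\<lambda>h. cscale h (of_real r, 0))) (at w)" for w
        using has_derivative_line[of "(t0, y)" "(of_real r, 0)" w] by (simp add: cscale_def mult.commute)
    qed
    moreover have "(t0, y) \<in> U" using r y by (meson IntD1 SigmaI centre_in_ball subsetD)
    then have "f 0 = 0" using assms(3)[of y] by (simp add: f_def)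
    moreover have "norm (f w) < 1" if "norm w < 1" for w
    proof -
      have "(t0 + of_real r * w, y) \<in> S" using inb[OF that] y r(2) by blast
      then show ?thesis using S(3) by (fastforce simp: f_def)
    qed
    moreover have tw: "norm ((t - t0) / of_real r) < 1"
      using t r(1) by (simp add: dist_norm norm_divide norm_minus_commute)
    ultimately have "norm (f ((t - t0) / of_real r)) \<le> norm ((t - t0) / of_real r)"
      using Schwarz_Lemma(1) by blast
    then show ?thesis using r(1) by (simp add: f_def norm_divide)
  qed
  then have "\<forall>t\<in>ball t0 r. \<forall>y\<in>ball y0 r. norm (h (t, y)) \<le> (1 / r) * norm (t - t0)" by blast
  moreover have "ball t0 r \<times> ball y0 r \<subseteq> U" using r(2) by blast
  ultimately show ?thesis using that r(1) by blast
qed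

lemma openin_leaf_topology:
  assumes "(c, U, Z) \<in> \<F>" "open D" "\<gamma> ` D \<subseteq> U" "chart c ` \<gamma> ` D \<subseteq> W"
    "\<And>t. t \<in> D \<Longrightarrow> Z (\<gamma> t) \<noteq> 0 \<and> (\<gamma> has_derivative (\<lambda>h. cscale h (Z (\<gamma> t)))) (at t)"
  shows "openin (leaf_topology \<F> W) (chart c ` \<gamma> ` D)"
  unfolding leaf_topology_def
  by (rule topology_generated_by_Basis) (use assms in blast)

lemma topspace_leaf_topologyE:
  assumes "q \<in> topspace (leaf_topology \<F> W)"
  obtains c U Z \<gamma> D t where "(c, U, Z) \<in> \<F>" "open D" "\<gamma> ` D \<subseteq> U" "chart c ` \<gamma> ` D \<subseteq> W"
    "\<forall>t\<in>D. Z (\<gamma> t) \<noteq> 0 \<and> (\<gamma> has_derivative (\<lambda>h. cscale h (Z (\<gamma> t)))) (at t)"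
    "t \<in> D" "q = chart c (\<gamma> t)"
proof -
  obtain A where A: "A \<in> {chart c ` \<gamma> ` D | c U Z \<gamma> D. (c, U, Z) \<in> \<F> \<and> open D \<and> \<gamma> ` D \<subseteq> U \<and> chart c ` \<gamma> ` D \<subseteq> W \<and>
        (\<forall>t\<in>D. Z (\<gamma> t) \<noteq> 0 \<and> (\<gamma> has_derivative (\<lambda>h. cscale h (Z (\<gamma> t)))) (at t))}" "q \<in> A"
    using assms unfolding leaf_topology_def topology_generated_by_topspace by (rule UnionE)
  from A(1) show ?thesis
    unfolding mem_Collect_eq
  proof (elim exE conjE)
    fix c U Z \<gamma> D
    assume *: "A = chart c ` \<gamma> ` D" "(c, U, Z) \<in> \<F>" "open D" "\<gamma> ` D \<subseteq> U" "chart c ` \<gamma> ` D \<subseteq> W"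
      "\<forall>t\<in>D. Z (\<gamma> t) \<noteq> 0 \<and> (\<gamma> has_derivative (\<lambda>h. cscale h (Z (\<gamma> t)))) (at t)"
    from A(2) *(1) obtain t where "t \<in> D" "q = chart c (\<gamma> t)" by blast
    with * show ?thesis using that by blast
  qed
qed

text \<open>Over a vertical base point the base component of a generator vanishes on the whole
  fibre, so along an integral curve the distance of the base coordinate from that point has a
  derivative bounded by a multiple of itself, and it stays 0. Off these fibres a curve remains off
  them for nearby times, since they lie over a finite set. Hence the union of vertical fibres is
  open and closed in the leaf topology, and a connected leaf cannot cross it.\<close>

lemma invariant_vertical_fibres:
  fixes \<F> :: "'n::finite local_field set"
  assumes "singular_foliation \<F>" "finite (vertical_base \<F>)"
  shows "invariant_under \<F> (fst -` vertical_base \<F>)"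
proof -
  let ?T = "leaf_topology \<F> UNIV" and ?A = "fst -` vertical_base \<F> :: 'n total set"
  have local: "\<exists>V. openin ?T V \<and> q \<in> V \<and> (V \<subseteq> ?A \<or> V \<subseteq> - ?A)" if q: "q \<in> topspace ?T" for q
  proof -
    obtain c U Z \<gamma> D t0 where g: "(c, U, Z) \<in> \<F>" "open D" "\<gamma> ` D \<subseteq> U"
      "\<forall>t\<in>D. Z (\<gamma> t) \<noteq> 0 \<and> (\<gamma> has_derivative (\<lambda>h. cscale h (Z (\<gamma> t)))) (at t)"
      "t0 \<in> D" "q = chart c (\<gamma> t0)"
      by (rule topspace_leaf_topologyE[OF q])
    have op: "openin ?T (chart c ` \<gamma> ` D')" if "open D'" "D' \<subseteq> D" for D'
      by (rule openin_leaf_topology[OF g(1) that(1)]) (use g(3,4) that in auto)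
    have contg: "continuous_on D \<gamma>"
      by (rule continuous_at_imp_continuous_on) (use g(4) has_derivative_continuous in blast)
    show ?thesis
    proof (cases "q \<in> ?A")
      case False
      define D' where "D' = D \<inter> (\<lambda>t. fst (\<gamma> t)) -` (- (sphere_chart (fst c) -` vertical_base \<F>))"
      have "open D'" unfolding D'_def
        by (intro continuous_open_preimage continuous_intros contg g(2) open_Compl
            finite_imp_closed finite_sphere_chart_vimage assms(2))
      moreover have "t0 \<in> D'" using False g(5,6) by (simp add: D'_def fst_chart)
      moreover have "chart c ` \<gamma> ` D' \<subseteq> - ?A" by (auto simp: D'_def fst_chart)
      ultimately show ?thesis using op[of D'] g(6) by (intro exI[of _ "chart c ` \<gamma> ` D'"]) (auto simp: D'_def)
    next
      case True
      note hol = generator_holomorphic[OF assms(1) g(1)]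
      let ?x = "fst (\<gamma> t0)"
      have zero: "fst (Z (?x, y)) = 0" if "(?x, y) \<in> U" for y
      proof -
        have "fst (chart c (?x, y)) \<in> vertical_base \<F>" using True g(6) by (simp add: fst_chart)
        then have "vertical_at \<F> (chart c (?x, y))" by (rule vertical_fibre[OF assms])
        then show ?thesis using vertical_at_iff[OF assms(1) g(1) that] by simp
      qed
      have "(?x, snd (\<gamma> t0)) \<in> U" using g(3,5) by auto
      then obtain r K where r: "r > 0" "ball ?x r \<times> ball (snd (\<gamma> t0)) r \<subseteq> U"
        "\<forall>t\<in>ball ?x r. \<forall>y\<in>ball (snd (\<gamma> t0)) r. norm (fst (Z (t, y))) \<le> K * norm (t - ?x)"
        by (rule lipschitz_at_zero_fibre[OF hol(2) _ zero])
      define D' where "D' = D \<inter> \<gamma> -` (ball ?x r \<times> ball (snd (\<gamma> t0)) r)"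
      have D': "open D'" "t0 \<in> D'" "D' \<subseteq> D"
        unfolding D'_def using g(2,5) r(1)
        by (auto intro!: continuous_open_preimage contg open_Times simp: mem_Times_iff)
      have der: "((\<lambda>t. fst (\<gamma> t) - ?x) has_field_derivative fst (Z (\<gamma> t))) (at t)" if "t \<in> D'" for t
          using bspec[OF g(4), of t] that D'(3) unfolding has_derivative_affine_iff
          by (auto intro!: derivative_eq_intros)
      have le: "norm (fst (Z (\<gamma> t))) \<le> K * norm (fst (\<gamma> t) - ?x)" if "t \<in> D'" for t
        proof -
          have "fst (\<gamma> t) \<in> ball ?x r" "snd (\<gamma> t) \<in> ball (snd (\<gamma> t0)) r"
            using that by (auto simp: D'_def mem_Times_iff)
          then have "norm (fst (Z (fst (\<gamma> t), snd (\<gamma> t)))) \<le> K * norm (fst (\<gamma> t) - ?x)"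
            using r(3) by blast
          then show ?thesis by simp
        qed
      obtain \<rho> where \<rho>: "\<rho> > 0" "ball t0 \<rho> \<subseteq> D'" "\<forall>t\<in>ball t0 \<rho>. fst (\<gamma> t) - ?x = 0"
        by (rule vanishes_near_if_deriv_le[where f="\<lambda>t. fst (\<gamma> t) - ?x" and f'="\<lambda>t. fst (Z (\<gamma> t))" and K=K,
              OF D'(1,2) right_minus_eq[THEN iffD2, OF refl] der le])
      have "openin ?T (chart c ` \<gamma> ` ball t0 \<rho>)"
        using \<rho>(2) D'(3) by (intro op) auto
      moreover have "chart c ` \<gamma> ` ball t0 \<rho> \<subseteq> ?A"
        using \<rho>(3) True g(6) by (auto simp: fst_chart)
      ultimately show ?thesis using g(6) \<rho>(1)
        by (intro exI[of _ "chart c ` \<gamma> ` ball t0 \<rho>"]) auto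
    qed
  qed
  have op1: "openin ?T (topspace ?T \<inter> ?A)"
  proof (subst openin_subopen, intro ballI)
    fix q assume q: "q \<in> topspace ?T \<inter> ?A"
    then obtain V where "openin ?T V" "q \<in> V" "V \<subseteq> ?A \<or> V \<subseteq> - ?A" using local[of q] by blast
    then show "\<exists>V. openin ?T V \<and> q \<in> V \<and> V \<subseteq> topspace ?T \<inter> ?A"
      using q openin_subset[of ?T V] by (intro exI[of _ V]) auto
  qed
  have op2: "openin ?T (topspace ?T - (topspace ?T \<inter> ?A))"
  proof (subst openin_subopen, intro ballI)
    fix q assume q: "q \<in> topspace ?T - (topspace ?T \<inter> ?A)"
    then obtain V where "openin ?T V" "q \<in> V" "V \<subseteq> ?A \<or> V \<subseteq> - ?A" using local[of q] by blast
    then show "\<exists>V. openin ?T V \<and> q \<in> V \<and> V \<subseteq> topspace ?T - (topspace ?T \<inter> ?A)"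
      using q openin_subset[of ?T V] by (intro exI[of _ V]) auto
  qed
  have cl: "closedin ?T (topspace ?T \<inter> ?A)"
    using op2 by (simp add: closedin_def)
  show ?thesis unfolding invariant_under_def leaves_def
  proof (intro ballI impI)
    fix L assume L: "L \<in> connected_components_of ?T" "L \<inter> ?A \<noteq> {}"
    have "connectedin ?T L" using L(1) by (rule connectedin_connected_components_of)
    from connectedin_clopen_cases[OF this cl op1]
    have "L \<subseteq> topspace ?T \<inter> ?A \<or> disjnt L (topspace ?T \<inter> ?A)" .
    moreover have "L \<subseteq> topspace ?T"
      using \<open>connectedin ?T L\<close> by (rule connectedin_subset_topspace)
    ultimately show "L \<subseteq> ?A" using L(2) by (auto simp: disjnt_def)
  qed
qed

lemma analytic_subset_fibres:
  assumes "finite S"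
  shows "analytic_subset (fst -` S :: 'n::finite total set)"
  unfolding analytic_subset_def
proof (intro allI)
  fix c :: "'n chart_id" and z :: "'n affine"
  let ?K = "sphere_chart (fst c) -` S"
  let ?f = "\<lambda>w :: 'n affine. \<Prod>k\<in>?K. fst w - k"
  have K: "finite ?K" using assms by (rule finite_sphere_chart_vimage)
  have "holomorphic_fun ?f UNIV"
    by (rule holomorphic_fun_base) (intro holomorphic_intros)
  moreover have "{w \<in> UNIV. chart c w \<in> fst -` S} = {w \<in> UNIV. \<forall>f\<in>{?f}. f w = 0}"
    using K by (auto simp: fst_chart)
  ultimately show "\<exists>U \<Phi>. open U \<and> z \<in> U \<and> finite \<Phi> \<and> (\<forall>f\<in>\<Phi>. holomorphic_fun f U) \<and>
        {w \<in> U. chart c w \<in> fst -` S} = {w \<in> U. \<forall>f\<in>\<Phi>. f w = 0}"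
    by (intro exI[of _ UNIV] exI[of _ "{?f}"]) simp
qed

section \<open>Riccati equations on the sphere\<close>

text \<open>The right-hand side of one Riccati equation in either chart of the sphere: the
  substitution \<open>w = 1 / y\<close> turns the second formula into the first, which is again
  quadratic, so the equation is regular at infinity.\<close>

definition riccati_slope :: "bool \<Rightarrow> complex \<Rightarrow> complex \<Rightarrow> complex \<Rightarrow> complex \<Rightarrow> complex" where
  "riccati_slope b \<alpha> \<beta> \<gamma> w = (if b then - (\<alpha> + \<beta> * w + \<gamma> * w\<^sup>2) else \<alpha> * w\<^sup>2 + \<beta> * w + \<gamma>)"

definition homogeneous :: "complex option \<Rightarrow> complex \<times> complex" where
  "homogeneous f = (case f of None \<Rightarrow> (1, 0) | Some y \<Rightarrow> (y, 1))"

text \<open>The point of the projective line with homogeneous coordinates \<open>a\<close>,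
  \<open>b\<close>; \<open>homogeneous\<close> chooses representatives. The pair of two zeros, which
  is no point, also gets the value infinity, so it is excluded wherever equality of ratios has to be
  informative.\<close>

definition sphere_ratio :: "complex \<Rightarrow> complex \<Rightarrow> complex option" where
  "sphere_ratio a b = (if b = 0 then None else Some (a / b))"

lemma sphere_ratio_eq_chart_iff:
  "u \<noteq> 0 \<or> v \<noteq> 0 \<Longrightarrow> sphere_ratio u v = sphere_chart b w \<longleftrightarrow> (if b then v = w * u else u = w * v)"
  by (auto simp: sphere_ratio_def sphere_chart_def field_simps)

lemma sphere_ratio_eq_imp:
  "u \<noteq> 0 \<or> v \<noteq> 0 \<Longrightarrow> u' \<noteq> 0 \<or> v' \<noteq> 0 \<Longrightarrow> sphere_ratio u v = sphere_ratio u' v' \<Longrightarrow> u * v' = u' * v"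
  by (auto simp: sphere_ratio_def field_simps split: if_splits)

lemma sphere_ratio_scale: "k \<noteq> 0 \<Longrightarrow> sphere_ratio (k * u) (k * v) = sphere_ratio u v"
  by (simp add: sphere_ratio_def)

lemma homogeneous_nonzero: "fst (homogeneous f) \<noteq> 0 \<or> snd (homogeneous f) \<noteq> 0"
  by (auto simp: homogeneous_def split: option.splits)

lemma homogeneous_inj:
  "fst (homogeneous f) * snd (homogeneous f') = fst (homogeneous f') * snd (homogeneous f) \<Longrightarrow> f = f'"
  by (auto simp: homogeneous_def split: option.splits)

lemma sphere_ratio_homogeneous: "sphere_ratio (fst (homogeneous f)) (snd (homogeneous f)) = f"
  by (auto simp: homogeneous_def sphere_ratio_def split: option.splits)

lemma homogeneous_sphere_ratio:
  assumes "u \<noteq> 0 \<or> v \<noteq> 0"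
  obtains k where "k \<noteq> 0" "u = k * fst (homogeneous (sphere_ratio u v))"
    "v = k * snd (homogeneous (sphere_ratio u v))"
  using assms by (cases "v = 0") (auto simp: homogeneous_def sphere_ratio_def intro: that[of u] that[of v])

text \<open>A matrix of determinant 1 acts bijectively on the projective line. Uniqueness comes from
  multiplicativity of determinants: the cross product of two images equals that of the two
  arguments.\<close>

lemma moebius_bij:
  assumes "u1 * v2 - u2 * v1 = (1::complex)"
  shows "\<exists>!f. sphere_ratio (u1 * fst (homogeneous f) + u2 * snd (homogeneous f))
     (v1 * fst (homogeneous f) + v2 * snd (homogeneous f)) = y"
proof -
  define U where "U = (\<lambda>f. u1 * fst (homogeneous f) + u2 * snd (homogeneous f))"
  define V where "V = (\<lambda>f. v1 * fst (homogeneous f) + v2 * snd (homogeneous f))"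
  have inv1: "v2 * U f - u2 * V f = (u1 * v2 - u2 * v1) * fst (homogeneous f)"
    "u1 * V f - v1 * U f = (u1 * v2 - u2 * v1) * snd (homogeneous f)" for f
    by (simp_all add: U_def V_def algebra_simps)
  have nz: "U f \<noteq> 0 \<or> V f \<noteq> 0" for f
    using inv1[of f] homogeneous_nonzero[of f] assms by auto
  have ex: "\<exists>f. sphere_ratio (U f) (V f) = y"
  proof -
    define h1 where "h1 = fst (homogeneous y)"
    define h2 where "h2 = snd (homogeneous y)"
    \<comment> \<open>The adjugate matrix applied to homogeneous coordinates of \<open>y\<close>
      yields those of the preimage.\<close>
    define k1 where "k1 = v2 * h1 - u2 * h2"
    define k2 where "k2 = u1 * h2 - v1 * h1"
    have h: "u1 * k1 + u2 * k2 = (u1 * v2 - u2 * v1) * h1" "v1 * k1 + v2 * k2 = (u1 * v2 - u2 * v1) * h2"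
      by (simp_all add: k1_def k2_def algebra_simps)
    then have "k1 \<noteq> 0 \<or> k2 \<noteq> 0"
      using homogeneous_nonzero[of y] assms by (auto simp: h1_def h2_def)
    then obtain k where k: "k \<noteq> 0" "k1 = k * fst (homogeneous (sphere_ratio k1 k2))"
      "k2 = k * snd (homogeneous (sphere_ratio k1 k2))"
      using homogeneous_sphere_ratio by blast
    define f where "f = sphere_ratio k1 k2"
    note k' = k(2,3)[folded f_def]
    have "u1 * k1 + u2 * k2 = k * U f" "v1 * k1 + v2 * k2 = k * V f"
      unfolding U_def V_def k' by (simp_all add: algebra_simps)
    then have "h1 = k * U f" "h2 = k * V f" using h assms by simp_all
    then have "sphere_ratio (U f) (V f) = sphere_ratio h1 h2"
      using sphere_ratio_scale[OF k(1)] by simp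
    then show ?thesis
      using sphere_ratio_homogeneous[of y] by (auto simp: h1_def h2_def)
  qed
  have un: "f = f'" if "sphere_ratio (U f) (V f) = y" "sphere_ratio (U f') (V f') = y" for f f'
  proof -
    from that have "U f * V f' = U f' * V f"
      using sphere_ratio_eq_imp[OF nz nz] by metis
    moreover have "U f * V f' - U f' * V f = (u1 * v2 - u2 * v1) *
       (fst (homogeneous f) * snd (homogeneous f') - fst (homogeneous f') * snd (homogeneous f))"
      by (simp add: U_def V_def algebra_simps)
    ultimately show "f = f'" using homogeneous_inj[of f f'] assms by simp
  qed
  have "\<exists>!f. sphere_ratio (U f) (V f) = y" using ex un by blast
  then show ?thesis by (simp add: U_def V_def)
qed

text \<open>
  Putting \<open>y = u / v\<close>, solutions of this traceless linear system become solutions of the Riccati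
  equation \<open>y' = A y\<^sup>2 + B y + C\<close>; since the trace vanishes, the Wronskian is constant.
\<close>

lemma riccati_fundamental_system:
  fixes A B C :: "complex \<Rightarrow> complex"
  assumes "r > 0" "A holomorphic_on ball t0 r" "B holomorphic_on ball t0 r" "C holomorphic_on ball t0 r"
  obtains \<rho> u1 v1 u2 v2 where "0 < \<rho>" "\<rho> \<le> r"
    "\<forall>t\<in>ball t0 \<rho>. (u1 has_field_derivative B t / 2 * u1 t + C t * v1 t) (at t)"
    "\<forall>t\<in>ball t0 \<rho>. (v1 has_field_derivative - A t * u1 t - B t / 2 * v1 t) (at t)"
    "\<forall>t\<in>ball t0 \<rho>. (u2 has_field_derivative B t / 2 * u2 t + C t * v2 t) (at t)"
    "\<forall>t\<in>ball t0 \<rho>. (v2 has_field_derivative - A t * u2 t - B t / 2 * v2 t) (at t)"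
    "\<forall>t\<in>ball t0 \<rho>. u1 t * v2 t - u2 t * v1 t = 1"
proof -
  have hol: "(\<lambda>t. B t / 2) holomorphic_on ball t0 r" "(\<lambda>t. - A t) holomorphic_on ball t0 r"
    "(\<lambda>t. - (B t / 2)) holomorphic_on ball t0 r"
    using assms by (auto intro!: holomorphic_intros)
  obtain \<rho>1 u1 v1 where 1: "0 < \<rho>1" "\<rho>1 \<le> r" "u1 t0 = 1" "v1 t0 = 0"
    "\<And>t. t \<in> ball t0 \<rho>1 \<Longrightarrow> (u1 has_field_derivative B t / 2 * u1 t + C t * v1 t) (at t)"
    "\<And>t. t \<in> ball t0 \<rho>1 \<Longrightarrow> (v1 has_field_derivative - A t * u1 t + - (B t / 2) * v1 t) (at t)"
    using linear_ode_2[OF assms(1) hol(1) assms(4) hol(2,3), of 1 0] by metis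
  obtain \<rho>2 u2 v2 where 2: "0 < \<rho>2" "\<rho>2 \<le> r" "u2 t0 = 0" "v2 t0 = 1"
    "\<And>t. t \<in> ball t0 \<rho>2 \<Longrightarrow> (u2 has_field_derivative B t / 2 * u2 t + C t * v2 t) (at t)"
    "\<And>t. t \<in> ball t0 \<rho>2 \<Longrightarrow> (v2 has_field_derivative - A t * u2 t + - (B t / 2) * v2 t) (at t)"
    using linear_ode_2[OF assms(1) hol(1) assms(4) hol(2,3), of 0 1] by metis
  define \<rho> where "\<rho> = min \<rho>1 \<rho>2"
  have sub: "t \<in> ball t0 \<rho>1" "t \<in> ball t0 \<rho>2" if "t \<in> ball t0 \<rho>" for t
    using that by (auto simp: \<rho>_def)
  have "((\<lambda>t. u1 t * v2 t - u2 t * v1 t) has_field_derivative 0) (at t within ball t0 \<rho>)"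
    if "t \<in> ball t0 \<rho>" for t
    apply (rule has_field_derivative_at_within)
    apply (rule derivative_eq_intros 1(5,6) 2(5,6) sub[OF that] refl)+
    apply (simp add: algebra_simps)
    done
  then obtain c where c: "\<And>t. t \<in> ball t0 \<rho> \<Longrightarrow> u1 t * v2 t - u2 t * v1 t = c"
    using has_field_derivative_zero_constant[OF convex_ball, of t0 \<rho> "\<lambda>t. u1 t * v2 t - u2 t * v1 t"] by blast
  have "t0 \<in> ball t0 \<rho>" using 1(1) 2(1) by (auto simp: \<rho>_def)
  from c[OF this] have "c = 1" using 1(3,4) 2(3,4) by simp
  with c have W: "u1 t * v2 t - u2 t * v1 t = 1" if "t \<in> ball t0 \<rho>" for t
    using that by blast
  show ?thesis
  proof (rule that[of \<rho> u1 v1 u2 v2])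
    show "0 < \<rho>" "\<rho> \<le> r" using 1 2 by (auto simp: \<rho>_def)
  qed (use 1(5,6) 2(5,6) sub W in \<open>simp_all\<close>)
qed

text \<open>A family of sections over one disc, labelled by \<open>f\<close>. The clauses say that
  the sections fill each fibre exactly once, that each of them solves the equation in any chart
  containing the current value, and that a solution run through the base with another time,
  \<open>T\<close> with speed \<open>\<zeta>\<close>, remains near a given time on the section it
  meets then.\<close>

definition riccati_flow :: "complex \<Rightarrow> real \<Rightarrow> (complex \<Rightarrow> complex) \<Rightarrow> (complex \<Rightarrow> complex) \<Rightarrow>
    (complex \<Rightarrow> complex) \<Rightarrow> (complex option \<Rightarrow> complex \<Rightarrow> complex option) \<Rightarrow> bool" where
  "riccati_flow t0 \<rho> A B C \<sigma> \<longleftrightarrow>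
    (\<forall>t\<in>ball t0 \<rho>. \<forall>y. \<exists>!f. \<sigma> f t = y) \<and>
    (\<forall>f. \<forall>t1\<in>ball t0 \<rho>. \<forall>b w1. \<sigma> f t1 = sphere_chart b w1 \<longrightarrow>
      (\<exists>N w. open N \<and> t1 \<in> N \<and> N \<subseteq> ball t0 \<rho> \<and> w t1 = w1 \<and>
         (\<forall>t\<in>N. \<sigma> f t = sphere_chart b (w t) \<and>
            (w has_field_derivative riccati_slope b (A t) (B t) (C t) (w t)) (at t)))) \<and>
    (\<forall>f D \<tau>0 T \<zeta> b w. open D \<longrightarrow> \<tau>0 \<in> D \<longrightarrow> T ` D \<subseteq> ball t0 \<rho> \<longrightarrow> continuous_on D \<zeta> \<longrightarrow>
      (\<forall>\<tau>\<in>D. (T has_field_derivative \<zeta> \<tau>) (at \<tau>)) \<longrightarrow>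
      (\<forall>\<tau>\<in>D. (w has_field_derivative \<zeta> \<tau> * riccati_slope b (A (T \<tau>)) (B (T \<tau>)) (C (T \<tau>)) (w \<tau>)) (at \<tau>)) \<longrightarrow>
      \<sigma> f (T \<tau>0) = sphere_chart b (w \<tau>0) \<longrightarrow>
      (\<exists>e>0. ball \<tau>0 e \<subseteq> D \<and> (\<forall>\<tau>\<in>ball \<tau>0 e. \<sigma> f (T \<tau>) = sphere_chart b (w \<tau>))))"

text \<open>The section labelled \<open>f\<close> is the solution of the linear system with
  coefficient vector \<open>homogeneous f\<close> in the fundamental system, read projectively. It
  is defined on the whole disc of the linear system, whatever poles the affine coordinate
  has.\<close>

lemma riccati_sections:
  fixes A B C :: "complex \<Rightarrow> complex"
  assumes "r > 0" and hol: "A holomorphic_on ball t0 r" "B holomorphic_on ball t0 r" "C holomorphic_on ball t0 r"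
  shows "\<exists>\<rho> \<sigma>. 0 < \<rho> \<and> \<rho> \<le> r \<and>
    riccati_flow t0 \<rho> A B C \<sigma>"
proof -
  obtain \<rho> u1 v1 u2 v2 where \<rho>: "0 < \<rho>" "\<rho> \<le> r"
    and d: "\<forall>t\<in>ball t0 \<rho>. (u1 has_field_derivative B t / 2 * u1 t + C t * v1 t) (at t)"
    "\<forall>t\<in>ball t0 \<rho>. (v1 has_field_derivative - A t * u1 t - B t / 2 * v1 t) (at t)"
    "\<forall>t\<in>ball t0 \<rho>. (u2 has_field_derivative B t / 2 * u2 t + C t * v2 t) (at t)"
    "\<forall>t\<in>ball t0 \<rho>. (v2 has_field_derivative - A t * u2 t - B t / 2 * v2 t) (at t)"
    and W: "\<forall>t\<in>ball t0 \<rho>. u1 t * v2 t - u2 t * v1 t = 1"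
    by (rule riccati_fundamental_system[OF assms(1) hol])
  note d = d[THEN bspec]
  define U where "U = (\<lambda>f t. u1 t * fst (homogeneous f) + u2 t * snd (homogeneous f))"
  define V where "V = (\<lambda>f t. v1 t * fst (homogeneous f) + v2 t * snd (homogeneous f))"
  define \<sigma> where "\<sigma> = (\<lambda>f t. sphere_ratio (U f t) (V f t))"
  have dU: "(U f has_field_derivative B t / 2 * U f t + C t * V f t) (at t)" if "t \<in> ball t0 \<rho>" for f t
    unfolding U_def V_def
    by (rule derivative_eq_intros d[OF that] refl)+ (simp add: algebra_simps)
  have dV: "(V f has_field_derivative - A t * U f t - B t / 2 * V f t) (at t)" if "t \<in> ball t0 \<rho>" for f t
    unfolding U_def V_def
    by (rule derivative_eq_intros d[OF that] refl)+ (simp add: algebra_simps)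
  have nz: "U f t \<noteq> 0 \<or> V f t \<noteq> 0" if "t \<in> ball t0 \<rho>" for f t
  proof -
    have "v2 t * U f t - u2 t * V f t = (u1 t * v2 t - u2 t * v1 t) * fst (homogeneous f)"
      "u1 t * V f t - v1 t * U f t = (u1 t * v2 t - u2 t * v1 t) * snd (homogeneous f)"
      by (simp_all add: U_def V_def algebra_simps)
    then show ?thesis using homogeneous_nonzero[of f] bspec[OF W that] by auto
  qed
  have iff: "\<sigma> f t = sphere_chart b w \<longleftrightarrow> (if b then V f t = w * U f t else U f t = w * V f t)"
    if "t \<in> ball t0 \<rho>" for f t b w
    unfolding \<sigma>_def by (rule sphere_ratio_eq_chart_iff[OF nz[OF that]])
  have P1: "\<forall>t\<in>ball t0 \<rho>. \<forall>y. \<exists>!f. \<sigma> f t = y"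
    unfolding \<sigma>_def U_def V_def using moebius_bij W by simp
  have P2: "\<exists>N w. open N \<and> t1 \<in> N \<and> N \<subseteq> ball t0 \<rho> \<and> w t1 = w1 \<and>
         (\<forall>t\<in>N. \<sigma> f t = sphere_chart b (w t) \<and>
            (w has_field_derivative riccati_slope b (A t) (B t) (C t) (w t)) (at t))"
    if t1: "t1 \<in> ball t0 \<rho>" and s: "\<sigma> f t1 = sphere_chart b w1" for f t1 b w1
  proof -
    have cont: "continuous_on (ball t0 \<rho>) (U f)" "continuous_on (ball t0 \<rho>) (V f)"
      using dU dV by (auto intro!: continuous_at_imp_continuous_on DERIV_isCont)
    show ?thesis
    proof (cases b)
      case False
      define N where "N = ball t0 \<rho> \<inter> V f -` (- {0})"
      have N: "open N" unfolding N_def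
        by (intro continuous_open_preimage cont) auto
      have eq: "U f t1 = w1 * V f t1" using iff[OF t1] s False by simp
      then have "V f t1 \<noteq> 0" using nz[OF t1, of f] by auto
      moreover have "((\<lambda>t. U f t / V f t) has_field_derivative riccati_slope b (A t) (B t) (C t) (U f t / V f t)) (at t)"
        if t: "t \<in> ball t0 \<rho>" "V f t \<noteq> 0" for t
        by (rule derivative_eq_intros dU[OF t(1)] dV[OF t(1)] t refl)+
          (use t False in \<open>simp add: riccati_slope_def field_simps power2_eq_square\<close>)
      ultimately show ?thesis using N t1 eq False
        by (intro exI[of _ N] exI[of _ "\<lambda>t. U f t / V f t"]) (auto simp: N_def iff)
    next
      case True
      define N where "N = ball t0 \<rho> \<inter> U f -` (- {0})"
      have N: "open N" unfolding N_def
        by (intro continuous_open_preimage cont) auto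
      have eq: "V f t1 = w1 * U f t1" using iff[OF t1] s True by simp
      then have "U f t1 \<noteq> 0" using nz[OF t1, of f] by auto
      moreover have "((\<lambda>t. V f t / U f t) has_field_derivative riccati_slope b (A t) (B t) (C t) (V f t / U f t)) (at t)"
        if t: "t \<in> ball t0 \<rho>" "U f t \<noteq> 0" for t
        by (rule derivative_eq_intros dU[OF t(1)] dV[OF t(1)] t refl)+
          (use t True in \<open>simp add: riccati_slope_def field_simps power2_eq_square\<close>)
      ultimately show ?thesis using N t1 eq True
        by (intro exI[of _ N] exI[of _ "\<lambda>t. V f t / U f t"]) (auto simp: N_def iff)
    qed
  qed
  have P3: "\<exists>e>0. ball \<tau>0 e \<subseteq> D \<and> (\<forall>\<tau>\<in>ball \<tau>0 e. \<sigma> f (T \<tau>) = sphere_chart b (w \<tau>))"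
    if D: "open D" "\<tau>0 \<in> D" "T ` D \<subseteq> ball t0 \<rho>" "continuous_on D \<zeta>"
      and dT: "\<forall>\<tau>\<in>D. (T has_field_derivative \<zeta> \<tau>) (at \<tau>)"
      and dw: "\<forall>\<tau>\<in>D. (w has_field_derivative \<zeta> \<tau> * riccati_slope b (A (T \<tau>)) (B (T \<tau>)) (C (T \<tau>)) (w \<tau>)) (at \<tau>)"
      and s: "\<sigma> f (T \<tau>0) = sphere_chart b (w \<tau>0)" for f D \<tau>0 T \<zeta> b w
  proof -
    \<comment> \<open>The determinant of the homogeneous coordinates of the curve and of the
      section, which vanishes exactly when they meet. It satisfies a homogeneous linear equation
      with coefficient \<open>k\<close>, so one zero forces zeros nearby.\<close>
    define \<Delta> where "\<Delta> = (\<lambda>\<tau>. if b then V f (T \<tau>) - w \<tau> * U f (T \<tau>) else w \<tau> * V f (T \<tau>) - U f (T \<tau>))"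
    define k where "k = (\<lambda>\<tau>. \<zeta> \<tau> * (if b then - (B (T \<tau>) / 2 + C (T \<tau>) * w \<tau>) else A (T \<tau>) * w \<tau> + B (T \<tau>) / 2))"
    have TD: "T \<tau> \<in> ball t0 \<rho>" if "\<tau> \<in> D" for \<tau> using D(3) that by blast
    have dD: "(\<Delta> has_field_derivative k \<tau> * \<Delta> \<tau>) (at \<tau>)" if \<tau>: "\<tau> \<in> D" for \<tau>
    proof -
      have dU': "((\<lambda>\<tau>. U f (T \<tau>)) has_field_derivative (B (T \<tau>) / 2 * U f (T \<tau>) + C (T \<tau>) * V f (T \<tau>)) * \<zeta> \<tau>) (at \<tau>)"
        by (rule DERIV_chain2[OF dU[OF TD[OF \<tau>]] bspec[OF dT \<tau>]])
      have dV': "((\<lambda>\<tau>. V f (T \<tau>)) has_field_derivative (- A (T \<tau>) * U f (T \<tau>) - B (T \<tau>) / 2 * V f (T \<tau>)) * \<zeta> \<tau>) (at \<tau>)"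
        by (rule DERIV_chain2[OF dV[OF TD[OF \<tau>]] bspec[OF dT \<tau>]])
      show ?thesis
      proof (cases b)
        case True
        have "((\<lambda>\<tau>. V f (T \<tau>) - w \<tau> * U f (T \<tau>)) has_field_derivative k \<tau> * \<Delta> \<tau>) (at \<tau>)"
          by (rule derivative_eq_intros dU' dV' bspec[OF dw \<tau>] refl)+
            (use True in \<open>simp add: k_def \<Delta>_def riccati_slope_def algebra_simps power2_eq_square\<close>)
        then show ?thesis using True by (simp add: \<Delta>_def)
      next
        case False
        have "((\<lambda>\<tau>. w \<tau> * V f (T \<tau>) - U f (T \<tau>)) has_field_derivative k \<tau> * \<Delta> \<tau>) (at \<tau>)"
          by (rule derivative_eq_intros dU' dV' bspec[OF dw \<tau>] refl)+
            (use False in \<open>simp add: k_def \<Delta>_def riccati_slope_def algebra_simps power2_eq_square\<close>)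
        then show ?thesis using False by (simp add: \<Delta>_def)
      qed
    qed
    have cT: "continuous_on D T" "continuous_on D w"
      using dT dw by (auto intro!: continuous_at_imp_continuous_on DERIV_isCont)
    have hc: "continuous_on D (\<lambda>\<tau>. h (T \<tau>))" if "h holomorphic_on ball t0 r" for h
      by (rule continuous_on_compose2[OF holomorphic_on_imp_continuous_on[OF that] cT(1)])
        (use D(3) \<rho>(2) in auto)
    have "continuous_on D k" unfolding k_def
      by (cases b) (auto intro!: continuous_intros D(4) cT hc[OF hol(1)] hc[OF hol(2)] hc[OF hol(3)])
    then have ck: "isCont k \<tau>0" using D(1,2) by (simp add: continuous_on_eq_continuous_at)
    have "eventually (\<lambda>\<tau>. norm (k \<tau>) \<in> {..<norm (k \<tau>0) + 1}) (nhds \<tau>0)"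
      by (rule eventually_nhds_if_isCont) (use ck in auto)
    then obtain S where S: "open S" "\<tau>0 \<in> S" "\<And>\<tau>. \<tau> \<in> S \<Longrightarrow> norm (k \<tau>) < norm (k \<tau>0) + 1"
      unfolding eventually_nhds by auto
    have z0: "\<Delta> \<tau>0 = 0"
      using s unfolding iff[OF TD[OF D(2)]] \<Delta>_def by (auto split: if_splits)
    have op: "open (D \<inter> S)" "\<tau>0 \<in> D \<inter> S" using D S by auto
    have der: "(\<Delta> has_field_derivative k \<tau> * \<Delta> \<tau>) (at \<tau>)" if "\<tau> \<in> D \<inter> S" for \<tau>
      using dD that by blast
    have le: "norm (k \<tau> * \<Delta> \<tau>) \<le> (norm (k \<tau>0) + 1) * norm (\<Delta> \<tau>)" if "\<tau> \<in> D \<inter> S" for \<tau>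
      unfolding norm_mult using S(3)[of \<tau>] that by (intro mult_right_mono) auto
    obtain e where e: "e > 0" "ball \<tau>0 e \<subseteq> D \<inter> S" "\<forall>\<tau>\<in>ball \<tau>0 e. \<Delta> \<tau> = 0"
      by (rule vanishes_near_if_deriv_le[where f=\<Delta> and f'="\<lambda>\<tau>. k \<tau> * \<Delta> \<tau>" and K="norm (k \<tau>0) + 1",
           OF op z0 der le])
    have "\<sigma> f (T \<tau>) = sphere_chart b (w \<tau>)" if "\<tau> \<in> ball \<tau>0 e" for \<tau>
    proof -
      have "\<tau> \<in> D" "\<Delta> \<tau> = 0" using e that by auto
      then show ?thesis unfolding iff[OF TD[OF \<open>\<tau> \<in> D\<close>]] by (auto simp: \<Delta>_def split: if_splits)
    qed
    then show ?thesis using e by auto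
  qed
  show ?thesis
    by (rule exI[of _ \<rho>], rule exI[of _ \<sigma>], unfold riccati_flow_def, intro conjI \<rho> P1)
      (intro allI ballI impI, rule P2 P3; assumption)+
qed

section \<open>Slopes of the generators with respect to the base coordinate\<close>

lemma coord_change_deriv_chain:
  assumes "b = b' \<or> t \<noteq> 0"
  shows "coord_change_deriv b' b'' (coord_change b b' t) * coord_change_deriv b b' t = coord_change_deriv b b'' t"
  using assms by (auto simp: coord_change_deriv_def coord_change_def power2_eq_square)

lemma coord_change_deriv_inverse:
  assumes "b = b' \<or> t \<noteq> 0"
  shows "coord_change_deriv b' b (coord_change b b' t) * coord_change_deriv b b' t = 1"
  using coord_change_deriv_chain[OF assms, of b] by (simp add: coord_change_deriv_def)

lemma riccati_slope_scale: "riccati_slope b (k * \<alpha>) (k * \<beta>) (k * \<gamma>) w = k * riccati_slope b \<alpha> \<beta> \<gamma> w"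
  by (simp add: riccati_slope_def algebra_simps)

lemma riccati_slope_coord_change:
  assumes "b = False \<or> y \<noteq> 0"
  shows "coord_change_deriv False b y * (\<alpha> * y\<^sup>2 + \<beta> * y + \<gamma>) = riccati_slope b \<alpha> \<beta> \<gamma> (coord_change False b y)"
  using assms by (auto simp: coord_change_deriv_def riccati_slope_def coord_change_def field_simps power2_eq_square)

text \<open>Dividing a fibre component by the speed of the base coordinate in the chart
  \<open>b\<close> cancels the factor \<open>g\<close> between \<open>X\<close> and the generator.
  So one triple of coefficients per fibre coordinate serves all generators at all finite points over
  \<open>x\<close>.\<close>

lemma riccati_slope_affine:
  fixes \<F> :: "'n::finite local_field set"
  assumes "singular_foliation \<F>" "given_by \<F> X" "polynomial_field X" "Some x \<notin> vertical_base \<F>"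
    and "sphere_chart b t = Some x"
  shows "\<exists>\<alpha> \<beta> \<gamma>. \<forall>c U Z z y i. (c, U, Z) \<in> \<F> \<longrightarrow> z \<in> U \<longrightarrow> chart c z = chart affine_chart (x, y) \<longrightarrow>
     snd (Z z) $ i = coord_change_deriv (fst c) b (fst z) * fst (Z z) *
       riccati_slope (snd c i) (\<alpha> i) (\<beta> i) (\<gamma> i) (snd z $ i)"
proof -
  have "\<forall>i. \<exists>\<alpha> \<beta> \<gamma>. \<forall>y. snd (X (x, y)) $ i = \<alpha> * (y $ i)\<^sup>2 + \<beta> * y $ i + \<gamma>"
    using affine_field_fibre_form[OF assms(1-4)] by metis
  then obtain \<alpha> \<beta> \<gamma> where form: "\<And>i y. snd (X (x, y)) $ i = \<alpha> i * (y $ i)\<^sup>2 + \<beta> i * y $ i + \<gamma> i"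
    by metis
  define P where "P = fst (X (x, 0))"
  have P: "P \<noteq> 0" "\<And>y. fst (X (x, y)) = P"
    using affine_field_base_nonzero[OF assms(1,2,4)] affine_field_base_constant[OF assms(1-4)]
    by (auto simp: P_def)
  define \<kappa> where "\<kappa> = coord_change_deriv False b x"
  have "b = False \<or> x \<noteq> 0" using assms(5) by (auto simp: sphere_chart_def split: if_splits)
  then have \<kappa>: "\<kappa> \<noteq> 0" unfolding \<kappa>_def by (intro coord_change_deriv_nonzero) auto
  \<comment> \<open>\<open>\<kappa> * P\<close> is the base speed of \<open>X\<close> in the chart
    \<open>b\<close>; dividing by it makes the base coordinate the time of the equation.\<close>
  define k where "k = 1 / (\<kappa> * P)"
  show ?thesis
  proof (intro exI allI impI)
    fix c U Z z y i
    assume z: "(c, U, Z) \<in> \<F>" "z \<in> U" "chart c z = chart affine_chart (x, y)"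
    have "chart affine_chart (x, y) = chart c z" using z(3) by simp
    then have ov: "(x, y) \<in> chart_overlap affine_chart c" "z = chart_change affine_chart c (x, y)"
      unfolding chart_eq_iff_chart_change by blast+
    then have ov': "False = fst c \<or> x \<noteq> 0" "snd c i = False \<or> y $ i \<noteq> 0"
      and zc: "fst z = coord_change False (fst c) x" "snd z $ i = coord_change False (snd c i) (y $ i)"
      by (auto simp: chart_overlap_def chart_change_def)
    obtain g where g: "g \<noteq> 0"
      "fst (Z z) = g * (coord_change_deriv False (fst c) x * fst (X (x, y)))"
      "\<And>i. snd (Z z) $ i = g * (coord_change_deriv False (snd c i) (y $ i) * snd (X (x, y)) $ i)"
      by (rule generator_vs_affine_field[OF assms(2) z]) blast
    have "coord_change_deriv (fst c) b (fst z) * fst (Z z) =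
       (coord_change_deriv (fst c) b (fst z) * coord_change_deriv False (fst c) x) * (g * P)"
      unfolding g(2) P(2) by simp
    also have "\<dots> = g * (\<kappa> * P)"
      unfolding zc(1) coord_change_deriv_chain[OF ov'(1)] \<kappa>_def by simp
    finally have speed: "coord_change_deriv (fst c) b (fst z) * fst (Z z) = g * (\<kappa> * P)" .
    have "snd (Z z) $ i = g * riccati_slope (snd c i) (\<alpha> i) (\<beta> i) (\<gamma> i) (snd z $ i)"
      unfolding g(3) form zc(2) riccati_slope_coord_change[OF ov'(2)] ..
    then show "snd (Z z) $ i = coord_change_deriv (fst c) b (fst z) * fst (Z z) *
       riccati_slope (snd c i) (k * \<alpha> i) (k * \<beta> i) (k * \<gamma> i) (snd z $ i)"
      unfolding speed riccati_slope_scale using \<kappa> P(1) by (simp add: k_def)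
  qed
qed

section \<open>Local sections of the foliation\<close>

lemma riccati_flowD:
  assumes "riccati_flow t0 \<rho> A B C \<sigma>"
  shows "t \<in> ball t0 \<rho> \<Longrightarrow> \<exists>!f. \<sigma> f t = y"
    and "t1 \<in> ball t0 \<rho> \<Longrightarrow> \<sigma> f t1 = sphere_chart b w1 \<Longrightarrow>
      \<exists>N w. open N \<and> t1 \<in> N \<and> N \<subseteq> ball t0 \<rho> \<and> w t1 = w1 \<and>
         (\<forall>t\<in>N. \<sigma> f t = sphere_chart b (w t) \<and>
            (w has_field_derivative riccati_slope b (A t) (B t) (C t) (w t)) (at t))"
    and "open D \<Longrightarrow> \<tau>0 \<in> D \<Longrightarrow> T ` D \<subseteq> ball t0 \<rho> \<Longrightarrow> continuous_on D \<zeta> \<Longrightarrow>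
      \<forall>\<tau>\<in>D. (T has_field_derivative \<zeta> \<tau>) (at \<tau>) \<Longrightarrow>
      \<forall>\<tau>\<in>D. (w has_field_derivative \<zeta> \<tau> * riccati_slope b (A (T \<tau>)) (B (T \<tau>)) (C (T \<tau>)) (w \<tau>)) (at \<tau>) \<Longrightarrow>
      \<sigma> f (T \<tau>0) = sphere_chart b (w \<tau>0) \<Longrightarrow>
      \<exists>e>0. ball \<tau>0 e \<subseteq> D \<and> (\<forall>\<tau>\<in>ball \<tau>0 e. \<sigma> f (T \<tau>) = sphere_chart b (w \<tau>))"
  using assms unfolding riccati_flow_def by simp_all

text \<open>A disc in the chart \<open>b\<close> of the base over which the foliation is given by
  Riccati equations with holomorphic coefficients. The product before \<open>riccati_slope\<close>
  is the velocity of the base coordinate along the generator. Points with infinite coordinates are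
  included.\<close>

definition riccati_chart :: "'n::finite local_field set \<Rightarrow> bool \<Rightarrow> complex \<Rightarrow> real \<Rightarrow>
    ('n \<Rightarrow> complex \<Rightarrow> complex) \<Rightarrow> ('n \<Rightarrow> complex \<Rightarrow> complex) \<Rightarrow> ('n \<Rightarrow> complex \<Rightarrow> complex) \<Rightarrow> bool" where
  "riccati_chart \<F> b t0 r A B C \<longleftrightarrow> r > 0 \<and>
    (\<forall>t\<in>ball t0 r. sphere_chart b t \<notin> vertical_base \<F>) \<and>
    (\<forall>i. A i holomorphic_on ball t0 r \<and> B i holomorphic_on ball t0 r \<and> C i holomorphic_on ball t0 r) \<and>
    (\<forall>c U Z z t i. (c, U, Z) \<in> \<F> \<longrightarrow> z \<in> U \<longrightarrow> t \<in> ball t0 r \<longrightarrow>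
       sphere_chart b t = sphere_chart (fst c) (fst z) \<longrightarrow>
       snd (Z z) $ i = coord_change_deriv (fst c) b (fst z) * fst (Z z) *
         riccati_slope (snd c i) (A i t) (B i t) (C i t) (snd z $ i))"

lemma eq_at_if_eventually_eq:
  fixes f g :: "complex \<Rightarrow> complex"
  assumes "isCont f a" "isCont g a" "eventually (\<lambda>s. f s = g s) (at a)"
  shows "f a = g a"
proof (rule tendsto_unique)
  show "(f \<longlongrightarrow> f a) (at a)" using assms(1) by (simp add: isCont_def)
  have "(g \<longlongrightarrow> g a) (at a)" using assms(2) by (simp add: isCont_def)
  then show "(f \<longlongrightarrow> g a) (at a)" using tendsto_cong[OF assms(3)] by simp
qed simp

lemma eventually_shift_nonzero: "eventually (\<lambda>s. a + s \<noteq> 0) (at (0::complex))"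
proof (cases "a = 0")
  case False
  have "eventually (\<lambda>s. a + s \<in> - {0}) (nhds 0)"
    by (rule eventually_nhds_if_isCont) (use False in \<open>auto intro!: continuous_intros simp: open_Compl\<close>)
  then show ?thesis by (auto simp: eventually_at_filter elim: eventually_mono)
qed (auto simp: eventually_at_filter)

lemma sphere_chart_finite: "t \<noteq> 0 \<Longrightarrow> \<exists>x. sphere_chart b t = Some x"
  by (simp add: sphere_chart_def)

text \<open>The coefficients supplied by \<open>riccati_slope_affine\<close> are chosen for each
  base point separately. To see them as holomorphic functions, they are recovered from the slopes of
  a single generator, by interpolation at three heights. The equation is then known at finite points
  and reaches the others by continuity.\<close>

lemma riccati_chart_exists:
  fixes \<F> :: "'n::finite local_field set"
  assumes "singular_foliation \<F>" "given_by \<F> X" "polynomial_field X" "finite (vertical_base \<F>)"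
    and x0: "x0 \<notin> vertical_base \<F>"
  shows "\<exists>b t0 r A B C. sphere_chart b t0 = x0 \<and> riccati_chart \<F> b t0 r A B C"
proof -
  \<comment> \<open>The value 0 lies in the affine chart of the sphere only, so all fibre charts of
    this generator are affine. Its base chart need not be, as \<open>x0\<close> may be
    infinity.\<close>
  obtain c0 U0 Z0 z0 where g0: "(c0, U0, Z0) \<in> \<F>" "z0 \<in> U0" "chart c0 z0 = (x0, \<chi> i. Some 0)"
    using generator_through[OF assms(1)] .
  define b where "b = fst c0"
  define t0 where "t0 = fst z0"
  have bt: "sphere_chart b t0 = x0" using arg_cong[OF g0(3), of fst] by (simp add: fst_chart b_def t0_def)
  have s0: "sphere_chart (snd c0 i) (snd z0 $ i) = Some 0" for i
    using arg_cong[OF g0(3), of "\<lambda>q. snd q $ i"] by (simp add: snd_chart)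
  have c0: "snd c0 i = False" and z0i: "snd z0 $ i = 0" for i
    using s0[of i] by (auto simp: sphere_chart_def split: if_splits)
  have z0: "z0 = (t0, 0)" by (simp add: t0_def prod_eq_iff vec_eq_iff z0i)
  note hol0 = generator_holomorphic[OF assms(1) g0(1)]
  obtain r1 where r1: "r1 > 0" "ball t0 r1 \<times> ball (0 :: complex ^ 'n) r1 \<subseteq> U0"
    using product_ball_subset[OF hol0(1)] g0(2) z0 by blast
  have "open (- (sphere_chart b -` vertical_base \<F>))"
    by (intro open_Compl finite_imp_closed finite_sphere_chart_vimage assms(4))
  moreover have "t0 \<in> - (sphere_chart b -` vertical_base \<F>)" using bt x0 by simp
  ultimately obtain r2 where r2: "r2 > 0" "ball t0 r2 \<subseteq> - (sphere_chart b -` vertical_base \<F>)" by (rule openE)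
  define r where "r = min r1 r2"
  have r: "r > 0" "\<And>t. t \<in> ball t0 r \<Longrightarrow> t \<in> ball t0 r1"
    "\<And>t. t \<in> ball t0 r \<Longrightarrow> sphere_chart b t \<notin> vertical_base \<F>"
    using r1 r2 by (auto simp: r_def)
  define e :: "complex ^ 'n" where "e = (\<chi> i. 1)"
  \<comment> \<open>Small enough for the sample points \<open>\<epsilon> *s e\<close> and
    \<open>- \<epsilon> *s e\<close> to remain in the domain of the generator; moving along
    \<open>e\<close> samples all fibre coordinates at once.\<close>
  define \<epsilon> :: complex where "\<epsilon> = of_real (r1 / (norm e + 1))"
  have ne: "norm e + 1 > 0" by (meson add_nonneg_pos norm_ge_zero zero_less_one)
  have \<epsilon>: "\<epsilon> \<noteq> 0" "norm \<epsilon> * norm e < r1"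
  proof -
    have "norm \<epsilon> = r1 / (norm e + 1)"
      unfolding \<epsilon>_def norm_of_real using r1(1) ne by simp
    moreover have "r1 / (norm e + 1) > 0" "r1 / (norm e + 1) * norm e < r1"
      using r1(1) ne by (simp_all add: field_simps)
    ultimately show "\<epsilon> \<noteq> 0" "norm \<epsilon> * norm e < r1" by auto
  qed
  define S where "S = (\<lambda>i w t. snd (Z0 (t, w *s e)) $ i / fst (Z0 (t, w *s e)))"
  have inU: "(t, w *s e) \<in> U0" if "w \<in> {0, \<epsilon>, - \<epsilon>}" "t \<in> ball t0 r" for w t
  proof -
    have "norm (w *s e) < r1" using that(1) \<epsilon>(2) r1(1) by (auto simp: norm_vector_scalar_mult)
    then show ?thesis using r(2)[OF that(2)] r1(2) by auto
  qed
  have nzU: "fst (Z0 (t, w *s e)) \<noteq> 0" if "w \<in> {0, \<epsilon>, - \<epsilon>}" "t \<in> ball t0 r" for w t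
    using fst_generator_nonzero[OF g0(1) inU[OF that]] r(3)[OF that(2)] by (simp add: fst_chart b_def)
  have holS: "S i w holomorphic_on ball t0 r" if "w \<in> {0, \<epsilon>, - \<epsilon>}" for i w
    unfolding S_def
    by (intro holomorphic_on_divide nzU that holomorphic_on_along_curve[OF hol0(3) open_ball _ has_derivative_horizontal]
         holomorphic_on_along_curve[OF hol0(2) open_ball _ has_derivative_horizontal])
      (use inU[OF that] in blast)+
  \<comment> \<open>Second and first central differences, which are exact for quadratics.\<close>
  define A where "A = (\<lambda>i t. (S i \<epsilon> t + S i (- \<epsilon>) t - 2 * S i 0 t) / (2 * \<epsilon>\<^sup>2))"
  define B where "B = (\<lambda>i t. (S i \<epsilon> t - S i (- \<epsilon>) t) / (2 * \<epsilon>))"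
  define C where "C = (\<lambda>i. S i 0)"
  have holA: "A i holomorphic_on ball t0 r" for i
    unfolding A_def by (intro holomorphic_intros holS) (use \<epsilon> in auto)
  have holB: "B i holomorphic_on ball t0 r" for i
    unfolding B_def by (intro holomorphic_intros holS) (use \<epsilon> in auto)
  have holC: "C i holomorphic_on ball t0 r" for i
    unfolding C_def by (intro holS) auto
  have aff: "snd (Z z) $ i = coord_change_deriv (fst c) b (fst z) * fst (Z z) *
         riccati_slope (snd c i) (A i t) (B i t) (C i t) (snd z $ i)"
    if t: "t \<in> ball t0 r" "sphere_chart b t = Some x" and z: "(c, U, Z) \<in> \<F>" "z \<in> U"
      "chart c z = chart affine_chart (x, y)" for t x c U Z z y i
  proof -
    have "Some x \<notin> vertical_base \<F>" using r(3)[OF t(1)] t(2) by simp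
    from riccati_slope_affine[OF assms(1-3) this t(2)] obtain \<alpha> \<beta> \<gamma> where *:
      "\<And>c U Z z y i. (c, U, Z) \<in> \<F> \<Longrightarrow> z \<in> U \<Longrightarrow> chart c z = chart affine_chart (x, y) \<Longrightarrow>
     snd (Z z) $ i = coord_change_deriv (fst c) b (fst z) * fst (Z z) *
       riccati_slope (snd c i) (\<alpha> i) (\<beta> i) (\<gamma> i) (snd z $ i)" by blast
    have S: "S i w t = \<alpha> i * w\<^sup>2 + \<beta> i * w + \<gamma> i" if w: "w \<in> {0, \<epsilon>, - \<epsilon>}" for w
    proof -
      have "chart c0 (t, w *s e) = chart affine_chart (x, w *s e)"
        unfolding chart_eq_iff using t(2) c0 by (simp add: b_def sphere_chart_def[of False])
      from *[OF g0(1) inU[OF w t(1)] this, of i]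
      have "snd (Z0 (t, w *s e)) $ i = fst (Z0 (t, w *s e)) * (\<alpha> i * w\<^sup>2 + \<beta> i * w + \<gamma> i)"
        using c0 by (simp add: b_def coord_change_deriv_def riccati_slope_def e_def)
      then show ?thesis using nzU[OF w t(1)] by (simp add: S_def)
    qed
    have "A i t = \<alpha> i" "B i t = \<beta> i" "C i t = \<gamma> i"
      using \<epsilon>(1) S[of 0] S[of \<epsilon>] S[of "- \<epsilon>"]
      by (simp_all add: A_def B_def C_def field_simps power2_eq_square)
    then show ?thesis using *[OF z] by simp
  qed
  have "snd (Z z) $ i = coord_change_deriv (fst c) b (fst z) * fst (Z z) *
         riccati_slope (snd c i) (A i t) (B i t) (C i t) (snd z $ i)"
    if z: "(c, U, Z) \<in> \<F>" "z \<in> U" and t: "t \<in> ball t0 r" "sphere_chart b t = sphere_chart (fst c) (fst z)"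
    for c U Z z t i
  proof -
    note hol = generator_holomorphic[OF assms(1) z(1)]
    have ov: "fst c = b \<or> fst z \<noteq> 0" "t = coord_change (fst c) b (fst z)"
      using t(2) sphere_chart_eq_iff[of "fst c" "fst z" b t] by auto
    define p where "p = (\<lambda>s. (fst z + s, snd z + s *s e))"
    have p0: "p 0 = z" by (simp add: p_def)
    have cp: "isCont p 0"
    proof -
      have "((\<lambda>s. z + cscale s (1, e)) has_derivative (\<lambda>h. cscale h (1, e))) (at 0)"
        by (rule has_derivative_line)
      moreover have "(\<lambda>s. z + cscale s (1, e)) = p" by (auto simp: p_def cscale_def prod_eq_iff)
      ultimately show ?thesis using has_derivative_continuous by metis
    qed
    define T where "T = (\<lambda>s. coord_change (fst c) b (fst (p s)))"
    have T0: "T 0 = t" using ov by (simp add: T_def p0)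
    have dc: "isCont (\<lambda>s. coord_change_deriv (fst c) b (fst (p s))) 0"
    proof (cases "fst c = b")
      case False
      then have "fst z \<noteq> 0" using ov by simp
      then show ?thesis using False unfolding coord_change_deriv_def p_def by (simp add: continuous_intros)
    qed (simp add: coord_change_deriv_def)
    have cT: "isCont T 0"
    proof (cases "fst c = b")
      case False
      then have "fst z \<noteq> 0" using ov by simp
      then show ?thesis using False unfolding T_def coord_change_def p_def by (simp add: continuous_intros)
    qed (simp add: T_def coord_change_def p_def)
    have hc: "isCont (\<lambda>s. h (T s)) 0" if "h holomorphic_on ball t0 r" for h
    proof (rule isCont_o2[OF cT])
      show "isCont h (T 0)" using holomorphic_on_imp_continuous_on[OF that] t(1)
        by (simp add: T0 continuous_on_eq_continuous_at)
    qed
    have cZ: "isCont (\<lambda>s. f (p s)) 0" if "holomorphic_fun f U" for f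
    proof (rule isCont_o2[OF cp])
      show "isCont f (p 0)" using holomorphic_fun_continuous_on[OF that] hol(1) z(2)
        by (simp add: p0 continuous_on_eq_continuous_at)
    qed
    have ci: "isCont (\<lambda>s. snd (p s) $ i) 0" unfolding p_def by (auto intro!: continuous_intros simp: e_def)
    define R where "R = (\<lambda>s. coord_change_deriv (fst c) b (fst (p s)) * fst (Z (p s)) *
         riccati_slope (snd c i) (A i (T s)) (B i (T s)) (C i (T s)) (snd (p s) $ i))"
    have cR: "isCont R 0"
      unfolding R_def riccati_slope_def
      by (cases "snd c i") (auto intro!: continuous_intros dc ci hc[OF holA] hc[OF holB] hc[OF holC] cZ[OF hol(2)])
    have "snd (Z (p 0)) $ i = R 0"
    proof (rule eq_at_if_eventually_eq[OF cZ[OF hol(3)] cR])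
      have e1: "eventually (\<lambda>s. p s \<in> U) (at 0)"
        using eventually_nhds_if_isCont[OF cp hol(1)] p0 z(2)
        by (auto simp: eventually_at_filter elim: eventually_mono)
      have e2: "eventually (\<lambda>s. T s \<in> ball t0 r) (at 0)"
        using eventually_nhds_if_isCont[OF cT open_ball, of t0 r] T0 t(1)
        by (auto simp: eventually_at_filter elim: eventually_mono)
      have e3: "eventually (\<lambda>s. fst z + s \<noteq> 0) (at 0)" by (rule eventually_shift_nonzero)
      have e4: "eventually (\<lambda>s. \<forall>k. snd z $ k + s \<noteq> 0) (at 0)"
        using eventually_all_finite[of "\<lambda>s k. snd z $ k + s \<noteq> 0"] eventually_shift_nonzero
        by (intro eventually_all_finite) auto
      show "eventually (\<lambda>s. snd (Z (p s)) $ i = R s) (at 0)"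
        using e1 e2 e3 e4
      proof eventually_elim
        case (elim s)
        obtain x where x: "sphere_chart (fst c) (fst (p s)) = Some x"
          using sphere_chart_finite[of "fst (p s)" "fst c"] elim(3) by (auto simp: p_def)
        have "\<exists>y. sphere_chart (snd c k) (snd (p s) $ k) = Some y" for k
          using sphere_chart_finite[of "snd (p s) $ k" "snd c k"] elim(4) by (auto simp: p_def e_def)
        then obtain y where y: "\<And>k. sphere_chart (snd c k) (snd (p s) $ k) = Some (y k)" by metis
        have "chart c (p s) = chart affine_chart (x, \<chi> k. y k)"
          unfolding chart_eq_iff using x y by (simp add: sphere_chart_def[of False])
        moreover have "sphere_chart b (T s) = Some x"
          using sphere_chart_coord_change[of "fst c" b "fst (p s)"] elim(3) x by (auto simp: T_def p_def)
        ultimately show ?case unfolding R_def using elim(1,2) by (intro aff[OF _ _ z(1)])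
      qed
    qed
    then show ?thesis by (simp add: R_def p0 T0)
  qed
  then have "riccati_chart \<F> b t0 r A B C"
    unfolding riccati_chart_def using r(1,3) holA holB holC by blast
  with bt show ?thesis by blast
qed

definition riccati_section :: "bool \<Rightarrow> ('n::finite \<Rightarrow> complex option \<Rightarrow> complex \<Rightarrow> complex option) \<Rightarrow>
    complex option ^ 'n \<Rightarrow> complex \<Rightarrow> 'n total" where
  "riccati_section b \<sigma> f t = (sphere_chart b t, \<chi> i. \<sigma> i (f $ i) t)"

lemma riccati_chartD:
  assumes "riccati_chart \<F> b t0 r A B C"
  shows "r > 0"
    and "t \<in> ball t0 r \<Longrightarrow> sphere_chart b t \<notin> vertical_base \<F>"
    and "A i holomorphic_on ball t0 r" "B i holomorphic_on ball t0 r" "C i holomorphic_on ball t0 r"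
    and "(c, U, Z) \<in> \<F> \<Longrightarrow> z \<in> U \<Longrightarrow> t \<in> ball t0 r \<Longrightarrow>
       sphere_chart b t = sphere_chart (fst c) (fst z) \<Longrightarrow>
       snd (Z z) $ i = coord_change_deriv (fst c) b (fst z) * fst (Z z) *
         riccati_slope (snd c i) (A i t) (B i t) (C i t) (snd z $ i)"
  using assms unfolding riccati_chart_def by blast+

text \<open>A piece of the graph of a section is the image of an integral curve of a generator, up
  to a change of complex time. That makes it a basic open set of the leaf topology.\<close>

lemma riccati_section_open:
  fixes \<F> :: "'n::finite local_field set"
  assumes sf: "singular_foliation \<F>" and rc: "riccati_chart \<F> b t0 r A B C" and \<rho>: "\<rho> \<le> r"
    and flow: "\<And>i. riccati_flow t0 \<rho> (A i) (B i) (C i) (\<sigma> i)" and t1: "t1 \<in> ball t0 \<rho>"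
  shows "\<exists>N. open N \<and> t1 \<in> N \<and> N \<subseteq> ball t0 \<rho> \<and>
    openin (leaf_topology \<F> (- (fst -` vertical_base \<F>))) (riccati_section b \<sigma> f ` N)"
proof -
  let ?s = "riccati_section b \<sigma> f"
  obtain c U Z z1 where g: "(c, U, Z) \<in> \<F>" "z1 \<in> U" "chart c z1 = ?s t1"
    using generator_through[OF sf] .
  note hol = generator_holomorphic[OF sf g(1)]
  have b1: "sphere_chart b t1 = sphere_chart (fst c) (fst z1)"
    using arg_cong[OF g(3), of fst] by (simp add: fst_chart riccati_section_def)
  then have ov: "b = fst c \<or> t1 \<noteq> 0" "fst z1 = coord_change b (fst c) t1"
    unfolding sphere_chart_eq_iff by auto
  have f1: "\<sigma> i (f $ i) t1 = sphere_chart (snd c i) (snd z1 $ i)" for i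
    using arg_cong[OF g(3), of "\<lambda>q. snd q $ i"] by (simp add: snd_chart riccati_section_def)
  have "\<forall>i. \<exists>N w. open N \<and> t1 \<in> N \<and> N \<subseteq> ball t0 \<rho> \<and> w t1 = snd z1 $ i \<and>
         (\<forall>t\<in>N. \<sigma> i (f $ i) t = sphere_chart (snd c i) (w t) \<and>
            (w has_field_derivative riccati_slope (snd c i) (A i t) (B i t) (C i t) (w t)) (at t))"
    using riccati_flowD(2)[OF flow t1 f1] by blast
  then obtain N w where Nw: "\<And>i. open (N i) \<and> t1 \<in> N i \<and> N i \<subseteq> ball t0 \<rho> \<and> w i t1 = snd z1 $ i \<and>
         (\<forall>t\<in>N i. \<sigma> i (f $ i) t = sphere_chart (snd c i) (w i t) \<and>
            (w i has_field_derivative riccati_slope (snd c i) (A i t) (B i t) (C i t) (w i t)) (at t))"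
    by metis
  define N1 where "N1 = (\<Inter>i. N i) \<inter> {t. b = fst c \<or> t \<noteq> 0}"
  have "open {t :: complex. b = fst c \<or> t \<noteq> 0}"
    by (cases "b = fst c") (auto simp: open_Collect_neq)
  moreover have "open (\<Inter>i. N i)" by (rule open_INT) (use Nw in auto)
  ultimately have N1: "open N1" "t1 \<in> N1" using Nw ov(1) by (auto simp: N1_def intro: open_Int)
  \<comment> \<open>Any index yields this inclusion; \<open>undefined\<close> merely names
    one.\<close>
  have N1b: "t \<in> ball t0 \<rho>" if "t \<in> N1" for t
    using that Nw[of undefined] by (auto simp: N1_def)
  have N1r: "t \<in> ball t0 r" if "t \<in> N1" for t using N1b[OF that] \<rho> by auto
  have N1o: "b = fst c \<or> t \<noteq> 0" if "t \<in> N1" for t using that by (auto simp: N1_def)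
  define y where "y = (\<lambda>t. (coord_change b (fst c) t, \<chi> i. w i t) :: 'n affine)"
  have y1: "y t1 = z1" using Nw ov(2) by (simp add: y_def prod_eq_iff vec_eq_iff)
  have chart_y: "chart c (y t) = ?s t" if "t \<in> N1" for t
  proof -
    have "sphere_chart (fst c) (coord_change b (fst c) t) = sphere_chart b t"
      by (rule sphere_chart_coord_change[OF N1o[OF that]])
    moreover have "\<sigma> i (f $ i) t = sphere_chart (snd c i) (w i t)" for i
      using Nw[of i] that by (auto simp: N1_def)
    ultimately show ?thesis
      by (simp add: prod_eq_iff vec_eq_iff fst_chart snd_chart riccati_section_def y_def)
  qed
  define v where "v = (\<lambda>t. (coord_change_deriv b (fst c) t,
     \<chi> i. riccati_slope (snd c i) (A i t) (B i t) (C i t) (w i t)) :: 'n affine)"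
  have dy: "(y has_derivative (\<lambda>h. cscale h (v t))) (at t)" if "t \<in> N1" for t
    unfolding has_derivative_affine_iff y_def v_def
    using Nw N1o[OF that] that has_field_derivative_coord_change[of b "fst c" t] by (auto simp: N1_def)
  have cy: "continuous_on N1 y"
    by (rule continuous_at_imp_continuous_on) (use dy has_derivative_continuous in blast)
  define N2 where "N2 = N1 \<inter> y -` U"
  have "open N2" unfolding N2_def by (intro continuous_open_preimage cy N1 hol)
  moreover have "t1 \<in> N2" using N1 y1 g(2) by (simp add: N2_def)
  ultimately obtain e where e: "e > 0" "ball t1 e \<subseteq> N2" by (rule openE)
  have eN: "t \<in> N1" "y t \<in> U" if "t \<in> ball t1 e" for t using e(2) that by (auto simp: N2_def)
  have Z1: "fst (Z (y t)) \<noteq> 0" if "t \<in> ball t1 e" for t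
  proof (rule fst_generator_nonzero[OF g(1) eN(2)[OF that]])
    show "fst (chart c (y t)) \<notin> vertical_base \<F>"
      using chart_y[OF eN(1)[OF that]] riccati_chartD(2)[OF rc N1r[OF eN(1)[OF that]]]
      by (simp add: riccati_section_def)
  qed
  \<comment> \<open>The factor by which the velocity \<open>v\<close> of the graph must differ from
    the generator, as read off from the base components. The Riccati equation makes it fit the fibre
    components too.\<close>
  define \<kappa> where "\<kappa> = (\<lambda>t. coord_change_deriv b (fst c) t / fst (Z (y t)))"
  have inv: "coord_change_deriv (fst c) b (fst (y t)) * coord_change_deriv b (fst c) t = 1" if "t \<in> ball t1 e" for t
    using coord_change_deriv_inverse[OF N1o[OF eN(1)[OF that]]] by (simp add: y_def)
  have vZ: "v t = cscale (\<kappa> t) (Z (y t))" if t: "t \<in> ball t1 e" for t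
  proof -
    have base: "sphere_chart b t = sphere_chart (fst c) (fst (y t))"
      using sphere_chart_coord_change[OF N1o[OF eN(1)[OF t]]] by (simp add: y_def)
    have "snd (v t) $ i = \<kappa> t * snd (Z (y t)) $ i" for i
    proof -
      let ?R = "riccati_slope (snd c i) (A i t) (B i t) (C i t) (w i t)"
      have "snd (Z (y t)) $ i = coord_change_deriv (fst c) b (fst (y t)) * fst (Z (y t)) * ?R"
        using riccati_chartD(6)[OF rc g(1) eN(2)[OF t] N1r[OF eN(1)[OF t]] base, of i] by (simp add: y_def)
      then have "\<kappa> t * snd (Z (y t)) $ i =
         (coord_change_deriv (fst c) b (fst (y t)) * coord_change_deriv b (fst c) t) * ?R"
        using Z1[OF t] by (simp add: \<kappa>_def)
      then show ?thesis using inv[OF t] by (simp add: v_def)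
    qed
    moreover have "fst (v t) = \<kappa> t * fst (Z (y t))" using Z1[OF t] by (simp add: v_def \<kappa>_def)
    ultimately show ?thesis by (simp add: cscale_def prod_eq_iff vec_eq_iff)
  qed
  have \<kappa>0: "\<kappa> t \<noteq> 0" if "t \<in> ball t1 e" for t
    using inv[OF that] Z1[OF that] by (auto simp: \<kappa>_def)
  have "(\<lambda>t. fst (Z (y t))) holomorphic_on ball t1 e"
    by (rule holomorphic_on_along_curve[OF hol(2) open_ball]) (use eN dy in auto)
  moreover have "coord_change_deriv b (fst c) holomorphic_on ball t1 e"
    unfolding coord_change_deriv_def using N1o eN(1)
    by (cases "b = fst c") (auto intro!: holomorphic_intros)
  ultimately have "\<kappa> holomorphic_on ball t1 e"
    unfolding \<kappa>_def using Z1 by (intro holomorphic_on_divide) auto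
  \<comment> \<open>\<open>\<Theta>\<close> is the time of the generator along the graph. As
    \<open>\<kappa>\<close> has no zeros, \<open>\<Theta>\<close> has a local inverse
    \<open>G\<close>, and substituting \<open>G\<close> for the base coordinate turns velocity
    \<open>v\<close> into velocity \<open>Z\<close>.\<close>
  then obtain \<Theta> where "\<And>t. t \<in> ball t1 e \<Longrightarrow> (\<Theta> has_field_derivative \<kappa> t) (at t within ball t1 e)"
    using holomorphic_convex_primitive'[OF convex_ball open_ball] by blast
  then have d\<Theta>: "(\<Theta> has_field_derivative \<kappa> t) (at t)" if "t \<in> ball t1 e" for t
    using that at_within_open[OF that open_ball] by metis
  have hol\<Theta>: "\<Theta> holomorphic_on ball t1 e"
    unfolding holomorphic_on_open[OF open_ball] using d\<Theta> by blast
  have der\<Theta>: "deriv \<Theta> t = \<kappa> t" if "t \<in> ball t1 e" for t using d\<Theta>[OF that] by (rule DERIV_imp_deriv)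
  have t1e: "t1 \<in> ball t1 e" using e by simp
  have "deriv \<Theta> t1 \<noteq> 0" using der\<Theta> \<kappa>0 t1e by simp
  from has_complex_derivative_locally_invertible[OF hol\<Theta> t1e open_ball this]
  obtain e' where e': "e' > 0" "ball t1 e' \<subseteq> ball t1 e" "open (\<Theta> ` ball t1 e')" "inj_on \<Theta> (ball t1 e')" .
  have "\<exists>G. G holomorphic_on \<Theta> ` ball t1 e' \<and> (\<forall>t\<in>ball t1 e'. deriv \<Theta> t * deriv G (\<Theta> t) = 1) \<and>
      (\<forall>t\<in>ball t1 e'. G (\<Theta> t) = t)"
    by (rule holomorphic_has_inverse[OF holomorphic_on_subset[OF hol\<Theta> e'(2)] open_ball e'(4)]) blast
  then obtain G where G: "G holomorphic_on \<Theta> ` ball t1 e'"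
    "\<And>t. t \<in> ball t1 e' \<Longrightarrow> deriv \<Theta> t * deriv G (\<Theta> t) = 1" "\<And>t. t \<in> ball t1 e' \<Longrightarrow> G (\<Theta> t) = t"
    by auto
  define D where "D = \<Theta> ` ball t1 e'"
  have GD: "G \<tau> \<in> ball t1 e'" if "\<tau> \<in> D" for \<tau> using that G(3) by (auto simp: D_def)
  have dG: "(G has_field_derivative 1 / \<kappa> (G \<tau>)) (at \<tau>)" if \<tau>: "\<tau> \<in> D" for \<tau>
  proof -
    obtain t where t: "t \<in> ball t1 e'" "\<tau> = \<Theta> t" using \<tau> by (auto simp: D_def)
    have te: "t \<in> ball t1 e" using t(1) e'(2) by blast
    have "deriv G \<tau> = 1 / \<kappa> (G \<tau>)"
      using G(2)[OF t(1)] der\<Theta>[OF te] \<kappa>0[OF te] t(2) G(3)[OF t(1)] by (simp add: field_simps)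
    moreover have "(G has_field_derivative deriv G \<tau>) (at \<tau>)"
      using holomorphic_derivI[OF G(1) e'(3)] \<tau> by (simp add: D_def)
    ultimately show ?thesis by simp
  qed
  define \<gamma> where "\<gamma> = (\<lambda>\<tau>. y (G \<tau>))"
  have img: "chart c ` \<gamma> ` D = ?s ` ball t1 e'"
  proof -
    have "\<gamma> ` D = y ` ball t1 e'" unfolding D_def \<gamma>_def image_image using G(3) by auto
    moreover have "chart c ` y ` ball t1 e' = ?s ` ball t1 e'"
      unfolding image_image using chart_y eN(1) e'(2) by (intro image_cong) auto
    ultimately show ?thesis by simp
  qed
  have "openin (leaf_topology \<F> (- (fst -` vertical_base \<F>))) (chart c ` \<gamma> ` D)"
  proof (rule openin_leaf_topology[OF g(1)])
    show "open D" using e'(3) by (simp add: D_def)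
    have "y (G \<tau>) \<in> U" if "\<tau> \<in> D" for \<tau> using GD[OF that] e'(2) by (intro eN(2)) blast
    then show "\<gamma> ` D \<subseteq> U" by (auto simp: \<gamma>_def)
    show "chart c ` \<gamma> ` D \<subseteq> - (fst -` vertical_base \<F>)"
      unfolding img using riccati_chartD(2)[OF rc] N1r eN(1) e'(2) by (auto simp: riccati_section_def)
    fix \<tau> assume \<tau>: "\<tau> \<in> D"
    let ?t = "G \<tau>"
    have te: "?t \<in> ball t1 e" using GD[OF \<tau>] e'(2) by blast
    have Zv: "Z (\<gamma> \<tau>) = cscale (1 / \<kappa> ?t) (v ?t)"
      unfolding vZ[OF te] \<gamma>_def using \<kappa>0[OF te] by (simp add: cscale_def prod_eq_iff vec_eq_iff)
    have dyt: "((\<lambda>t. fst (y t)) has_field_derivative fst (v ?t)) (at ?t)"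
      "((\<lambda>t. snd (y t) $ i) has_field_derivative snd (v ?t) $ i) (at ?t)" for i
      using dy[OF eN(1)[OF te]] unfolding has_derivative_affine_iff by auto
    have "(\<gamma> has_derivative (\<lambda>h. cscale h (Z (\<gamma> \<tau>)))) (at \<tau>)"
      unfolding has_derivative_affine_iff Zv
      using DERIV_chain2[OF dyt(1) dG[OF \<tau>]] DERIV_chain2[OF dyt(2) dG[OF \<tau>]]
      by (simp add: \<gamma>_def cscale_def)
    moreover have "Z (\<gamma> \<tau>) \<noteq> 0" using Z1[OF te] by (auto simp: \<gamma>_def)
    ultimately show "Z (\<gamma> \<tau>) \<noteq> 0 \<and> (\<gamma> has_derivative (\<lambda>h. cscale h (Z (\<gamma> \<tau>)))) (at \<tau>)" by blast
  qed
  then show ?thesis unfolding img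
    using e' eN(1) N1b by (intro exI[of _ "ball t1 e'"]) auto
qed

text \<open>The converse direction, which makes sections continuous into the leaf topology. In every
  fibre coordinate the curve solves the Riccati equation with time \<open>T\<close>, its base
  coordinate, so it runs inside the section that it meets. Since \<open>T\<close> has nonzero
  derivative, it covers a neighbourhood of \<open>t1\<close>.\<close>

lemma integral_curve_in_section:
  fixes \<F> :: "'n::finite local_field set"
  assumes sf: "singular_foliation \<F>" and rc: "riccati_chart \<F> b t0 r A B C" and \<rho>: "\<rho> \<le> r"
    and flow: "\<And>i. riccati_flow t0 \<rho> (A i) (B i) (C i) (\<sigma> i)" and t1: "t1 \<in> ball t0 \<rho>"
    and g: "(c, U, Z) \<in> \<F>" "open D" "\<gamma> ` D \<subseteq> U"
      "\<forall>\<tau>\<in>D. Z (\<gamma> \<tau>) \<noteq> 0 \<and> (\<gamma> has_derivative (\<lambda>h. cscale h (Z (\<gamma> \<tau>)))) (at \<tau>)"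
      "\<tau>0 \<in> D" "chart c (\<gamma> \<tau>0) = riccati_section b \<sigma> f t1"
  shows "\<exists>N. open N \<and> t1 \<in> N \<and> N \<subseteq> ball t0 \<rho> \<and> riccati_section b \<sigma> f ` N \<subseteq> chart c ` \<gamma> ` D"
proof -
  note hol = generator_holomorphic[OF sf g(1)]
  have b1: "sphere_chart (fst c) (fst (\<gamma> \<tau>0)) = sphere_chart b t1"
    using arg_cong[OF g(6), of fst] by (simp add: fst_chart riccati_section_def)
  then have ov: "fst c = b \<or> fst (\<gamma> \<tau>0) \<noteq> 0" "t1 = coord_change (fst c) b (fst (\<gamma> \<tau>0))"
    unfolding sphere_chart_eq_iff by auto
  have f1: "\<sigma> i (f $ i) t1 = sphere_chart (snd c i) (snd (\<gamma> \<tau>0) $ i)" for i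
    using arg_cong[OF g(6), of "\<lambda>q. snd q $ i"] by (simp add: snd_chart riccati_section_def)
  have d: "((\<lambda>t. fst (\<gamma> t)) has_field_derivative fst (Z (\<gamma> \<tau>))) (at \<tau>)"
    "((\<lambda>t. snd (\<gamma> t) $ i) has_field_derivative snd (Z (\<gamma> \<tau>)) $ i) (at \<tau>)" if "\<tau> \<in> D" for \<tau> i
    using g(4) that unfolding has_derivative_affine_iff by auto
  have cg: "continuous_on D \<gamma>"
    by (rule continuous_at_imp_continuous_on) (use g(4) has_derivative_continuous in blast)
  define D1 where "D1 = D \<inter> {\<tau>. fst c = b \<or> fst (\<gamma> \<tau>) \<noteq> 0}"
  have "open D1"
  proof (cases "fst c = b")
    case False
    have "open (D \<inter> (\<lambda>\<tau>. fst (\<gamma> \<tau>)) -` (- {0}))"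
      by (intro continuous_open_preimage continuous_intros cg g(2))
    then show ?thesis using False by (simp add: D1_def vimage_def Compl_eq)
  qed (use g(2) in \<open>simp add: D1_def\<close>)
  have D1: "\<tau>0 \<in> D1" using g(5) ov by (simp add: D1_def)
  define T where "T = (\<lambda>\<tau>. coord_change (fst c) b (fst (\<gamma> \<tau>)))"
  define \<zeta> where "\<zeta> = (\<lambda>\<tau>. coord_change_deriv (fst c) b (fst (\<gamma> \<tau>)) * fst (Z (\<gamma> \<tau>)))"
  have dT: "(T has_field_derivative \<zeta> \<tau>) (at \<tau>)" if "\<tau> \<in> D1" for \<tau>
    unfolding T_def \<zeta>_def
    by (rule DERIV_chain2[OF has_field_derivative_coord_change d(1)])
      (use that in \<open>auto simp: D1_def\<close>)
  have cT: "continuous_on D1 T"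
    by (rule continuous_at_imp_continuous_on) (use dT DERIV_isCont in blast)
  define D2 where "D2 = D1 \<inter> T -` ball t0 \<rho>"
  have D2: "open D2" unfolding D2_def by (intro continuous_open_preimage cT \<open>open D1\<close>) auto
  have \<tau>02: "\<tau>0 \<in> D2" using D1 t1 ov(2) by (simp add: D2_def T_def)
  have D2D: "\<tau> \<in> D1" "\<tau> \<in> D" "T \<tau> \<in> ball t0 \<rho>" "T \<tau> \<in> ball t0 r" "\<gamma> \<tau> \<in> U" if "\<tau> \<in> D2" for \<tau>
    using that g(3) \<rho> by (auto simp: D2_def D1_def)
  have base: "sphere_chart b (T \<tau>) = sphere_chart (fst c) (fst (\<gamma> \<tau>))" if "\<tau> \<in> D2" for \<tau>
    unfolding T_def by (rule sphere_chart_coord_change) (use that in \<open>auto simp: D2_def D1_def\<close>)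
  have c\<zeta>: "continuous_on D2 \<zeta>"
  proof -
    have "continuous_on D2 (\<lambda>\<tau>. fst (Z (\<gamma> \<tau>)))"
      by (rule continuous_on_compose2[OF holomorphic_fun_continuous_on[OF hol(2)] continuous_on_subset[OF cg]])
        (use D2D in auto)
    moreover have "continuous_on D2 (\<lambda>\<tau>. coord_change_deriv (fst c) b (fst (\<gamma> \<tau>)))"
    proof (cases "fst c = b")
      case False
      have "continuous_on D2 (\<lambda>\<tau>. fst (\<gamma> \<tau>))"
        by (intro continuous_intros continuous_on_subset[OF cg]) (use D2D in auto)
      moreover have "fst (\<gamma> \<tau>) \<noteq> 0" if "\<tau> \<in> D2" for \<tau>
        using that False by (auto simp: D2_def D1_def)
      ultimately show ?thesis using False unfolding coord_change_deriv_def
        by (auto intro!: continuous_intros)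
    qed (simp add: coord_change_deriv_def)
    ultimately show ?thesis unfolding \<zeta>_def by (intro continuous_on_mult) auto
  qed
  have "\<exists>e>0. ball \<tau>0 e \<subseteq> D2 \<and> (\<forall>\<tau>\<in>ball \<tau>0 e. \<sigma> i (f $ i) (T \<tau>) = sphere_chart (snd c i) (snd (\<gamma> \<tau>) $ i))" for i
  proof (rule riccati_flowD(3)[OF flow D2 \<tau>02 _ c\<zeta>])
    show "T ` D2 \<subseteq> ball t0 \<rho>" using D2D by auto
    show "\<forall>\<tau>\<in>D2. (T has_field_derivative \<zeta> \<tau>) (at \<tau>)" using dT D2D by auto
    show "\<forall>\<tau>\<in>D2. ((\<lambda>\<tau>. snd (\<gamma> \<tau>) $ i) has_field_derivative
       \<zeta> \<tau> * riccati_slope (snd c i) (A i (T \<tau>)) (B i (T \<tau>)) (C i (T \<tau>)) (snd (\<gamma> \<tau>) $ i)) (at \<tau>)"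
    proof
      fix \<tau> assume \<tau>: "\<tau> \<in> D2"
      have "snd (Z (\<gamma> \<tau>)) $ i = \<zeta> \<tau> * riccati_slope (snd c i) (A i (T \<tau>)) (B i (T \<tau>)) (C i (T \<tau>)) (snd (\<gamma> \<tau>) $ i)"
        unfolding \<zeta>_def using riccati_chartD(6)[OF rc g(1) D2D(5,4)[OF \<tau>] base[OF \<tau>]] .
      then show "((\<lambda>\<tau>. snd (\<gamma> \<tau>) $ i) has_field_derivative
         \<zeta> \<tau> * riccati_slope (snd c i) (A i (T \<tau>)) (B i (T \<tau>)) (C i (T \<tau>)) (snd (\<gamma> \<tau>) $ i)) (at \<tau>)"
        using d(2)[OF D2D(2)[OF \<tau>], of i] by simp
    qed
    show "\<sigma> i (f $ i) (T \<tau>0) = sphere_chart (snd c i) (snd (\<gamma> \<tau>0) $ i)"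
      using f1[of i] ov(2) by (simp add: T_def)
  qed
  then obtain e where e: "\<And>i. e i > 0 \<and> ball \<tau>0 (e i) \<subseteq> D2 \<and>
     (\<forall>\<tau>\<in>ball \<tau>0 (e i). \<sigma> i (f $ i) (T \<tau>) = sphere_chart (snd c i) (snd (\<gamma> \<tau>) $ i))"
    by metis
  define S where "S = (\<Inter>i. ball \<tau>0 (e i))"
  have S: "open S" "\<tau>0 \<in> S" "S \<subseteq> D2"
  proof -
    show "open S" "\<tau>0 \<in> S" using e unfolding S_def by (auto intro!: open_INT)
    have "S \<subseteq> ball \<tau>0 (e undefined)" by (auto simp: S_def)
    then show "S \<subseteq> D2" using e[of undefined] by blast
  qed
  have onS: "riccati_section b \<sigma> f (T \<tau>) = chart c (\<gamma> \<tau>)" if "\<tau> \<in> S" for \<tau>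
  proof -
    have "\<sigma> i (f $ i) (T \<tau>) = sphere_chart (snd c i) (snd (\<gamma> \<tau>) $ i)" for i
      using e[of i] that by (auto simp: S_def)
    moreover have "\<tau> \<in> D2" using that S by blast
    ultimately show ?thesis
      using base by (simp add: riccati_section_def prod_eq_iff vec_eq_iff fst_chart snd_chart)
  qed
  have holT: "T holomorphic_on S"
    unfolding holomorphic_on_open[OF S(1)] using dT D2D(1) S(3) by blast
  have "\<zeta> \<tau>0 \<noteq> 0"
  proof -
    have "fst (Z (\<gamma> \<tau>0)) \<noteq> 0"
    proof (rule fst_generator_nonzero[OF g(1)])
      show "\<gamma> \<tau>0 \<in> U" using D2D \<tau>02 by blast
      show "fst (chart c (\<gamma> \<tau>0)) \<notin> vertical_base \<F>"
        using riccati_chartD(2)[OF rc, of t1] t1 \<rho> b1 by (simp add: fst_chart)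
    qed
    then show ?thesis unfolding \<zeta>_def using coord_change_deriv_nonzero[OF ov(1)] by simp
  qed
  moreover have "deriv T \<tau>0 = \<zeta> \<tau>0" using dT[OF D1] by (rule DERIV_imp_deriv)
  ultimately have "deriv T \<tau>0 \<noteq> 0" by simp
  from has_complex_derivative_locally_invertible[OF holT S(2,1) this]
  obtain e' where e': "e' > 0" "ball \<tau>0 e' \<subseteq> S" "open (T ` ball \<tau>0 e')" .
  have "t1 \<in> T ` ball \<tau>0 e'" using e'(1) ov(2) by (intro image_eqI[of _ _ \<tau>0]) (auto simp: T_def)
  moreover have "T ` ball \<tau>0 e' \<subseteq> ball t0 \<rho>" using e'(2) S(3) D2D(3) by auto
  moreover have "riccati_section b \<sigma> f ` T ` ball \<tau>0 e' \<subseteq> chart c ` \<gamma> ` D"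
  proof -
    have "riccati_section b \<sigma> f (T \<tau>) \<in> chart c ` \<gamma> ` D" if "\<tau> \<in> ball \<tau>0 e'" for \<tau>
    proof -
      have "\<tau> \<in> S" using e'(2) that by blast
      then have "\<tau> \<in> D" using S(3) D2D(2) by blast
      then show ?thesis using onS[OF \<open>\<tau> \<in> S\<close>] by auto
    qed
    then show ?thesis by blast
  qed
  ultimately show ?thesis using e'(3) by blast
qed

section \<open>Covering property of the leaves\<close>

lemma covering_map_of_local_sections:
  fixes X :: "('a \<times> 'b) topology" and Y :: "'a topology"
  assumes cont: "continuous_map X Y fst" and conn: "connected_space Y"
    and triv: "\<And>x. x \<in> topspace Y \<Longrightarrow> \<exists>T (s :: 'c \<Rightarrow> 'a \<Rightarrow> 'a \<times> 'b). openin Y T \<and> x \<in> T \<and> connectedin Y T \<and>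
      (\<forall>q\<in>topspace X. fst q \<in> T \<longrightarrow> (\<exists>f. s f (fst q) = q)) \<and>
      (\<forall>f. \<forall>x\<in>T. fst (s f x) = x) \<and>
      (\<forall>f g. \<forall>x\<in>T. s f x = s g x \<longrightarrow> f = g) \<and>
      (\<forall>f. openin X (s f ` T)) \<and>
      (\<forall>f. continuous_map (subtopology Y T) X (s f))"
    and L: "L \<in> connected_components_of X"
  shows "covering_map (subtopology X L) Y fst"
proof -
  have LX: "L \<subseteq> topspace X" by (rule connected_components_of_subset[OF L])
  have Lne: "L \<noteq> {}" by (rule nonempty_connected_components_of[OF L])
  have tL: "topspace (subtopology X L) = L" using LX by auto
  have cover: "\<exists>T \<V>. y \<in> T \<and> openin Y T \<and> (T \<subseteq> fst ` L \<or> T \<inter> fst ` L = {}) \<and>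
      \<Union>\<V> = {q \<in> L. fst q \<in> T} \<and> (\<forall>V\<in>\<V>. openin (subtopology X L) V) \<and> pairwise disjnt \<V> \<and>
      (\<forall>V\<in>\<V>. homeomorphic_map (subtopology (subtopology X L) V) (subtopology Y T) fst)"
    if y: "y \<in> topspace Y" for y
  proof -
    obtain T and s :: "'c \<Rightarrow> 'a \<Rightarrow> 'a \<times> 'b" where T: "openin Y T" "y \<in> T" "connectedin Y T"
      and s: "\<forall>q\<in>topspace X. fst q \<in> T \<longrightarrow> (\<exists>f. s f (fst q) = q)"
        "\<forall>f. \<forall>x\<in>T. fst (s f x) = x"
        "\<forall>f g. \<forall>x\<in>T. s f x = s g x \<longrightarrow> f = g"
        "\<forall>f. openin X (s f ` T)"
        "\<forall>f. continuous_map (subtopology Y T) X (s f)"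
      using triv[OF y] by (elim exE conjE) (rule that)
    have TY: "T \<subseteq> topspace Y" using T(1) by (rule openin_subset)
    have "connectedin X (s f ` T)" for f
      by (rule connectedin_continuous_map_image[OF s(5)[THEN spec]])
        (use T(3) in \<open>simp add: connectedin_subtopology\<close>)
    then have plaque: "s f ` T \<subseteq> L" if "s f ` T \<inter> L \<noteq> {}" for f
      using connected_components_of_maximal[OF L] that by (auto simp: disjnt_def)
    have plaque': "s f ` T \<subseteq> L" if "x \<in> T" "s f x \<in> L" for f x
      using plaque that by blast
    define \<V> where "\<V> = {s f ` T | f. s f ` T \<subseteq> L}"
    have "T \<subseteq> fst ` L" if "T \<inter> fst ` L \<noteq> {}"
    proof -
      obtain q where q: "q \<in> L" "fst q \<in> T" using \<open>T \<inter> fst ` L \<noteq> {}\<close> by blast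
      then obtain f where f: "s f (fst q) = q" using s(1) LX by blast
      then have sub: "s f ` T \<subseteq> L" using plaque'[of "fst q" f] q by simp
      show ?thesis
      proof
        fix x assume "x \<in> T"
        then have "s f x \<in> L" "fst (s f x) = x" using sub s(2) by auto
        then show "x \<in> fst ` L" by force
      qed
    qed
    moreover have "\<Union>\<V> = {q \<in> L. fst q \<in> T}"
    proof
      show "\<Union>\<V> \<subseteq> {q \<in> L. fst q \<in> T}" using s(2) by (auto simp: \<V>_def)
      show "{q \<in> L. fst q \<in> T} \<subseteq> \<Union>\<V>"
      proof clarify
        fix a b assume q: "(a, b) \<in> L" "fst (a, b) \<in> T"
        then obtain f where f: "s f a = (a, b)" using s(1) LX by fastforce
        then have "s f ` T \<in> \<V>" using plaque'[of a f] q by (auto simp: \<V>_def)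
        moreover have "(a, b) \<in> s f ` T" using f q by force
        ultimately show "(a, b) \<in> \<Union>\<V>" by blast
      qed
    qed
    moreover have "\<forall>V\<in>\<V>. openin (subtopology X L) V"
      using s(4) by (auto simp: \<V>_def openin_subtopology intro: exI[of _ "s _ ` T"])
    moreover have "pairwise disjnt \<V>"
    proof (rule pairwiseI)
      fix V V' assume "V \<in> \<V>" "V' \<in> \<V>" "V \<noteq> V'"
      then obtain f g where fg: "V = s f ` T" "V' = s g ` T" "f \<noteq> g" by (auto simp: \<V>_def)
      have "s f x \<noteq> s g x'" if "x \<in> T" "x' \<in> T" for x x'
        using fg(3) s(2,3) that by metis
      then show "disjnt V V'" unfolding fg disjnt_def by blast
    qed
    moreover have "\<forall>V\<in>\<V>. homeomorphic_map (subtopology (subtopology X L) V) (subtopology Y T) fst"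
    proof
      fix V assume "V \<in> \<V>"
      then obtain f where V: "V = s f ` T" "V \<subseteq> L" by (auto simp: \<V>_def)
      have "subtopology (subtopology X L) V = subtopology X V"
        using V(2) by (simp add: subtopology_subtopology Int_absorb1)
      moreover have "homeomorphic_maps (subtopology X V) (subtopology Y T) fst (s f)"
        unfolding homeomorphic_maps_def
      proof (intro conjI ballI)
        show "continuous_map (subtopology X V) (subtopology Y T) fst"
          using s(2) V(1) by (intro continuous_map_into_subtopology continuous_map_from_subtopology cont) auto
        show "continuous_map (subtopology Y T) (subtopology X V) (s f)"
          using s(5) V(1) by (intro continuous_map_into_subtopology) auto
      qed (use s(2) V(1) in auto)
      ultimately show "homeomorphic_map (subtopology (subtopology X L) V) (subtopology Y T) fst"
        using homeomorphic_map_maps by metis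
    qed
    ultimately show ?thesis using T(1,2) by blast
  qed
  have sub: "fst ` L \<subseteq> topspace Y"
    using continuous_map_image_subset_topspace[OF cont] LX by blast
  have cover0: "\<exists>T. y \<in> T \<and> openin Y T \<and> (T \<subseteq> fst ` L \<or> T \<inter> fst ` L = {})" if "y \<in> topspace Y" for y
    using cover[OF that] by (elim exE conjE) (intro exI conjI, assumption+)
  have op1: "openin Y (fst ` L)"
  proof (subst openin_subopen, intro ballI)
    fix y assume "y \<in> fst ` L"
    then show "\<exists>T. openin Y T \<and> y \<in> T \<and> T \<subseteq> fst ` L"
      using cover0[of y] sub by blast
  qed
  have op2: "openin Y (topspace Y - fst ` L)"
  proof (subst openin_subopen, intro ballI)
    fix y assume y: "y \<in> topspace Y - fst ` L"
    then obtain T where T: "y \<in> T" "openin Y T" "T \<subseteq> fst ` L \<or> T \<inter> fst ` L = {}" using cover0[of y] by blast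
    then have "T \<subseteq> topspace Y - fst ` L" using y openin_subset[OF T(2)] by blast
    then show "\<exists>T. openin Y T \<and> y \<in> T \<and> T \<subseteq> topspace Y - fst ` L" using T by blast
  qed
  have "fst ` L = topspace Y"
    using conn op1 op2 sub Lne unfolding connected_space_clopen_in closedin_def by blast
  then show ?thesis
    unfolding covering_map_def tL
  proof (intro conjI ballI)
    show "continuous_map (subtopology X L) Y fst" by (rule continuous_map_from_subtopology[OF cont])
    fix y assume "y \<in> topspace Y"
    from cover[OF this] obtain T \<V> where c: "y \<in> T" "openin Y T" "\<Union>\<V> = {q \<in> L. fst q \<in> T}"
      "\<forall>V\<in>\<V>. openin (subtopology X L) V" "pairwise disjnt \<V>"
      "\<forall>V\<in>\<V>. homeomorphic_map (subtopology (subtopology X L) V) (subtopology Y T) fst"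
      by (elim exE conjE) (rule that)
    show "\<exists>T. y \<in> T \<and> openin Y T \<and>
        (\<exists>\<V>. \<Union>\<V> = {x \<in> L. fst x \<in> T} \<and> (\<forall>V\<in>\<V>. openin (subtopology X L) V) \<and> pairwise disjnt \<V> \<and>
           (\<forall>V\<in>\<V>. homeomorphic_map (subtopology (subtopology X L) V) (subtopology Y T) fst))"
      by (rule exI[of _ T], intro conjI c(1,2), rule exI[of _ \<V>]) (intro conjI c(3-6))
  qed
qed

section \<open>The leaves over the nonvertical part of the base\<close>

lemma continuous_map_sphere_chart: "continuous_map euclidean sphere_topology (sphere_chart b)"
  unfolding continuous_map_def by (auto simp: openin_sphere_iff vimage_def)

text \<open>The plane without a finite set is connected. At most the point infinity has to be added
  to it, and this point belongs to its closure.\<close>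

lemma connectedin_sphere_Compl_finite:
  assumes "finite S"
  shows "connectedin sphere_topology (- S)"
proof -
  let ?K = "sphere_chart False -` S" and ?K' = "sphere_chart True -` S"
  have K: "finite ?K" "finite ?K'" using assms by (auto intro: finite_sphere_chart_vimage)
  have "connected (UNIV - ?K)"
    by (rule connected_open_diff_countable) (use K(1) in \<open>auto intro: countable_finite\<close>)
  then have "connectedin sphere_topology (sphere_chart False ` (UNIV - ?K))"
    by (intro connectedin_continuous_map_image[OF continuous_map_sphere_chart]) simp
  then show ?thesis
  proof (rule connectedin_intermediate_closure_of)
    show "sphere_chart False ` (UNIV - ?K) \<subseteq> - S" by auto
    show "- S \<subseteq> sphere_topology closure_of sphere_chart False ` (UNIV - ?K)"
    proof
      fix x assume x: "x \<in> - S"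
      obtain b t where bt: "x = sphere_chart b t" by (rule sphere_chart_surj)
      show "x \<in> sphere_topology closure_of sphere_chart False ` (UNIV - ?K)"
        unfolding in_closure_of
      proof (intro conjI allI impI)
        fix V assume V: "x \<in> V \<and> openin sphere_topology V"
        have "open (sphere_chart b -` V)" "t \<in> sphere_chart b -` V"
          using V bt by (auto simp: openin_sphere_iff)
        then obtain e where e: "e > 0" "ball t e \<subseteq> sphere_chart b -` V"
          by (meson openE)
        have "infinite (ball t e)" using e(1) by (simp add: uncountable_infinite uncountable_ball)
        moreover have "finite (sphere_chart b -` S \<union> {0})" using K by (cases b) auto
        ultimately obtain u where u: "u \<in> ball t e" "u \<notin> sphere_chart b -` S \<union> {0}"
          by (meson finite_subset subsetI)
        obtain w where w: "sphere_chart b u = Some w" using u(2) sphere_chart_finite[of u b] by auto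
        then have "sphere_chart False w = sphere_chart b u" by (simp add: sphere_chart_def)
        then show "\<exists>y. y \<in> sphere_chart False ` (UNIV - ?K) \<and> y \<in> V"
          using u e(2) by (intro exI[of _ "sphere_chart b u"]) (auto intro: image_eqI[of _ _ w])
      qed simp
    qed
  qed
qed

lemma continuous_map_fst_leaf_topology:
  "continuous_map (leaf_topology \<F> W) sphere_topology fst"
  unfolding continuous_map_def
proof (intro conjI allI impI)
  fix V assume V: "openin sphere_topology V"
  let ?P = "{q \<in> topspace (leaf_topology \<F> W). fst q \<in> V}"
  show "openin (leaf_topology \<F> W) ?P"
  proof (subst openin_subopen, intro ballI)
    fix q assume q: "q \<in> ?P"
    then have "q \<in> topspace (leaf_topology \<F> W)" by simp
    then obtain c U Z \<gamma> D t0 where g: "(c, U, Z) \<in> \<F>" "open D" "\<gamma> ` D \<subseteq> U" "chart c ` \<gamma> ` D \<subseteq> W"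
      "\<forall>t\<in>D. Z (\<gamma> t) \<noteq> 0 \<and> (\<gamma> has_derivative (\<lambda>h. cscale h (Z (\<gamma> t)))) (at t)"
      "t0 \<in> D" "q = chart c (\<gamma> t0)"
      by (rule topspace_leaf_topologyE)
    have contg: "continuous_on D \<gamma>"
      by (rule continuous_at_imp_continuous_on) (use g(5) has_derivative_continuous in blast)
    define D' where "D' = D \<inter> (\<lambda>t. fst (\<gamma> t)) -` (sphere_chart (fst c) -` V)"
    have "open D'" unfolding D'_def
      using V by (intro continuous_open_preimage continuous_intros contg g(2)) (simp add: openin_sphere_iff)
    then have O: "openin (leaf_topology \<F> W) (chart c ` \<gamma> ` D')"
      by (rule openin_leaf_topology[OF g(1)]) (use g(3-5) in \<open>auto simp: D'_def\<close>)
    moreover have "q \<in> chart c ` \<gamma> ` D'" using q g(6,7) by (auto simp: D'_def fst_chart)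
    moreover have "chart c ` \<gamma> ` D' \<subseteq> ?P"
      using openin_subset[OF O] by (auto simp: D'_def fst_chart)
    ultimately show "\<exists>T. openin (leaf_topology \<F> W) T \<and> q \<in> T \<and> T \<subseteq> ?P" by blast
  qed
qed auto

text \<open>Open sets of the leaf topology are generated from images of integral curves, so the
  claim follows by induction on their generation, with \<open>integral_curve_in_section\<close> for
  the generating sets.\<close>

lemma section_enters_leaf_open:
  fixes \<F> :: "'n::finite local_field set"
  assumes sf: "singular_foliation \<F>" and rc: "riccati_chart \<F> b t0 r A B C" and \<rho>: "\<rho> \<le> r"
    and flow: "\<And>i. riccati_flow t0 \<rho> (A i) (B i) (C i) (\<sigma> i)"
    and G: "openin (leaf_topology \<F> W) G"
  shows "\<forall>t1\<in>ball t0 \<rho>. riccati_section b \<sigma> f t1 \<in> G \<longrightarrow>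
    (\<exists>N. open N \<and> t1 \<in> N \<and> N \<subseteq> ball t0 \<rho> \<and> riccati_section b \<sigma> f ` N \<subseteq> G)"
proof -
  let ?s = "riccati_section b \<sigma> f"
  have "generate_topology_on {chart c ` \<gamma> ` D | c U Z \<gamma> D. (c, U, Z) \<in> \<F> \<and> open D \<and> \<gamma> ` D \<subseteq> U \<and> chart c ` \<gamma> ` D \<subseteq> W \<and>
        (\<forall>t\<in>D. Z (\<gamma> t) \<noteq> 0 \<and> (\<gamma> has_derivative (\<lambda>h. cscale h (Z (\<gamma> t)))) (at t))} G"
    using G unfolding leaf_topology_def by (rule openin_topology_generated_by)
  then show ?thesis
  proof (induction rule: generate_topology_on.induct)
    case Empty
    then show ?case by simp
  next
    case (Int a b)
    show ?case
    proof (intro ballI impI)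
      fix t1 assume t1: "t1 \<in> ball t0 \<rho>" "?s t1 \<in> a \<inter> b"
      obtain N1 where N1: "open N1" "t1 \<in> N1" "N1 \<subseteq> ball t0 \<rho>" "?s ` N1 \<subseteq> a"
        using Int.IH(1) t1 by auto
      obtain N2 where N2: "open N2" "t1 \<in> N2" "?s ` N2 \<subseteq> b"
        using Int.IH(2) t1 by auto
      show "\<exists>N. open N \<and> t1 \<in> N \<and> N \<subseteq> ball t0 \<rho> \<and> ?s ` N \<subseteq> a \<inter> b"
        using N1 N2 by (intro exI[of _ "N1 \<inter> N2"]) auto
    qed
  next
    case (UN K)
    show ?case
    proof (intro ballI impI)
      fix t1 assume t1: "t1 \<in> ball t0 \<rho>" "?s t1 \<in> \<Union>K"
      then obtain k where k: "k \<in> K" "?s t1 \<in> k" by blast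
      then obtain N where "open N" "t1 \<in> N" "N \<subseteq> ball t0 \<rho>" "?s ` N \<subseteq> k"
        using UN.IH[OF k(1)] t1(1) by auto
      then show "\<exists>N. open N \<and> t1 \<in> N \<and> N \<subseteq> ball t0 \<rho> \<and> ?s ` N \<subseteq> \<Union>K" using k(1) by blast
    qed
  next
    case (Basis a)
    then show ?case
      unfolding mem_Collect_eq
    proof (elim exE conjE, intro ballI impI)
      fix c U Z \<gamma> D t1
      assume *: "a = chart c ` \<gamma> ` D" "(c, U, Z) \<in> \<F>" "open D" "\<gamma> ` D \<subseteq> U"
        "\<forall>t\<in>D. Z (\<gamma> t) \<noteq> 0 \<and> (\<gamma> has_derivative (\<lambda>h. cscale h (Z (\<gamma> t)))) (at t)"
        "t1 \<in> ball t0 \<rho>" "?s t1 \<in> a"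
      then obtain \<tau>0 where "\<tau>0 \<in> D" "chart c (\<gamma> \<tau>0) = ?s t1" by auto
      from integral_curve_in_section[OF sf rc \<rho> flow *(6) *(2-5) this]
      show "\<exists>N. open N \<and> t1 \<in> N \<and> N \<subseteq> ball t0 \<rho> \<and> ?s ` N \<subseteq> a" unfolding *(1) .
    qed
  qed
qed

text \<open>Allows the discs obtained separately for the \<open>n\<close> fibre coordinates to be
  shrunk to a common one.\<close>

lemma riccati_flow_mono:
  assumes flow: "riccati_flow t0 \<rho>' A B C \<sigma>" and le: "\<rho> \<le> \<rho>'"
  shows "riccati_flow t0 \<rho> A B C \<sigma>"
proof -
  have sub: "ball t0 \<rho> \<subseteq> ball t0 \<rho>'" using le by (rule subset_ball)
  show ?thesis
    unfolding riccati_flow_def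
  proof (intro conjI)
    show "\<forall>t\<in>ball t0 \<rho>. \<forall>y. \<exists>!f. \<sigma> f t = y"
      using riccati_flowD(1)[OF flow] sub by blast
    show "\<forall>f. \<forall>t1\<in>ball t0 \<rho>. \<forall>b w1. \<sigma> f t1 = sphere_chart b w1 \<longrightarrow>
      (\<exists>N w. open N \<and> t1 \<in> N \<and> N \<subseteq> ball t0 \<rho> \<and> w t1 = w1 \<and>
         (\<forall>t\<in>N. \<sigma> f t = sphere_chart b (w t) \<and>
            (w has_field_derivative riccati_slope b (A t) (B t) (C t) (w t)) (at t)))"
    proof (intro allI ballI impI)
      fix f t1 b w1 assume t1: "t1 \<in> ball t0 \<rho>" "\<sigma> f t1 = sphere_chart b w1"
      have "t1 \<in> ball t0 \<rho>'" using t1(1) sub by blast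
      from riccati_flowD(2)[OF flow this t1(2)]
      obtain N w where "open N" "t1 \<in> N" "w t1 = w1"
         "\<forall>t\<in>N. \<sigma> f t = sphere_chart b (w t) \<and>
            (w has_field_derivative riccati_slope b (A t) (B t) (C t) (w t)) (at t)"
        by (elim exE conjE) (rule that)
      then show "\<exists>N w. open N \<and> t1 \<in> N \<and> N \<subseteq> ball t0 \<rho> \<and> w t1 = w1 \<and>
         (\<forall>t\<in>N. \<sigma> f t = sphere_chart b (w t) \<and>
            (w has_field_derivative riccati_slope b (A t) (B t) (C t) (w t)) (at t))"
        using t1(1) by (intro exI[of _ "N \<inter> ball t0 \<rho>"] exI[of _ w]) auto
    qed
    show "\<forall>f D \<tau>0 T \<zeta> b w. open D \<longrightarrow> \<tau>0 \<in> D \<longrightarrow> T ` D \<subseteq> ball t0 \<rho> \<longrightarrow> continuous_on D \<zeta> \<longrightarrow>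
      (\<forall>\<tau>\<in>D. (T has_field_derivative \<zeta> \<tau>) (at \<tau>)) \<longrightarrow>
      (\<forall>\<tau>\<in>D. (w has_field_derivative \<zeta> \<tau> * riccati_slope b (A (T \<tau>)) (B (T \<tau>)) (C (T \<tau>)) (w \<tau>)) (at \<tau>)) \<longrightarrow>
      \<sigma> f (T \<tau>0) = sphere_chart b (w \<tau>0) \<longrightarrow>
      (\<exists>e>0. ball \<tau>0 e \<subseteq> D \<and> (\<forall>\<tau>\<in>ball \<tau>0 e. \<sigma> f (T \<tau>) = sphere_chart b (w \<tau>)))"
      by (intro allI impI, rule riccati_flowD(3)[OF flow], assumption+, erule order_trans[OF _ sub]; assumption)
  qed
qed

lemma leaf_covering:
  fixes \<F> :: "'n::finite local_field set"
  assumes sf: "singular_foliation \<F>" and gX: "given_by \<F> X" "polynomial_field X"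
    and fin: "finite (vertical_base \<F>)"
    and L: "L \<in> leaves \<F> (- (fst -` vertical_base \<F>))"
  shows "covering_map (subtopology (leaf_topology \<F> (- (fst -` vertical_base \<F>))) L)
    (subtopology sphere_topology (- vertical_base \<F>)) fst"
proof -
  let ?B = "- vertical_base \<F>"
  let ?W = "- (fst -` vertical_base \<F>) :: 'n total set"
  let ?X = "leaf_topology \<F> ?W" and ?Y = "subtopology sphere_topology ?B"
  have tY: "topspace ?Y = ?B" by simp
  have tX: "topspace ?X \<subseteq> ?W"
    by (auto elim!: topspace_leaf_topologyE)
  have cont: "continuous_map ?X ?Y fst"
    using tX by (intro continuous_map_into_subtopology continuous_map_fst_leaf_topology) auto
  have conn: "connected_space ?Y"
    using connectedin_sphere_Compl_finite[OF fin] by (simp add: connectedin_def)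
  show ?thesis
  proof (rule covering_map_of_local_sections[where 'c="complex option ^ 'n", OF cont conn])
    show "L \<in> connected_components_of ?X" using L by (simp add: leaves_def)
    fix x0 assume "x0 \<in> topspace ?Y"
    then have x0: "x0 \<notin> vertical_base \<F>" by simp
    obtain b t0 r A B C where rc: "sphere_chart b t0 = x0" "riccati_chart \<F> b t0 r A B C"
      using riccati_chart_exists[OF sf gX fin x0] by (elim exE conjE) (rule that)
    have "\<forall>i. \<exists>\<rho> \<sigma>. 0 < \<rho> \<and> \<rho> \<le> r \<and> riccati_flow t0 \<rho> (A i) (B i) (C i) \<sigma>"
      using riccati_sections[OF riccati_chartD(1,3,4,5)[OF rc(2)]] by blast
    from choice[OF this] obtain \<rho>' where
      "\<forall>i. \<exists>\<sigma>. 0 < \<rho>' i \<and> \<rho>' i \<le> r \<and> riccati_flow t0 (\<rho>' i) (A i) (B i) (C i) \<sigma>" by blast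
    from choice[OF this] obtain \<sigma> where
      \<rho>': "\<forall>i. 0 < \<rho>' i \<and> \<rho>' i \<le> r \<and> riccati_flow t0 (\<rho>' i) (A i) (B i) (C i) (\<sigma> i)" by blast
    define \<rho> where "\<rho> = Min (range \<rho>')"
    have \<rho>: "\<rho> > 0" "\<rho> \<le> \<rho>' i" for i using \<rho>' by (auto simp: \<rho>_def)
    have \<rho>r: "\<rho> \<le> r" using \<rho>(2)[of undefined] spec[OF \<rho>', of undefined] by simp
    have flow: "riccati_flow t0 \<rho> (A i) (B i) (C i) (\<sigma> i)" for i
      by (rule riccati_flow_mono[of t0 "\<rho>' i"]) (use \<rho>' \<rho>(2) in blast)+
    define T where "T = sphere_chart b ` ball t0 \<rho>"
    \<comment> \<open>The sections as functions of the base point instead of its parameter. A vector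
      of sphere points labels a plaque, one Moebius label per fibre coordinate.\<close>
    define s where "s = (\<lambda>f x. riccati_section b \<sigma> f (inv (sphere_chart b) x))"
    have s: "s f (sphere_chart b t) = riccati_section b \<sigma> f t" for f t
    proof -
      have "inj (sphere_chart b)" by (simp add: inj_def sphere_chart_inj)
      then show ?thesis by (simp add: s_def)
    qed
    have TB: "T \<subseteq> ?B"
      using riccati_chartD(2)[OF rc(2)] \<rho>r by (auto simp: T_def)
    have enter: "\<exists>N. open N \<and> t1 \<in> N \<and> N \<subseteq> ball t0 \<rho> \<and> riccati_section b \<sigma> f ` N \<subseteq> G"
      if "openin ?X G" "t1 \<in> ball t0 \<rho>" "riccati_section b \<sigma> f t1 \<in> G" for G t1 f
      using section_enters_leaf_open[OF sf rc(2) \<rho>r flow that(1)] that(2,3) by blast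
    have plaque: "openin ?X (s f ` T)" for f
    proof (subst openin_subopen, intro ballI)
      fix q assume "q \<in> s f ` T"
      then obtain t where t: "t \<in> ball t0 \<rho>" "q = riccati_section b \<sigma> f t" by (auto simp: T_def s)
      from riccati_section_open[OF sf rc(2) \<rho>r flow t(1), of f]
      obtain N where N: "open N" "t \<in> N" "N \<subseteq> ball t0 \<rho>" "openin ?X (riccati_section b \<sigma> f ` N)"
        by (elim exE conjE) (rule that)
      have "riccati_section b \<sigma> f ` N \<subseteq> s f ` T"
        using N(3) by (auto simp: T_def image_image s)
      then show "\<exists>V. openin ?X V \<and> q \<in> V \<and> V \<subseteq> s f ` T" using N t(2) by blast
    qed
    have "openin ?Y T"
      unfolding openin_subtopology
      by (rule exI[of _ T]) (use TB in \<open>auto simp: T_def intro!: openin_sphere_chart_image\<close>)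
    moreover have "x0 \<in> T" using rc(1) \<rho>(1) by (auto simp: T_def)
    moreover have "connectedin ?Y T"
      unfolding connectedin_subtopology using TB
      by (auto simp: T_def intro!: connectedin_continuous_map_image[OF continuous_map_sphere_chart])
    moreover have "\<forall>q\<in>topspace ?X. fst q \<in> T \<longrightarrow> (\<exists>f. s f (fst q) = q)"
    proof (intro ballI impI)
      fix q :: "'n total" assume "fst q \<in> T"
      then obtain t where t: "t \<in> ball t0 \<rho>" "fst q = sphere_chart b t" by (auto simp: T_def)
      have "\<forall>i. \<exists>f. \<sigma> i f t = snd q $ i" using riccati_flowD(1)[OF flow t(1)] by blast
      then obtain f where "\<And>i. \<sigma> i (f i) t = snd q $ i" by metis
      then have "s (\<chi> i. f i) (fst q) = q"
        unfolding t(2) s by (simp add: riccati_section_def prod_eq_iff vec_eq_iff t(2))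
      then show "\<exists>f. s f (fst q) = q" by blast
    qed
    moreover have "\<forall>f. \<forall>x\<in>T. fst (s f x) = x"
      by (auto simp: T_def s riccati_section_def)
    moreover have "\<forall>f g. \<forall>x\<in>T. s f x = s g x \<longrightarrow> f = g"
    proof (intro allI ballI impI)
      fix f g x assume "x \<in> T" and eq: "s f x = s g x"
      then obtain t where t: "t \<in> ball t0 \<rho>" "x = sphere_chart b t" by (auto simp: T_def)
      have "\<sigma> i (f $ i) t = \<sigma> i (g $ i) t" for i
        using eq unfolding t(2) s by (simp add: riccati_section_def vec_eq_iff)
      then have "f $ i = g $ i" for i using riccati_flowD(1)[OF flow t(1)] by metis
      then show "f = g" by (simp add: vec_eq_iff)
    qed
    moreover have "\<forall>f. continuous_map (subtopology ?Y T) ?X (s f)"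
    proof
      fix f
      have tT: "topspace (subtopology ?Y T) = T" using TB by auto
      show "continuous_map (subtopology ?Y T) ?X (s f)"
        unfolding continuous_map_def tT
      proof (intro conjI allI impI)
        show "s f \<in> T \<rightarrow> topspace ?X" using openin_subset[OF plaque[of f]] by auto
        fix G assume G: "openin ?X G"
        have "openin sphere_topology {x \<in> T. s f x \<in> G}"
        proof (subst openin_subopen, intro ballI)
          fix x assume x: "x \<in> {x \<in> T. s f x \<in> G}"
          then obtain t where t: "t \<in> ball t0 \<rho>" "x = sphere_chart b t" by (auto simp: T_def)
          from enter[OF G t(1), of f] obtain N where N: "open N" "t \<in> N" "N \<subseteq> ball t0 \<rho>"
            "riccati_section b \<sigma> f ` N \<subseteq> G"
            using x t(2) by (auto simp: s)
          have "sphere_chart b ` N \<subseteq> {x \<in> T. s f x \<in> G}"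
            using N(3,4) by (auto simp: T_def s)
          then show "\<exists>V. openin sphere_topology V \<and> x \<in> V \<and> V \<subseteq> {x \<in> T. s f x \<in> G}"
            using openin_sphere_chart_image[OF N(1), of b] N(2) t(2) by blast
        qed
        then show "openin (subtopology ?Y T) {x \<in> T. s f x \<in> G}"
          using TB unfolding subtopology_subtopology openin_subtopology
          by (intro exI[of _ "{x \<in> T. s f x \<in> G}"]) auto
      qed
    qed
    ultimately show "\<exists>T (s :: complex option ^ 'n \<Rightarrow> complex option \<Rightarrow> 'n total). openin ?Y T \<and> x0 \<in> T \<and> connectedin ?Y T \<and>
      (\<forall>q\<in>topspace ?X. fst q \<in> T \<longrightarrow> (\<exists>f. s f (fst q) = q)) \<and>
      (\<forall>f. \<forall>x\<in>T. fst (s f x) = x) \<and>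
      (\<forall>f g. \<forall>x\<in>T. s f x = s g x \<longrightarrow> f = g) \<and>
      (\<forall>f. openin ?X (s f ` T)) \<and>
      (\<forall>f. continuous_map (subtopology ?Y T) ?X (s f))"
      by (intro exI[of _ T] exI[of _ s] conjI) (use plaque in auto)
  qed
qed

section \<open>The exceptional set and the conclusion\<close>

lemma transverse_off_vertical_fibres:
  fixes \<F> :: "'n::finite local_field set"
  assumes sf: "singular_foliation \<F>" and gX: "given_by \<F> X" "polynomial_field X"
    and fin: "finite (vertical_base \<F>)"
  shows "transverse_off \<F> (fst -` vertical_base \<F>)"
proof -
  let ?A = "fst -` vertical_base \<F> :: 'n total set"
  have nz: "fst (Z z) \<noteq> 0" if "(c, U, Z) \<in> \<F>" "z \<in> U" "chart c z \<in> - ?A" for c U Z z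
    using fst_generator_nonzero[OF that(1,2)] that(3) by simp
  have img: "fst ` (- ?A) = - vertical_base \<F>"
  proof
    show "- vertical_base \<F> \<subseteq> fst ` (- ?A)"
    proof
      fix x assume "x \<in> - vertical_base \<F>"
      then show "x \<in> fst ` (- ?A)" by (intro image_eqI[of _ _ "(x, undefined)"]) auto
    qed
  qed auto
  have "infinite (UNIV :: complex option set)"
    using infinite_UNIV_char_0[where 'a=complex] by (simp add: finite_option_UNIV)
  then obtain x where x: "x \<notin> vertical_base \<F>" using fin by (metis UNIV_eq_I)
  have "transverse_on \<F> (- ?A)"
    unfolding transverse_on_def
  proof (intro conjI)
    show "- ?A \<inter> sing \<F> = {}"
    proof (rule ccontr)
      assume "- ?A \<inter> sing \<F> \<noteq> {}"
      then obtain c U Z z where "(c, U, Z) \<in> \<F>" "z \<in> U" "Z z = 0" "chart c z \<in> - ?A"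
        unfolding sing_def by blast
      then show False using nz[of c U Z z] by simp
    qed
    show "\<forall>(c, U, Z)\<in>\<F>. \<forall>z\<in>U. chart c z \<in> - ?A \<longrightarrow> {cscale a (Z z) + v | a v. fst v = 0} = UNIV"
      unfolding spans_with_vertical_iff using nz by blast
    show "\<forall>L\<in>leaves \<F> (- ?A).
        covering_map (subtopology (leaf_topology \<F> (- ?A)) L) (subtopology sphere_topology (fst ` (- ?A))) fst"
      unfolding img using leaf_covering[OF assms] by blast
  qed
  moreover have "?A \<noteq> UNIV"
  proof -
    have "(x, undefined) \<notin> ?A" using x by simp
    then show ?thesis by blast
  qed
  ultimately show ?thesis
    unfolding transverse_off_def using analytic_subset_fibres[OF fin] by blast
qed

theorem theorem2:
  fixes \<F> :: "'n::finite local_field set"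
    and X :: "'n affine \<Rightarrow> 'n affine"
  assumes "singular_foliation \<F>"
    and "polynomial_field X"
    and "given_by \<F> X"
    and "transverse_to_almost_every_fiber \<F>"
  shows "riccati_foliation \<F> \<and>
    (\<exists>(p :: complex poly) (q :: 'n \<Rightarrow> nat \<Rightarrow> complex poly). \<forall>x y.
       X (x, y) =
         (poly p x,
          \<chi> i. poly (q i 2) x * (y $ i)\<^sup>2 + poly (q i 1) x * y $ i + poly (q i 0) x))"
proof
  let ?A = "fst -` vertical_base \<F> :: 'n total set"
  have min: "finite S \<and> vertical_base \<F> \<subseteq> S" if "transverse_off \<F> (fst -` S)" for S
  proof -
    have an: "analytic_subset (fst -` S :: 'n total set)" "(fst -` S :: 'n total set) \<noteq> UNIV"
      and tr: "transverse_on \<F> (- (fst -` S))"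
      using that by (auto simp: transverse_off_def)
    then have "S \<noteq> UNIV" by auto
    then show ?thesis using finite_base_of_analytic[OF an(1)] vertical_base_subset_if_transverse[OF tr] by blast
  qed
  obtain S where "transverse_off \<F> (fst -` S)"
    using assms(4) unfolding transverse_to_almost_every_fiber_def transverse_off_def by blast
  then have fin: "finite (vertical_base \<F>)" using min finite_subset by blast
  note off = transverse_off_vertical_fibres[OF assms(1,3,2) fin]
  \<comment> \<open>Being least, and not merely minimal, makes \<open>?A\<close> the only
    exceptional set, so the invariance of \<open>?A\<close> alone settles the Riccati
    property.\<close>
  have least: "?A \<subseteq> \<Lambda>" if off': "transverse_off \<F> \<Lambda>" for \<Lambda>
  proof -
    obtain S where "\<Lambda> = fst -` S" using off' by (auto simp: transverse_off_def)
    then show ?thesis using min[of S] off' by blast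
  qed
  have "exceptional_set \<F> ?A" unfolding exceptional_set_def using off least by blast
  moreover have "\<Lambda> = ?A" if "exceptional_set \<F> \<Lambda>" for \<Lambda>
    using that off least unfolding exceptional_set_def by blast
  ultimately show "riccati_foliation \<F>"
    unfolding riccati_foliation_def using assms(1,4) invariant_vertical_fibres[OF assms(1) fin] by blast
  show "\<exists>(p :: complex poly) (q :: 'n \<Rightarrow> nat \<Rightarrow> complex poly). \<forall>x y.
       X (x, y) =
         (poly p x,
          \<chi> i. poly (q i 2) x * (y $ i)\<^sup>2 + poly (q i 1) x * y $ i + poly (q i 0) x)"
    by (rule affine_field_riccati_form[OF assms(1,3,2) fin]) blast
qed

end
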